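(* Let $\psi:\mathbb D\to G/K=S^2_1$ be a harmonic map with $\psi(0,0)=K$ (i.e. $\psi(0,0)=\mathbf k'$), and let $\Psi$ be an extended framing of $\psi$. Then there exists an open subset $\mathbb D\setminus\mathcal S$ of $\mathbb D$ containing $(0,0)$ on which $\Psi$ splits into $$\Psi=\Psi_-L_+=\Psi_+L_-,\qquad \Psi_\pm\in\tilde\Lambda^{\pm}_*G_\sigma,\quad L_\pm\in\tilde\Lambda^{\pm}G_\sigma .$$ The 1-forms $\eta',\eta''$ defined by $$\eta'(x)=\lambda^{-1}\,\Psi_+^{-1}\mathrm d\Psi_+,\qquad \eta''(y)=\lambda\,\Psi_-^{-1}\mathrm d\Psi_-$$ are, respectively, an $\mathfrak m$-valued Lorentz holomorphic 1-form and an $\mathfrak m$-valued Lorentz anti-holomorphic 1-form on $\mathbb D\setminus\mathcal S$. Conversely, any harmonic map $\psi:\mathbb D\to G/K$ with $\psi(0,0)=K$ can be constructed from a pair of $\mathfrak m$-valued 1-forms $\eta',\eta''$ which are Lorentz holomorphic and Lorentz anti-holomorphic respectively. The harmonic map $\psi$ is constructed via the Weierstraß representation with potentials $$\xi'=\lambda\eta',\qquad \xi''=\lambda^{-1}\eta'' .$$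
   Context: $G=\mathrm{SL}(2;\mathbb R)$, $\mathfrak g=\mathfrak{sl}(2;\mathbb R)$ with $\langle X,Y\rangle=\frac12\mathrm{tr}(XY)$, $\mathbf k'=\mathrm{diag}(-1,1)$, $S^2_1=\{X\in\mathfrak g:\langle X,X\rangle=1\}$ with its induced Lorentz metric, $\mathrm{Ad}(g)X=gXg^{-1}$. $K$ is the subgroup of diagonal matrices of $G$, the isotropy group of $\mathbf k'$, so $S^2_1=G/K$. $\mathfrak k$ and $\mathfrak m$ are the subspaces of diagonal and of off-diagonal matrices in $\mathfrak g$. $\sigma$ denotes conjugation by $\mathbf k'$. Loop groups: $\Lambda G_\sigma$ is the Banach Lie group of loops $\gamma(\lambda)=\sum_{j\in\mathbb Z}\gamma_j\lambda^j$, $\lambda\in S^1$, with real $2\times2$ coefficients, $\sum_j|\gamma_j|<\infty$, $\det\gamma=1$ and $\sigma(\gamma(\lambda))=\gamma(-\lambda)$. $\tilde\Lambda G_\sigma$ is the subgroup of those $\gamma$ extending analytically to $\lambda\in\mathbb C^*$, with the topology induced from $\Lambda G_\sigma$. $\tilde\Lambda^{+}G_\sigma$ (resp. $\tilde\Lambda^{-}G_\sigma$) consists of the elements of $\tilde\Lambda G_\sigma$ with only powers $\lambda^j$, $j\ge0$ (resp. $j\le0$); $\tilde\Lambda^{\pm}_*G_\sigma$ consists of those elements of $\tilde\Lambda^\pm G_\sigma$ whose $\lambda^0$-coefficient is $\mathbf 1$. $\mathbb D$ is a simply connected region of the Minkowski plane $(\mathbb R^2(x,y),\mathrm dx\,\mathrm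 dy)$ containing the origin. A smooth map $\psi$ into $S^2_1$ is harmonic if its tension field with respect to $\mathrm dx\,\mathrm dy$ vanishes; equivalently $\psi_{xy}=\rho\,\psi$ for some function $\rho$. A 1-form is Lorentz holomorphic (resp. Lorentz anti-holomorphic) if it is of the form $A\,\mathrm dx$ with $\partial A/\partial y=0$ (resp. $A\,\mathrm dy$ with $\partial A/\partial x=0$). An extended framing of $\psi$ is a smooth map $\Psi=\Psi_\lambda:\mathbb D\to\tilde\Lambda G_\sigma$ with $\Psi_\lambda(0,0)=\mathbf 1$ for all $\lambda$, $\psi=\mathrm{Ad}(\Psi_1)\mathbf k'$, $\Psi^{-1}\Psi_x=A+\lambda B$ and $\Psi^{-1}\Psi_y=C+\lambda^{-1}D$, where $A,C$ are $\mathfrak k$-valued and $B,D$ are $\mathfrak m$-valued functions on $\mathbb D$ independent of $\lambda$. The set $\mathcal S\subset\mathbb D$ is the set of points $(x,y)$ at which $\Psi(x,y)$ fails to belong to at least one of the two big cells $\tilde\Lambda^-_*G_\sigma\cdot\tilde\Lambda^+G_\sigma$ and $\tilde\Lambda^+_*G_\sigma\cdot\tilde\Lambda^-G_\sigma$. Weierstraß representation with potentials $\xi',\xi''$: solve $\mathrm d'\Psi'=\Psi'\xi'$, $\mathrm d''\Psi''=\Psi''\xi''$ with $\Psi'(x=0)=\Psi''(y=0)=\mathbf 1$, where $\mathrm d'=\frac{\partial}{\partial x}\mathrm dx$, $\mathrm d''=\frac{\partial}{\partial y}\mathrm dy$; take the Iwasawa decomposition $(\Psi',\Psi'')=(\hat\Psi,\hat\Psi)(\ell_-^{-1},\ell_+^{-1})$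 with $\hat\Psi\in\tilde\Lambda G_\sigma$, $\ell_-\in\tilde\Lambda^-_*G_\sigma$, $\ell_+\in\tilde\Lambda^+G_\sigma$; then $\mathrm{Ad}(\hat\Psi_\lambda)\mathbf k'$, $\lambda\in\mathbb R^+$, is the loop of harmonic maps produced, and the harmonic map is its member at $\lambda=1$.
   Formalization: In the converse, η', η'' and the Weierstraß construction of ψ live on D∖S for an extended framing of ψ, not all of D (false for staircase-shaped D), and Ψ'(x=0)=Ψ''(y=0)=1 is required only on the parts of the axes joined to the origin inside D∖S. *)

theory Defs
  imports "HOL-Analysis.Analysis"
begin

section \<open>The Banach algebra of absolutely convergent loops\<close>

text \<open>A loop \<open>\<gamma>(\<lambda>) = \<Sum>\<^sub>j \<gamma>\<^sub>j \<lambda>\<^sup>j\<close> with real 2x2 coefficients and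
  \<open>\<Sum>\<^sub>j |\<gamma>\<^sub>j| < \<infinity>\<close> is represented by its coefficient family \<open>coeff \<gamma>\<close>; the product is the
  convolution of the families, i.e. the pointwise matrix product of loops. On \<^typ>\<open>real^2^2\<close> the
  library's \<open>*\<close> and \<open>1\<close> are componentwise, hence \<open>**\<close> and \<open>mat 1\<close> below.\<close>

type_synonym mat2 = "real^2^2"

typedef loop = "{c :: int \<Rightarrow> mat2. (\<lambda>j. norm (c j)) summable_on UNIV}"
  morphisms coeff Loop
  by (rule exI[of _ "\<lambda>_. 0"]) simp

setup_lifting type_definition_loop

lemma coeff_abs_summable: "(\<lambda>j. norm (coeff a j)) summable_on UNIV"
  using coeff[of a] by simp

lemma loop_eqI: "(\<And>n. coeff a n = coeff b n) \<Longrightarrow> a = b"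
  by (simp add: coeff_inject[symmetric] fun_eq_iff)

subsection \<open>Normed vector space structure\<close>

lemma abs_summable_add:
  fixes a b :: "int \<Rightarrow> mat2"
  assumes "(\<lambda>j. norm (a j)) summable_on UNIV" "(\<lambda>j. norm (b j)) summable_on UNIV"
  shows "(\<lambda>j. norm (a j + b j)) summable_on UNIV"
  by (rule summable_on_comparison_test[OF summable_on_add[OF assms]])
    (simp_all only: norm_triangle_ineq norm_ge_zero)

instantiation loop :: real_vector
begin

lift_definition zero_loop :: loop is "\<lambda>_. 0" by simp

lift_definition plus_loop :: "loop \<Rightarrow> loop \<Rightarrow> loop" is "\<lambda>a b j. a j + b j"
  by (rule abs_summable_add)

lift_definition uminus_loop :: "loop \<Rightarrow> loop" is "\<lambda>a j. - a j" by simp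

definition minus_loop :: "loop \<Rightarrow> loop \<Rightarrow> loop" where "minus_loop a b = a + - b"

lift_definition scaleR_loop :: "real \<Rightarrow> loop \<Rightarrow> loop" is "\<lambda>r a j. r *\<^sub>R a j"
  unfolding norm_scaleR by (rule summable_on_cmult_right)

instance
proof
  fix a b c :: loop and r t :: real
  show "a + b + c = a + (b + c)" by (rule loop_eqI) (simp add: plus_loop.rep_eq)
  show "a + b = b + a" by (rule loop_eqI) (simp add: plus_loop.rep_eq)
  show "0 + a = a" by (rule loop_eqI) (simp add: plus_loop.rep_eq zero_loop.rep_eq)
  show "- a + a = 0"
    by (rule loop_eqI) (simp add: plus_loop.rep_eq zero_loop.rep_eq uminus_loop.rep_eq)
  show "a - b = a + - b" by (rule minus_loop_def)
  show "r *\<^sub>R (a + b) = r *\<^sub>R a + r *\<^sub>R b"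
    by (rule loop_eqI) (simp add: plus_loop.rep_eq scaleR_loop.rep_eq scaleR_add_right)
  show "(r + t) *\<^sub>R a = r *\<^sub>R a + t *\<^sub>R a"
    by (rule loop_eqI) (simp add: plus_loop.rep_eq scaleR_loop.rep_eq scaleR_add_left)
  show "r *\<^sub>R t *\<^sub>R a = (r * t) *\<^sub>R a" by (rule loop_eqI) (simp add: scaleR_loop.rep_eq)
  show "1 *\<^sub>R a = a" by (rule loop_eqI) (simp add: scaleR_loop.rep_eq)
qed

end

lemma coeff_minus: "coeff (a - b) j = coeff a j - coeff b j"
  unfolding minus_loop_def plus_loop.rep_eq uminus_loop.rep_eq by simp

instantiation loop :: real_normed_vector
begin

definition norm_loop :: "loop \<Rightarrow> real"
  where "norm_loop a = (\<Sum>\<^sub>\<infinity>j. norm (coeff a j))"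

definition dist_loop :: "loop \<Rightarrow> loop \<Rightarrow> real" where "dist_loop a b = norm (a - b)"

definition sgn_loop :: "loop \<Rightarrow> loop" where "sgn_loop a = inverse (norm a) *\<^sub>R a"

definition uniformity_loop :: "(loop \<times> loop) filter"
  where "uniformity_loop = (INF e\<in>{0<..}. principal {(x, y). dist x y < e})"

definition open_loop :: "loop set \<Rightarrow> bool"
  where "open_loop U \<longleftrightarrow> (\<forall>x\<in>U. \<forall>\<^sub>F (x', y) in uniformity. x' = x \<longrightarrow> y \<in> U)"

instance
proof
  fix a b :: loop and r :: real
  show "norm a = 0 \<longleftrightarrow> a = 0"
  proof
    assume "norm a = 0"
    then have "norm (coeff a j) = 0" for j
      using nonneg_infsum_le_0D[of "\<lambda>j. norm (coeff a j)" UNIV j] coeff_abs_summable[of a]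
      by (simp add: norm_loop_def)
    then show "a = 0" by (intro loop_eqI) (simp add: zero_loop.rep_eq)
  qed (simp add: norm_loop_def zero_loop.rep_eq)
  have "norm (a + b) \<le> (\<Sum>\<^sub>\<infinity>j. norm (coeff a j) + norm (coeff b j))"
    unfolding norm_loop_def
    by (rule infsum_mono[OF coeff_abs_summable summable_on_add[OF coeff_abs_summable coeff_abs_summable]])
      (simp add: plus_loop.rep_eq norm_triangle_ineq)
  also have "\<dots> = norm a + norm b"
    unfolding norm_loop_def by (rule infsum_add) (rule coeff_abs_summable)+
  finally show "norm (a + b) \<le> norm a + norm b" .
  show "norm (r *\<^sub>R a) = \<bar>r\<bar> * norm a"
    by (simp add: norm_loop_def scaleR_loop.rep_eq infsum_cmult_right')
  show "dist a b = norm (a - b)" by (rule dist_loop_def)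
  show "sgn a = a /\<^sub>R norm a" by (rule sgn_loop_def)
  show "uniformity = (INF e\<in>{0<..}. principal {(x :: loop, y). dist x y < e})"
    by (rule uniformity_loop_def)
  show "open U \<longleftrightarrow> (\<forall>x\<in>U. \<forall>\<^sub>F (x', y) in uniformity. x' = x \<longrightarrow> y \<in> U)" for U :: "loop set"
    by (rule open_loop_def)
qed

end

subsection \<open>Algebra structure\<close>

lemma norm_matrix_mult_le:
  fixes A :: "real^'n^'m" and B :: "real^'p^'n"
  shows "norm (A ** B) \<le> norm A * norm B"
proof -
  have sq: "(norm M)\<^sup>2 = (\<Sum>i\<in>UNIV. (norm (M $ i))\<^sup>2)" for M :: "real^'a^'b"
    by (simp add: norm_vec_def L2_set_def sum_nonneg)
  have tr: "(norm M)\<^sup>2 = (norm (transpose M))\<^sup>2" for M :: "real^'a^'b"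
    by (simp add: norm_vec_def L2_set_def sum_nonneg transpose_def) (rule sum.swap)
  have "(norm (A ** B))\<^sup>2 = (\<Sum>i\<in>UNIV. \<Sum>j\<in>UNIV. (A $ i \<bullet> transpose B $ j)\<^sup>2)"
    by (simp add: norm_vec_def L2_set_def sum_nonneg matrix_matrix_mult_def inner_vec_def
        transpose_def)
  also have "\<dots> \<le> (\<Sum>i\<in>UNIV. \<Sum>j\<in>UNIV. (norm (A $ i))\<^sup>2 * (norm (transpose B $ j))\<^sup>2)"
    by (intro sum_mono) (metis Cauchy_Schwarz_ineq power2_norm_eq_inner)
  also have "\<dots> = (norm A)\<^sup>2 * (norm (transpose B))\<^sup>2"
    unfolding sq by (simp add: sum_product)
  also have "\<dots> = (norm A * norm B)\<^sup>2" by (simp add: tr[symmetric] power_mult_distrib)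
  finally show ?thesis by (rule power2_le_imp_le) simp
qed

lemma matrix_bilinear: "bounded_bilinear ((**) :: mat2 \<Rightarrow> mat2 \<Rightarrow> mat2)"
proof
  show "\<exists>K. \<forall>(A::mat2) (B::mat2). norm (A ** B) \<le> norm A * norm B * K"
    by (rule exI[of _ 1]) (simp add: norm_matrix_mult_le)
qed (simp_all add: matrix_matrix_mult_def vec_eq_iff sum.distrib algebra_simps sum_distrib_left)

lemma summable_conv_Sigma:
  fixes a b :: "int \<Rightarrow> mat2"
  assumes "(\<lambda>j. norm (a j)) summable_on UNIV" "(\<lambda>j. norm (b j)) summable_on UNIV"
  shows "(\<lambda>(n, j). norm (a j) * norm (b (n - j))) summable_on (UNIV \<times> UNIV)"
proof -
  have "(\<lambda>p. norm (case p of (j, k) \<Rightarrow> norm (a j) * norm (b k))) summable_on (UNIV \<times> UNIV)"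
    unfolding Infinite_Sum.abs_summable_on_Sigma_iff using assms
    by (auto simp: abs_mult infsum_cmult_right' infsum_nonneg
        intro!: summable_on_cmult_right summable_on_cmult_left)
  then have "(\<lambda>(j, k). norm (a j) * norm (b k)) summable_on (UNIV \<times> UNIV)"
    by (rule abs_summable_summable)
  then show ?thesis
    by (subst summable_on_reindex_bij_witness[of _ "\<lambda>(j, k). (j + k, j)" "\<lambda>(n, j). (j, n - j)"
          "UNIV \<times> UNIV" "\<lambda>(j, k). norm (a j) * norm (b k)"]) auto
qed

lemma summable_conv:
  fixes a b :: "int \<Rightarrow> mat2"
  assumes "(\<lambda>j. norm (a j)) summable_on UNIV" "(\<lambda>j. norm (b j)) summable_on UNIV"
  shows "(\<lambda>j. norm (a j) * norm (b (n - j))) summable_on UNIV"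
    and "(\<lambda>j. norm (a j ** b (n - j))) summable_on UNIV"
    and "(\<lambda>j. a j ** b (n - j)) summable_on UNIV"
    and "(\<lambda>n. \<Sum>\<^sub>\<infinity>j. norm (a j) * norm (b (n - j))) summable_on UNIV"
    and "norm (\<Sum>\<^sub>\<infinity>j. a j ** b (n - j)) \<le> (\<Sum>\<^sub>\<infinity>j. norm (a j) * norm (b (n - j)))"
proof -
  let ?f = "\<lambda>n j. norm (a j) * norm (b (n - j))"
  have s: "(\<lambda>(n, j). ?f n j) summable_on Sigma UNIV (\<lambda>_. UNIV)"
    using summable_conv_Sigma[OF assms] by simp
  show 1: "(\<lambda>j. ?f n j) summable_on UNIV"
    using summable_on_SigmaD1[OF s, of n] by simp
  show 2: "(\<lambda>j. norm (a j ** b (n - j))) summable_on UNIV"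
    by (rule summable_on_comparison_test[OF 1]) (auto intro: norm_matrix_mult_le)
  then show "(\<lambda>j. a j ** b (n - j)) summable_on UNIV" by (rule abs_summable_summable)
  show "(\<lambda>n. \<Sum>\<^sub>\<infinity>j. ?f n j) summable_on UNIV"
    using summable_on_Sigma_banach[OF s] by simp
  have "norm (\<Sum>\<^sub>\<infinity>j. a j ** b (n - j)) \<le> (\<Sum>\<^sub>\<infinity>j. norm (a j ** b (n - j)))"
    using 2 by (rule norm_infsum_bound)
  also have "\<dots> \<le> (\<Sum>\<^sub>\<infinity>j. ?f n j)"
    by (rule infsum_mono[OF 2 1]) (rule norm_matrix_mult_le)
  finally show "norm (\<Sum>\<^sub>\<infinity>j. a j ** b (n - j)) \<le> (\<Sum>\<^sub>\<infinity>j. ?f n j)" .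
qed

instantiation loop :: "{times, one}"
begin

lift_definition times_loop :: "loop \<Rightarrow> loop \<Rightarrow> loop"
  is "\<lambda>a b n. \<Sum>\<^sub>\<infinity>j. a j ** b (n - j)"
  subgoal for a b
    by (rule summable_on_comparison_test[OF summable_conv(4)[of a b]])
      (auto intro: summable_conv(5)[of a b])
  done

lift_definition one_loop :: loop is "\<lambda>j. if j = 0 then mat 1 else 0"
  by (rule finite_nonzero_values_imp_summable_on, rule finite_subset[of _ "{0}"]) auto

instance ..

end

lemma infsum_linear_image:
  assumes "bounded_linear h" "f summable_on A"
  shows "(\<Sum>\<^sub>\<infinity>x\<in>A. h (f x)) = h (infsum f A)"
  by (rule infsumI, rule has_sum_bounded_linear[OF assms(1)], rule has_sum_infsum[OF assms(2)])

lemma conv_assoc: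
  fixes a b c :: "int \<Rightarrow> mat2"
  assumes a: "(\<lambda>j. norm (a j)) summable_on UNIV" and b: "(\<lambda>j. norm (b j)) summable_on UNIV"
    and c: "(\<lambda>j. norm (c j)) summable_on UNIV"
  shows "(\<Sum>\<^sub>\<infinity>j. (\<Sum>\<^sub>\<infinity>i. a i ** b (j - i)) ** c (n - j))
       = (\<Sum>\<^sub>\<infinity>i. a i ** (\<Sum>\<^sub>\<infinity>j. b j ** c (n - i - j)))"
proof -
  interpret bounded_bilinear "(**) :: mat2 \<Rightarrow> mat2 \<Rightarrow> mat2" by (rule matrix_bilinear)
  let ?F = "\<lambda>(j, i). norm (a i) * norm (b (j - i)) * (\<Sum>\<^sub>\<infinity>k. norm (c k))"
  have cle: "norm (c k) \<le> (\<Sum>\<^sub>\<infinity>k. norm (c k))" for k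
    using finite_sum_le_infsum[OF c, of "{k}"] by simp
  have le: "norm (a i ** b (j - i) ** c (n - j))
      \<le> norm (a i) * norm (b (j - i)) * (\<Sum>\<^sub>\<infinity>k. norm (c k))" for i j
    using norm_matrix_mult_le[of "a i ** b (j - i)" "c (n - j)"]
      mult_mono[OF norm_matrix_mult_le[of "a i" "b (j - i)"] cle[of "n - j"]]
    by simp
  have "?F summable_on (UNIV \<times> UNIV)"
    using summable_on_cmult_left[OF summable_conv_Sigma[OF a b]] by (simp add: case_prod_unfold)
  then have "(\<lambda>(j, i). norm (a i ** b (j - i) ** c (n - j))) summable_on (UNIV \<times> UNIV)"
    by (rule summable_on_comparison_test) (auto simp: le)
  then have s: "(\<lambda>(j, i). a i ** b (j - i) ** c (n - j)) summable_on (UNIV \<times> UNIV)"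
    using abs_summable_summable[of "\<lambda>(j, i). a i ** b (j - i) ** c (n - j)" "UNIV \<times> UNIV"]
    by (simp add: case_prod_unfold)
  have l: "(\<Sum>\<^sub>\<infinity>i. a i ** b (j - i)) ** c (n - j) = (\<Sum>\<^sub>\<infinity>i. a i ** b (j - i) ** c (n - j))" for j
    by (rule infsum_linear_image[OF bounded_linear_left summable_conv(3)[OF a b], symmetric])
  have q: "a i ** (\<Sum>\<^sub>\<infinity>j. b j ** c (n - i - j)) = (\<Sum>\<^sub>\<infinity>j. a i ** (b j ** c (n - i - j)))" for i
    by (rule infsum_linear_image[OF bounded_linear_right summable_conv(3)[OF b c], symmetric])
  have e: "(\<Sum>\<^sub>\<infinity>j. a i ** b (j - i) ** c (n - j)) = (\<Sum>\<^sub>\<infinity>j. a i ** (b j ** c (n - i - j)))" for i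
    by (rule infsum_reindex_bij_witness[where i = "\<lambda>j. j + i" and j = "\<lambda>j. j - i"])
      (auto simp: matrix_mul_assoc algebra_simps)
  show ?thesis
    unfolding l q e[symmetric] by (rule infsum_swap_banach[OF s])
qed

instance loop :: "{real_normed_algebra, ring_1}"
proof
  interpret B: bounded_bilinear "(**) :: mat2 \<Rightarrow> mat2 \<Rightarrow> mat2" by (rule matrix_bilinear)
  fix a b c :: loop and r :: real
  note S = coeff_abs_summable
  show "a * b * c = a * (b * c)"
    by (rule loop_eqI) (simp add: times_loop.rep_eq conv_assoc[OF S S S])
  show "(a + b) * c = a * c + b * c"
    by (rule loop_eqI)
      (simp add: times_loop.rep_eq plus_loop.rep_eq B.add_left infsum_add summable_conv(3)[OF S S])
  show "a * (b + c) = a * b + a * c"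
    by (rule loop_eqI)
      (simp add: times_loop.rep_eq plus_loop.rep_eq B.add_right infsum_add summable_conv(3)[OF S S])
  show "r *\<^sub>R a * b = r *\<^sub>R (a * b)"
    by (rule loop_eqI)
      (simp add: times_loop.rep_eq scaleR_loop.rep_eq B.scaleR_left infsum_scaleR_right)
  show "a * r *\<^sub>R b = r *\<^sub>R (a * b)"
    by (rule loop_eqI)
      (simp add: times_loop.rep_eq scaleR_loop.rep_eq B.scaleR_right infsum_scaleR_right)
  show "1 * a = a"
  proof (rule loop_eqI)
    fix n
    have "coeff (1 * a) n = (\<Sum>\<^sub>\<infinity>j. (if j = 0 then mat 1 else 0) ** coeff a (n - j))"
      by (simp add: times_loop.rep_eq one_loop.rep_eq)
    also have "\<dots> = (\<Sum>\<^sub>\<infinity>j\<in>{0::int}. coeff a n)"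
      by (rule infsum_cong_neutral) (auto simp: B.zero_left)
    finally show "coeff (1 * a) n = coeff a n" by simp
  qed
  show "a * 1 = a"
  proof (rule loop_eqI)
    fix n
    have "coeff (a * 1) n = (\<Sum>\<^sub>\<infinity>j. coeff a j ** (if n - j = 0 then mat 1 else 0))"
      by (simp add: times_loop.rep_eq one_loop.rep_eq)
    also have "\<dots> = (\<Sum>\<^sub>\<infinity>j\<in>{n}. coeff a n)"
      by (rule infsum_cong_neutral) (auto simp: B.zero_right)
    finally show "coeff (a * 1) n = coeff a n" by simp
  qed
  have "coeff (0::loop) 0 \<noteq> coeff 1 0"
    by (simp add: zero_loop.rep_eq one_loop.rep_eq vec_eq_iff mat_def)
  then show "(0::loop) \<noteq> 1" by metis
  let ?f = "\<lambda>n j. norm (coeff a j) * norm (coeff b (n - j))"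
  have "norm (a * b) \<le> (\<Sum>\<^sub>\<infinity>n. \<Sum>\<^sub>\<infinity>j. ?f n j)"
    unfolding norm_loop_def
    by (intro infsum_mono S summable_conv(4)[OF S S])
      (simp add: times_loop.rep_eq summable_conv(5)[OF S S])
  also have "\<dots> = (\<Sum>\<^sub>\<infinity>j. \<Sum>\<^sub>\<infinity>n. ?f n j)"
    by (rule infsum_swap_banach[OF summable_conv_Sigma[OF S S]])
  also have "\<dots> = (\<Sum>\<^sub>\<infinity>j. \<Sum>\<^sub>\<infinity>n. norm (coeff a j) * norm (coeff b n))"
    by (intro infsum_cong infsum_reindex_bij_witness[where i = "\<lambda>n. n + j" and j = "\<lambda>n. n - j" for j])
      auto
  also have "\<dots> = norm a * norm b"
    by (simp add: norm_loop_def infsum_cmult_right' infsum_cmult_left')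
  finally show "norm (a * b) \<le> norm a * norm b" .
qed

text \<open>\<open>lmonom k X\<close> is the loop \<open>X \<lambda>\<^sup>k\<close>; \<open>lpow k\<close> is the scalar loop \<open>\<lambda>\<^sup>k\<close>.\<close>

lift_definition lmonom :: "int \<Rightarrow> mat2 \<Rightarrow> loop" is "\<lambda>k X j. if j = k then X else 0"
  subgoal for k X
    by (rule finite_nonzero_values_imp_summable_on, rule finite_subset[of _ "{k}"]) auto
  done

abbreviation lpow :: "int \<Rightarrow> loop" where "lpow k \<equiv> lmonom k (mat 1)"

definition linv :: "loop \<Rightarrow> loop"
  where "linv \<gamma> = (THE \<delta>. \<gamma> * \<delta> = 1 \<and> \<delta> * \<gamma> = 1)"

text \<open>The value \<open>\<gamma>(\<lambda>)\<close>, for real or complex \<open>\<lambda>\<close>.\<close>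

definition loop_at :: "loop \<Rightarrow> 'a::real_normed_field \<Rightarrow> 'a^2^2"
  where "loop_at \<gamma> z = (\<chi> a b. \<Sum>\<^sub>\<infinity>j. of_real (coeff \<gamma> j $ a $ b) * z powi j)"

section \<open>The symmetric space and the loop groups\<close>

definition kmat :: "'a::ring_1^2^2"
  where "kmat = vector [vector [-1, 0], vector [0, 1]]"

definition Ad :: "'a::semiring_1^2^2 \<Rightarrow> 'a^2^2 \<Rightarrow> 'a^2^2"
  where "Ad g X = g ** X ** matrix_inv g"

definition \<sigma> :: "'a::ring_1^2^2 \<Rightarrow> 'a^2^2"
  where "\<sigma> = Ad kmat"

definition ip :: "mat2 \<Rightarrow> mat2 \<Rightarrow> real"
  where "ip X Y = trace (X ** Y) / 2"

definition S21 :: "mat2 set"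
  where "S21 = {X. trace X = 0 \<and> ip X X = 1}"

definition k_sub :: "mat2 set"
  where "k_sub = {X. trace X = 0 \<and> X $ 1 $ 2 = 0 \<and> X $ 2 $ 1 = 0}"

definition m_sub :: "mat2 set"
  where "m_sub = {X. trace X = 0 \<and> X $ 1 $ 1 = 0 \<and> X $ 2 $ 2 = 0}"

definition LG :: "loop set"
  where "LG = {\<gamma>. \<forall>z::complex. norm z = 1 \<longrightarrow>
            det (loop_at \<gamma> z) = 1 \<and> \<sigma> (loop_at \<gamma> z) = loop_at \<gamma> (- z)}"

definition tLG :: "loop set"
  where "tLG = {\<gamma>\<in>LG. \<exists>F :: complex \<Rightarrow> complex^2^2.
            (\<forall>a b. (\<lambda>z. F z $ a $ b) holomorphic_on (- {0})) \<and>
            (\<forall>z. norm z = 1 \<longrightarrow> F z = loop_at \<gamma> z)}"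

definition tLG_plus :: "loop set"
  where "tLG_plus = {\<gamma>\<in>tLG. \<forall>j<0. coeff \<gamma> j = 0}"

definition tLG_minus :: "loop set"
  where "tLG_minus = {\<gamma>\<in>tLG. \<forall>j>0. coeff \<gamma> j = 0}"

definition tLG_plus_star :: "loop set"
  where "tLG_plus_star = {\<gamma>\<in>tLG_plus. coeff \<gamma> 0 = mat 1}"

definition tLG_minus_star :: "loop set"
  where "tLG_minus_star = {\<gamma>\<in>tLG_minus. coeff \<gamma> 0 = mat 1}"

definition big_cell_minus_plus :: "loop set"
  where "big_cell_minus_plus = {\<alpha> * \<beta> | \<alpha> \<beta>. \<alpha> \<in> tLG_minus_star \<and> \<beta> \<in> tLG_plus}"

definition big_cell_plus_minus :: "loop set"
  where "big_cell_plus_minus = {\<alpha> * \<beta> | \<alpha> \<beta>. \<alpha> \<in> tLG_plus_star \<and> \<beta> \<in> tLG_minus}"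

section \<open>Calculus on the Minkowski plane\<close>

type_synonym plane = "real \<times> real"

text \<open>Smoothness on an open set, for maps into a normed space. Maps into the loop groups are smooth
  when they are smooth as maps into the ambient Banach algebra \<^typ>\<open>loop\<close>: \<open>\<Lambda>G\<^sub>\<sigma>\<close> is a closed
  submanifold of it, and \<open>tLG\<close> carries the topology induced from \<open>\<Lambda>G\<^sub>\<sigma>\<close>.\<close>

primrec Ck_on :: "nat \<Rightarrow> plane set \<Rightarrow> (plane \<Rightarrow> 'b::real_normed_vector) \<Rightarrow> bool" where
  "Ck_on 0 U f \<longleftrightarrow> continuous_on U f"
| "Ck_on (Suc n) U f \<longleftrightarrow> (\<exists>fx fy.
     (\<forall>p\<in>U. (f has_derivative (\<lambda>h. fst h *\<^sub>R fx p + snd h *\<^sub>R fy p)) (at p)) \<and>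
     Ck_on n U fx \<and> Ck_on n U fy)"

definition smooth_on :: "plane set \<Rightarrow> (plane \<Rightarrow> 'b::real_normed_vector) \<Rightarrow> bool"
  where "smooth_on U f \<longleftrightarrow> (\<forall>n. Ck_on n U f)"

definition pdx :: "(plane \<Rightarrow> 'b::real_normed_vector) \<Rightarrow> plane \<Rightarrow> 'b"
  where "pdx f p = vector_derivative (\<lambda>t. f (t, snd p)) (at (fst p))"

definition pdy :: "(plane \<Rightarrow> 'b::real_normed_vector) \<Rightarrow> plane \<Rightarrow> 'b"
  where "pdy f p = vector_derivative (\<lambda>t. f (fst p, t)) (at (snd p))"

text \<open>A 1-form assigns to a point a linear function of the tangent vector.\<close>

type_synonym 'b one_form = "plane \<Rightarrow> plane \<Rightarrow> 'b"

definition ext_d :: "(plane \<Rightarrow> 'b::real_normed_vector) \<Rightarrow> 'b one_form"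
  where "ext_d f p = frechet_derivative f (at p)"

definition d1 :: "(plane \<Rightarrow> 'b::real_normed_vector) \<Rightarrow> 'b one_form"
  where "d1 f p h = fst h *\<^sub>R pdx f p"

definition d2 :: "(plane \<Rightarrow> 'b::real_normed_vector) \<Rightarrow> 'b one_form"
  where "d2 f p h = snd h *\<^sub>R pdy f p"

definition lorentz_holomorphic :: "plane set \<Rightarrow> mat2 one_form \<Rightarrow> bool"
  where "lorentz_holomorphic U \<omega> \<longleftrightarrow> (\<exists>A. smooth_on U A \<and>
           (\<forall>p\<in>U. (\<forall>h. \<omega> p h = fst h *\<^sub>R A p) \<and> pdy A p = 0))"

definition lorentz_antiholomorphic :: "plane set \<Rightarrow> mat2 one_form \<Rightarrow> bool"
  where "lorentz_antiholomorphic U \<omega> \<longleftrightarrow> (\<exists>A. smooth_on U A \<and>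
           (\<forall>p\<in>U. (\<forall>h. \<omega> p h = snd h *\<^sub>R A p) \<and> pdx A p = 0))"

definition valued_in :: "plane set \<Rightarrow> 'b set \<Rightarrow> 'b one_form \<Rightarrow> bool"
  where "valued_in U V \<omega> \<longleftrightarrow> (\<forall>p\<in>U. \<forall>h. \<omega> p h \<in> V)"

section \<open>Harmonic maps, extended framings and the Weierstrass representation\<close>

text \<open>The Levi-Civita connection of \<open>S\<^sup>2\<^sub>1\<close> is the tangential part \<open>Z - \<langle>Z,X\<rangle>X\<close> of
  the flat derivative in \<open>sl(2;\<real>)\<close>. The metric \<open>dx dy\<close> has \<open>g\<^sup>x\<^sup>x = g\<^sup>y\<^sup>y = 0\<close>,
  \<open>g\<^sup>x\<^sup>y = g\<^sup>y\<^sup>x = 2\<close> and vanishing Christoffel symbols, so the trace of the second fundamental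
  form is 4 times its \<open>xy\<close>-component.\<close>

definition tangential :: "mat2 \<Rightarrow> mat2 \<Rightarrow> mat2"
  where "tangential X Z = Z - ip Z X *\<^sub>R X"

definition tension_field :: "(plane \<Rightarrow> mat2) \<Rightarrow> plane \<Rightarrow> mat2"
  where "tension_field \<psi> p = 4 *\<^sub>R tangential (\<psi> p) (pdx (pdy \<psi>) p)"

definition harmonic_map :: "plane set \<Rightarrow> (plane \<Rightarrow> mat2) \<Rightarrow> bool"
  where "harmonic_map U \<psi> \<longleftrightarrow> smooth_on U \<psi> \<and> \<psi> ` U \<subseteq> S21 \<and> (\<forall>p\<in>U. tension_field \<psi> p = 0)"

definition extended_framing :: "plane set \<Rightarrow> (plane \<Rightarrow> mat2) \<Rightarrow> (plane \<Rightarrow> loop) \<Rightarrow> bool"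
  where "extended_framing U \<psi> \<Psi> \<longleftrightarrow>
     smooth_on U \<Psi> \<and> \<Psi> ` U \<subseteq> tLG \<and> \<Psi> (0, 0) = 1 \<and>
     (\<forall>p\<in>U. \<psi> p = Ad (loop_at (\<Psi> p) 1) kmat) \<and>
     (\<exists>A B C E. \<forall>p\<in>U. A p \<in> k_sub \<and> B p \<in> m_sub \<and> C p \<in> k_sub \<and> E p \<in> m_sub \<and>
        linv (\<Psi> p) * pdx \<Psi> p = lmonom 0 (A p) + lmonom 1 (B p) \<and>
        linv (\<Psi> p) * pdy \<Psi> p = lmonom 0 (C p) + lmonom (-1) (E p))"

definition sing_set :: "plane set \<Rightarrow> (plane \<Rightarrow> loop) \<Rightarrow> plane set"
  where "sing_set U \<Psi> = {p\<in>U. \<Psi> p \<notin> big_cell_minus_plus \<or> \<Psi> p \<notin> big_cell_plus_minus}"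

definition splits_on ::
  "plane set \<Rightarrow> (plane \<Rightarrow> loop) \<Rightarrow> (plane \<Rightarrow> loop) \<Rightarrow> (plane \<Rightarrow> loop) \<Rightarrow>
   (plane \<Rightarrow> loop) \<Rightarrow> (plane \<Rightarrow> loop) \<Rightarrow> bool"
  where "splits_on U \<Psi> \<Psi>m Lp \<Psi>p Lm \<longleftrightarrow> (\<forall>p\<in>U.
     \<Psi>m p \<in> tLG_minus_star \<and> Lp p \<in> tLG_plus \<and> \<Psi>p p \<in> tLG_plus_star \<and> Lm p \<in> tLG_minus \<and>
     \<Psi> p = \<Psi>m p * Lp p \<and> \<Psi> p = \<Psi>p p * Lm p)"

text \<open>Here \<open>\<Psi>1\<close>, \<open>\<Psi>2\<close> stand for \<open>\<Psi>'\<close>, \<open>\<Psi>''\<close>. The set \<open>U\<close> need not be a product of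
  intervals, so it is spelled out that \<open>\<Psi>'\<close> depends on \<open>x\<close> only and \<open>\<Psi>''\<close> on \<open>y\<close> only, in the
  same (local) sense in which the potentials do; the initial conditions are imposed on the part of the coordinate
  axis that is joined to the origin inside \<open>U\<close>. If \<open>U\<close> meets the axes in intervals, this is
  all of \<open>x = 0\<close> and all of \<open>y = 0\<close>.\<close>

definition weierstrass_rep ::
  "plane set \<Rightarrow> loop one_form \<Rightarrow> loop one_form \<Rightarrow> (plane \<Rightarrow> loop) \<Rightarrow> bool"
  where "weierstrass_rep U \<xi>1 \<xi>2 \<Phi> \<longleftrightarrow> (\<exists>\<Psi>1 \<Psi>2 lm lp.
     smooth_on U \<Psi>1 \<and> smooth_on U \<Psi>2 \<and>
     (\<forall>p\<in>U. (\<forall>h. d1 \<Psi>1 p h = \<Psi>1 p * \<xi>1 p h) \<and> pdy \<Psi>1 p = 0) \<and>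
     (\<forall>p\<in>U. (\<forall>h. d2 \<Psi>2 p h = \<Psi>2 p * \<xi>2 p h) \<and> pdx \<Psi>2 p = 0) \<and>
     (\<forall>y. closed_segment (0, 0) (0, y) \<subseteq> U \<longrightarrow> \<Psi>1 (0, y) = 1) \<and>
     (\<forall>x. closed_segment (0, 0) (x, 0) \<subseteq> U \<longrightarrow> \<Psi>2 (x, 0) = 1) \<and>
     (\<forall>p\<in>U. \<Phi> p \<in> tLG \<and> lm p \<in> tLG_minus_star \<and> lp p \<in> tLG_plus \<and>
        \<Psi>1 p = \<Phi> p * linv (lm p) \<and> \<Psi>2 p = \<Phi> p * linv (lp p)))"

end

theory Submission
  imports Defs "HOL-Complex_Analysis.Complex_Residues" "HOL-Complex_Analysis.Riemann_Mapping"
begin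

text \<open>In terms of Fourier coefficients, \<open>tLG\<close> consists of the loops \<open>\<gamma>\<close> whose inverse is the
  coefficientwise adjugate, whose even and odd coefficients are diagonal and off-diagonal, and all of whose
  dilations \<open>\<lambda> \<mapsto> r\<lambda>\<close> are summable.

  Near the identity a Birkhoff factorization amounts to inverting a linear operator close to the identity
  on the Banach algebra of loops. This gives openness of the big cells and shows that the derivative of the
  first factor of \<open>\<Psi> = F L\<close> is \<open>F\<close> times the projection of \<open>L (\<Psi>\<inverse>d\<Psi>) L\<inverse>\<close> to the positive (or
  negative) powers of \<open>\<lambda>\<close>. For an extended framing only one power survives, with one of the
  differentials \<open>dx\<close>, \<open>dy\<close>; this yields the potentials, and smoothness by bootstrapping.

  Conversely, a harmonic map on a simply connected region is lifted to the group by means of a continuous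
  square root; the connection form of the lift extends to a family of flat connections, which is integrated
  in the Banach algebra of loops. That the solution extends to \<open>\<lambda> \<in> \<complex>\<^sup>*\<close> follows by comparison
  with the solutions for the dilated connections. The factors of its two splittings, normalized by a gauge
  with values in \<open>K\<close>, form the Weierstrass data.\<close>

section \<open>Coefficientwise maps on loops\<close>

text \<open>In the topology of the algebra the group of loops with analytic extension is not
  complete, so neither an inverse function theorem nor an existence theorem for differential
  equations can be applied inside it. Everything is therefore solved in the Banach algebra
  \<open>loop\<close>, where the adjugate, the twist and the projections are bounded linear maps,
  and membership in the group is recovered afterwards. Symmetry comes from the invariance of the
  equation and the uniqueness of its solution, the determinant from a degree count or a vanishing
  derivative, and the analytic extension from summability of the dilations, which has to be won
  separately since the norm of the algebra controls only the unit circle.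

  Apart from connectedness, simple connectedness enters twice: through the square root that orients
  the eigenlines of the harmonic map, and through a homeomorphism with the plane that reduces the
  continuation of solutions to rectangles. This homeomorphism is only continuous, so the
  differential equation is never transported along it.\<close>

lemma norm_coeff_le: "norm (coeff a j) \<le> norm a"
  using finite_sum_le_infsum[OF coeff_abs_summable, of "{j}" a] by (simp add: norm_loop_def)

lemma coeff_add: "coeff (a + b) j = coeff a j + coeff b j"
  by (simp add: plus_loop.rep_eq)

lemma coeff_scaleR: "coeff (r *\<^sub>R a) j = r *\<^sub>R coeff a j"
  by (simp add: scaleR_loop.rep_eq)

lemma coeff_zero [simp]: "coeff 0 j = 0"
  by (simp add: zero_loop.rep_eq)

lemma coeff_one: "coeff 1 j = (if j = 0 then mat 1 else 0)"
  by (simp add: one_loop.rep_eq)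

lemma coeff_lmonom: "coeff (lmonom k X) j = (if j = k then X else 0)"
  by (simp add: lmonom.rep_eq)

lemma lmonom_0_mat_1 [simp]: "lmonom 0 (mat 1) = 1"
  by (rule loop_eqI) (simp add: coeff_lmonom coeff_one)

lemma bounded_linear_coeff: "bounded_linear (\<lambda>a. coeff a j)"
  by (rule bounded_linear_intro[of _ 1]) (auto simp: coeff_add coeff_scaleR norm_coeff_le)

lemma norm_lmonom: "norm (lmonom k X) = norm X"
proof -
  have "norm (lmonom k X) = (\<Sum>\<^sub>\<infinity>j\<in>{k}. norm X)"
    unfolding norm_loop_def by (rule infsum_cong_neutral) (auto simp: coeff_lmonom)
  then show ?thesis by simp
qed

lemma bounded_linear_lmonom: "bounded_linear (lmonom k)"
  by (rule bounded_linear_intro[of _ 1])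
    (auto simp: norm_lmonom coeff_lmonom coeff_add coeff_scaleR intro!: loop_eqI)

lemmas lmonom_add = linear_add[OF bounded_linear.linear[OF bounded_linear_lmonom]]
  and lmonom_minus = linear_neg[OF bounded_linear.linear[OF bounded_linear_lmonom]]
  and lmonom_scaleR = linear_cmul[OF bounded_linear.linear[OF bounded_linear_lmonom]]
  and lmonom_zero = linear_0[OF bounded_linear.linear[OF bounded_linear_lmonom]]

interpretation mat2: bounded_bilinear "(**) :: mat2 \<Rightarrow> mat2 \<Rightarrow> mat2"
  by (rule matrix_bilinear)

lemma coeff_mult_lmonom: "coeff (a * lmonom k X) n = coeff a (n - k) ** X"
proof -
  have "coeff (a * lmonom k X) n = (\<Sum>\<^sub>\<infinity>j\<in>{n - k}. coeff a (n - k) ** X)"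
    unfolding times_loop.rep_eq
    by (rule infsum_cong_neutral) (auto simp: coeff_lmonom mat2.zero_right)
  then show ?thesis by simp
qed

lemma coeff_lmonom_mult: "coeff (lmonom k X * a) n = X ** coeff a (n - k)"
proof -
  have "coeff (lmonom k X * a) n = (\<Sum>\<^sub>\<infinity>j\<in>{k}. X ** coeff a (n - k))"
    unfolding times_loop.rep_eq
    by (rule infsum_cong_neutral) (auto simp: coeff_lmonom mat2.zero_left)
  then show ?thesis by simp
qed

lemma lmonom_mult_lmonom: "lmonom j X * lmonom k Y = lmonom (j + k) (X ** Y)"
  by (rule loop_eqI) (auto simp: coeff_lmonom_mult coeff_lmonom mat2.zero_right)

text \<open>Completeness carries both fixed-point arguments below and the integrals of loop-valued
  maps. The limit is taken coefficientwise; the Cauchy bound over finite index sets survives it and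
  yields both summability of the limit and convergence in norm.\<close>

instance loop :: banach
proof
  fix X :: "nat \<Rightarrow> loop"
  assume X: "Cauchy X"
  have "convergent (\<lambda>n. coeff (X n) j)" for j
    using bounded_linear.Cauchy[OF bounded_linear_coeff X] by (rule Cauchy_convergent)
  then obtain c where c: "\<And>j. (\<lambda>n. coeff (X n) j) \<longlonglongrightarrow> c j"
    unfolding convergent_def by metis
  have fin: "(\<Sum>j\<in>F. norm (c j - coeff (X n) j)) \<le> e"
    if "\<forall>m\<ge>N. \<forall>n\<ge>N. dist (X m) (X n) < e" "n \<ge> N" "finite F" for e N n F
  proof (rule LIMSEQ_le_const2)
    show "(\<lambda>m. \<Sum>j\<in>F. norm (coeff (X m) j - coeff (X n) j)) \<longlonglongrightarrow> (\<Sum>j\<in>F. norm (c j - coeff (X n) j))"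
      by (intro tendsto_intros c)
    have "(\<Sum>j\<in>F. norm (coeff (X m) j - coeff (X n) j)) \<le> e" if "m \<ge> N" for m
    proof -
      have "(\<Sum>j\<in>F. norm (coeff (X m - X n) j)) \<le> norm (X m - X n)"
        unfolding norm_loop_def
        by (rule finite_sum_le_infsum[OF coeff_abs_summable \<open>finite F\<close>]) auto
      also have "\<dots> \<le> e"
        using \<open>\<forall>m\<ge>N. \<forall>n\<ge>N. dist (X m) (X n) < e\<close> \<open>n \<ge> N\<close> \<open>m \<ge> N\<close>
        by (auto simp: dist_norm intro: less_imp_le)
      finally show ?thesis by (simp add: coeff_minus)
    qed
    then show "\<exists>N. \<forall>m\<ge>N. (\<Sum>j\<in>F. norm (coeff (X m) j - coeff (X n) j)) \<le> e" by blast
  qed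
  have sm: "(\<lambda>j. norm (c j - coeff (X n) j)) summable_on UNIV"
    if "\<forall>m\<ge>N. \<forall>n\<ge>N. dist (X m) (X n) < e" "n \<ge> N" for e N n
    by (rule nonneg_bdd_above_summable_on) (auto intro!: bdd_aboveI2[where M = e] fin[OF that])
  obtain N1 where N1: "\<forall>m\<ge>N1. \<forall>n\<ge>N1. dist (X m) (X n) < 1"
    using X unfolding Cauchy_def by (metis zero_less_one)
  have "(\<lambda>j. norm ((c j - coeff (X N1) j) + coeff (X N1) j)) summable_on UNIV"
    by (rule abs_summable_add[OF sm[OF N1 order_refl] coeff_abs_summable])
  then have cs: "(\<lambda>j. norm (c j)) summable_on UNIV" by simp
  have cL: "coeff (Loop c) = c" using cs by (simp add: Loop_inverse)
  have "X \<longlonglongrightarrow> Loop c"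
  proof (rule metric_LIMSEQ_I)
    fix e :: real assume "e > 0"
    then obtain N where N: "\<forall>m\<ge>N. \<forall>n\<ge>N. dist (X m) (X n) < e / 2"
      using X unfolding Cauchy_def by (meson half_gt_zero)
    have "dist (X n) (Loop c) < e" if "n \<ge> N" for n
    proof -
      have "norm (Loop c - X n) \<le> e / 2"
        unfolding norm_loop_def coeff_minus cL
        by (rule infsum_le_finite_sums[OF sm[OF N that]]) (rule fin[OF N that], simp)
      then show ?thesis using \<open>e > 0\<close> by (simp add: dist_norm norm_minus_commute)
    qed
    then show "\<exists>N. \<forall>n\<ge>N. dist (X n) (Loop c) < e" by blast
  qed
  then show "convergent X" by (auto simp: convergent_def)
qed

lemma has_sum_lmonom: "((\<lambda>j. lmonom j (coeff a j)) has_sum a) UNIV"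
proof -
  have "(\<lambda>j. lmonom j (coeff a j)) summable_on UNIV"
    by (rule abs_summable_summable) (simp add: norm_lmonom coeff_abs_summable)
  then obtain S where S: "((\<lambda>j. lmonom j (coeff a j)) has_sum S) UNIV"
    by (auto simp: summable_on_def)
  have "coeff S n = coeff a n" for n
  proof -
    have "((\<lambda>j. coeff (lmonom j (coeff a j)) n) has_sum coeff S n) UNIV"
      by (rule has_sum_bounded_linear[OF bounded_linear_coeff S])
    moreover have "((\<lambda>j. coeff (lmonom j (coeff a j)) n) has_sum coeff a n) UNIV"
      by (rule has_sum_cong_neutral[THEN iffD1, OF _ _ _ has_sum_finite[of "{n}" "\<lambda>_. coeff a n", simplified]])
        (auto simp: coeff_lmonom)
    ultimately show ?thesis by (rule has_sum_unique)
  qed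
  then have "S = a" by (rule loop_eqI)
  then show ?thesis using S by simp
qed

text \<open>Finite sums of monomials are dense, so identities between bounded linear maps need only be
  checked on monomials.\<close>

lemma bounded_linear_eq_on_lmonom:
  assumes "bounded_linear f" "bounded_linear g" "\<And>j X. f (lmonom j X) = g (lmonom j X)"
  shows "f a = g a"
proof -
  have "((\<lambda>j. f (lmonom j (coeff a j))) has_sum f a) UNIV"
    by (rule has_sum_bounded_linear[OF assms(1) has_sum_lmonom])
  moreover have "((\<lambda>j. g (lmonom j (coeff a j))) has_sum g a) UNIV"
    by (rule has_sum_bounded_linear[OF assms(2) has_sum_lmonom])
  ultimately show ?thesis by (simp add: assms(3) has_sum_unique)
qed

definition coeffwise :: "(int \<Rightarrow> mat2 \<Rightarrow> mat2) \<Rightarrow> bool"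
  where "coeffwise T \<longleftrightarrow> (\<forall>j. linear (T j)) \<and> (\<exists>K. \<forall>j X. norm (T j X) \<le> K * norm X)"

text \<open>\<open>Loop\<close> is unspecified on families that are not summable, hence the side
  condition \<open>coeffwise\<close>, whose bound is uniform in the index.\<close>

definition lmap :: "(int \<Rightarrow> mat2 \<Rightarrow> mat2) \<Rightarrow> loop \<Rightarrow> loop"
  where "lmap T a = Loop (\<lambda>j. T j (coeff a j))"

lemma coeffwiseI:
  assumes "\<And>j. linear (T j)" "\<And>j X. norm (T j X) \<le> K * norm X"
  shows "coeffwise T"
  using assms by (auto simp: coeffwise_def)

lemma coeff_lmap:
  assumes "coeffwise T"
  shows "coeff (lmap T a) j = T j (coeff a j)"
proof -
  obtain K where K: "\<And>j X. norm (T j X) \<le> K * norm X"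
    using assms by (auto simp: coeffwise_def)
  have "(\<lambda>j. norm (T j (coeff a j))) summable_on UNIV"
    by (rule summable_on_comparison_test[OF summable_on_cmult_right[OF coeff_abs_summable, of K a]])
      (auto intro: K)
  then show ?thesis by (simp add: lmap_def Loop_inverse)
qed

lemma norm_lmap_le:
  assumes "coeffwise T" "\<And>j X. norm (T j X) \<le> K * norm X"
  shows "norm (lmap T a) \<le> K * norm a"
proof -
  have "norm (lmap T a) \<le> (\<Sum>\<^sub>\<infinity>j. K * norm (coeff a j))"
    unfolding norm_loop_def
    by (rule infsum_mono[OF coeff_abs_summable summable_on_cmult_right[OF coeff_abs_summable]])
      (simp add: coeff_lmap[OF assms(1)] assms(2))
  then show ?thesis by (simp add: norm_loop_def infsum_cmult_right')
qed

lemma bounded_linear_lmap: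
  assumes "coeffwise T"
  shows "bounded_linear (lmap T)"
proof -
  obtain K where K: "\<And>j X. norm (T j X) \<le> K * norm X"
    using assms by (auto simp: coeffwise_def)
  have l: "linear (T j)" for j using assms by (auto simp: coeffwise_def)
  show ?thesis
  proof (rule bounded_linear_intro[of _ K])
    show "norm (lmap T a) \<le> norm a * K" for a
      using norm_lmap_le[OF assms K] by (simp add: mult.commute)
  qed (auto intro!: loop_eqI
      simp: coeff_lmap[OF assms] coeff_add coeff_scaleR linear_add[OF l] linear_cmul[OF l])
qed

lemma lmap_lmonom:
  assumes "coeffwise T"
  shows "lmap T (lmonom k X) = lmonom k (T k X)"
  using assms
  by (intro loop_eqI) (auto simp: coeff_lmap coeff_lmonom linear_0 coeffwise_def)

lemma lmap_eqI:
  assumes "coeffwise T" "\<And>j. T j (coeff a j) = coeff b j"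
  shows "lmap T a = b"
  by (rule loop_eqI) (simp add: coeff_lmap assms)

section \<open>The adjugate and the symmetry\<close>

text \<open>On SL(2) this is the inverse, and it is linear: inversion of loops extends to a bounded
  linear map of the whole algebra. It is polymorphic because it acts on real coefficients as well as
  on complex values of loops.\<close>

definition adj2 :: "'a::comm_ring_1^2^2 \<Rightarrow> 'a^2^2"
  where "adj2 X = vector [vector [X $ 2 $ 2, - X $ 1 $ 2], vector [- X $ 2 $ 1, X $ 1 $ 1]]"

lemma mat2_eq_iff:
  "(X :: 'a^2^2) = Y \<longleftrightarrow> X $ 1 $ 1 = Y $ 1 $ 1 \<and> X $ 1 $ 2 = Y $ 1 $ 2 \<and>
     X $ 2 $ 1 = Y $ 2 $ 1 \<and> X $ 2 $ 2 = Y $ 2 $ 2"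
  by (subst vec_eq_iff, subst forall_2, (subst vec_eq_iff, subst forall_2)+, rule conj_assoc)

lemma adj2_nth [simp]:
  "adj2 X $ 1 $ 1 = X $ 2 $ 2" "adj2 X $ 1 $ 2 = - X $ 1 $ 2"
  "adj2 X $ 2 $ 1 = - X $ 2 $ 1" "adj2 X $ 2 $ 2 = X $ 1 $ 1"
  by (simp_all add: adj2_def)

lemma matrix_mult_nth2: "(X ** Y) $ i $ j = X $ i $ 1 * Y $ 1 $ j + X $ i $ 2 * Y $ 2 $ j"
  for X Y :: "'a::semiring_1^2^2"
  by (simp add: matrix_matrix_mult_def sum_2)

lemma mat_nth2 [simp]:
  "(mat c :: 'a::zero^2^2) $ 1 $ 1 = c" "(mat c :: 'a::zero^2^2) $ 1 $ 2 = 0"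
  "(mat c :: 'a::zero^2^2) $ 2 $ 1 = 0" "(mat c :: 'a::zero^2^2) $ 2 $ 2 = c"
  by (simp_all add: mat_def)

lemma kmat_nth [simp]:
  "kmat $ 1 $ 1 = -1" "kmat $ 1 $ 2 = 0" "kmat $ 2 $ 1 = 0" "kmat $ 2 $ 2 = 1"
  by (simp_all add: kmat_def)

lemma trace2: "trace X = X $ 1 $ 1 + X $ 2 $ 2" for X :: "'a::semiring_1^2^2"
  by (simp add: trace_def sum_2)

lemma mult_adj2: "X ** adj2 X = mat (det X)" and adj2_mult_self: "adj2 X ** X = mat (det X)"
  by (simp_all add: mat2_eq_iff matrix_mult_nth2 det_2 algebra_simps)

lemma adj2_mult: "adj2 (X ** Y) = adj2 Y ** adj2 X"
  by (simp add: mat2_eq_iff matrix_mult_nth2 algebra_simps)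

lemma matrix_inv_eq:
  fixes X Y :: "'a::semiring_1^'n^'n"
  assumes "X ** Y = mat 1" "Y ** X = mat 1"
  shows "matrix_inv X = Y"
proof -
  have "invertible X" using assms by (auto simp: invertible_def)
  then have "matrix_inv X ** X = mat 1"
    unfolding invertible_def matrix_inv_def by (rule someI2_ex) simp
  then show ?thesis
    by (metis assms(1) matrix_mul_assoc matrix_mul_lid matrix_mul_rid)
qed

lemma matrix_inv_adj2: "det X = 1 \<Longrightarrow> matrix_inv X = adj2 X"
  by (rule matrix_inv_eq) (simp_all add: mult_adj2 adj2_mult_self)

lemma \<sigma>_nth:
  "\<sigma> X $ 1 $ 1 = X $ 1 $ 1" "\<sigma> X $ 1 $ 2 = - X $ 1 $ 2"
  "\<sigma> X $ 2 $ 1 = - X $ 2 $ 1" "\<sigma> X $ 2 $ 2 = X $ 2 $ 2"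
proof -
  have "matrix_inv (kmat :: 'a::ring_1^2^2) = kmat"
    by (rule matrix_inv_eq) (simp_all add: mat2_eq_iff matrix_mult_nth2)
  then show "\<sigma> X $ 1 $ 1 = X $ 1 $ 1" "\<sigma> X $ 1 $ 2 = - X $ 1 $ 2"
    "\<sigma> X $ 2 $ 1 = - X $ 2 $ 1" "\<sigma> X $ 2 $ 2 = X $ 2 $ 2"
    by (simp_all add: \<sigma>_def Ad_def matrix_mult_nth2)
qed

lemma \<sigma>_mult: "\<sigma> (X ** Y) = \<sigma> X ** \<sigma> Y" for X Y :: "'a::ring_1^2^2"
  by (simp add: mat2_eq_iff \<sigma>_nth matrix_mult_nth2)

lemma norm_mat2: "norm X = sqrt ((X $ 1 $ 1)\<^sup>2 + (X $ 1 $ 2)\<^sup>2 + (X $ 2 $ 1)\<^sup>2 + (X $ 2 $ 2)\<^sup>2)"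
  for X :: mat2
  by (simp add: norm_vec_def L2_set_def sum_2 algebra_simps)

lemma linear_adj2: "linear (adj2 :: mat2 \<Rightarrow> mat2)"
  by (rule linearI) (simp_all add: mat2_eq_iff)

lemma norm_adj2: "norm (adj2 X) = norm X" for X :: mat2
  by (simp add: norm_mat2 algebra_simps)

lemma linear_\<sigma>: "linear (\<sigma> :: mat2 \<Rightarrow> mat2)"
  by (rule linearI) (simp_all add: mat2_eq_iff \<sigma>_nth)

lemma norm_\<sigma>: "norm (\<sigma> X) = norm X" for X :: mat2
  by (simp add: norm_mat2 \<sigma>_nth)

definition ladj :: "loop \<Rightarrow> loop" where "ladj = lmap (\<lambda>_. adj2)"

text \<open>The sign (-1)^j is the substitution of -\<lambda> for \<lambda>, so the fixed points are
  the loops satisfying the symmetry condition of the group.\<close>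

definition ltwist :: "loop \<Rightarrow> loop"
  where "ltwist = lmap (\<lambda>j X. if even j then \<sigma> X else - \<sigma> X)"

lemma coeffwise_adj2: "coeffwise (\<lambda>_. adj2)"
  by (rule coeffwiseI[of _ 1]) (simp_all add: linear_adj2 norm_adj2)

lemma coeffwise_twist: "coeffwise (\<lambda>j X. if even j then \<sigma> X else - \<sigma> X)"
proof (rule coeffwiseI[of _ 1])
  show "linear (\<lambda>X :: mat2. if even j then \<sigma> X else - \<sigma> X)" for j :: int
    using linear_\<sigma> linear_compose_neg[OF linear_\<sigma>] by (cases "even j") simp_all
qed (simp add: norm_\<sigma>)

lemma coeff_ladj: "coeff (ladj a) j = adj2 (coeff a j)"
  by (simp add: ladj_def coeff_lmap[OF coeffwise_adj2])

lemma coeff_ltwist: "coeff (ltwist a) j = (if even j then \<sigma> (coeff a j) else - \<sigma> (coeff a j))"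
  by (simp add: ltwist_def coeff_lmap[OF coeffwise_twist])

lemma bounded_linear_ladj: "bounded_linear ladj"
  unfolding ladj_def by (rule bounded_linear_lmap[OF coeffwise_adj2])

lemma bounded_linear_ltwist: "bounded_linear ltwist"
  unfolding ltwist_def by (rule bounded_linear_lmap[OF coeffwise_twist])

lemma adj2_mat_1 [simp]: "adj2 (mat 1) = mat 1"
  by (simp add: mat2_eq_iff)

lemma adj2_adj2 [simp]: "adj2 (adj2 X) = X"
  by (simp add: mat2_eq_iff)

lemma ladj_lmonom: "ladj (lmonom k X) = lmonom k (adj2 X)"
  by (simp add: ladj_def lmap_lmonom[OF coeffwise_adj2])

lemma ltwist_lmonom: "ltwist (lmonom k X) = lmonom k (if even k then \<sigma> X else - \<sigma> X)"
  by (simp add: ltwist_def lmap_lmonom[OF coeffwise_twist])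

lemma ladj_1 [simp]: "ladj 1 = 1"
  using ladj_lmonom[of 0 "mat 1"] by simp

lemma ltwist_1 [simp]: "ltwist 1 = 1"
proof -
  have "\<sigma> (mat 1) = (mat 1 :: mat2)" by (simp add: mat2_eq_iff \<sigma>_nth)
  then show ?thesis using ltwist_lmonom[of 0 "mat 1"] by simp
qed

lemma ladj_ladj [simp]: "ladj (ladj a) = a"
  by (rule loop_eqI) (simp add: coeff_ladj)

lemma ladj_mult: "ladj (a * b) = ladj b * ladj a"
proof -
  note bl = bounded_linear_compose[OF bounded_linear_ladj]
  have 1: "ladj (lmonom j X * b) = ladj b * ladj (lmonom j X)" for j X
  proof (rule bounded_linear_eq_on_lmonom[where a = b])
    show "bounded_linear (\<lambda>b. ladj (lmonom j X * b))"
      by (rule bl[OF bounded_linear_mult_right])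
    show "bounded_linear (\<lambda>b. ladj b * ladj (lmonom j X))"
      by (rule bounded_linear_compose[OF bounded_linear_mult_left bounded_linear_ladj])
  qed (simp add: ladj_lmonom lmonom_mult_lmonom adj2_mult add.commute)
  show ?thesis
  proof (rule bounded_linear_eq_on_lmonom[where a = a])
    show "bounded_linear (\<lambda>a. ladj (a * b))"
      by (rule bl[OF bounded_linear_mult_left])
    show "bounded_linear (\<lambda>a. ladj b * ladj a)"
      by (rule bounded_linear_compose[OF bounded_linear_mult_right bounded_linear_ladj])
  qed (rule 1)
qed

lemma ltwist_mult: "ltwist (a * b) = ltwist a * ltwist b"
proof -
  note bl = bounded_linear_compose[OF bounded_linear_ltwist]
  have 1: "ltwist (lmonom j X * b) = ltwist (lmonom j X) * ltwist b" for j X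
  proof (rule bounded_linear_eq_on_lmonom[where a = b])
    show "bounded_linear (\<lambda>b. ltwist (lmonom j X * b))"
      by (rule bl[OF bounded_linear_mult_right])
    show "bounded_linear (\<lambda>b. ltwist (lmonom j X) * ltwist b)"
      by (rule bounded_linear_compose[OF bounded_linear_mult_right bounded_linear_ltwist])
  qed (auto simp: ltwist_lmonom lmonom_mult_lmonom \<sigma>_mult mat2.minus_left mat2.minus_right)
  show ?thesis
  proof (rule bounded_linear_eq_on_lmonom[where a = a])
    show "bounded_linear (\<lambda>a. ltwist (a * b))"
      by (rule bl[OF bounded_linear_mult_left])
    show "bounded_linear (\<lambda>a. ltwist a * ltwist b)"
      by (rule bounded_linear_compose[OF bounded_linear_mult_left bounded_linear_ltwist])
  qed (rule 1)
qed

text \<open>The coefficients of \<open>a + ladj a\<close> are the scalar matrices of the traces, so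
  this sum commutes with \<open>a\<close>. Consequently the one-sided identity
  \<open>a * ladj a = 1\<close> makes \<open>ladj a\<close> a two-sided inverse.\<close>

lemma mult_ladj_commute: "a * ladj a = ladj a * a"
proof -
  have tr: "coeff a j + coeff (ladj a) j = mat (trace (coeff a j))" for j
    by (simp add: coeff_ladj mat2_eq_iff trace2)
  have c: "X ** mat t = mat t ** X" for X :: mat2 and t
    by (simp add: mat2_eq_iff matrix_mult_nth2)
  have "coeff (a * (a + ladj a)) n = coeff ((a + ladj a) * a) n" for n
  proof -
    have "coeff (a * (a + ladj a)) n = (\<Sum>\<^sub>\<infinity>j. mat (trace (coeff a (n - j))) ** coeff a j)"
      unfolding times_loop.rep_eq coeff_add tr c ..
    also have "\<dots> = (\<Sum>\<^sub>\<infinity>j. mat (trace (coeff a j)) ** coeff a (n - j))"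
      by (rule infsum_reindex_bij_witness[of _ "\<lambda>j. n - j" "\<lambda>j. n - j"]) simp_all
    also have "\<dots> = coeff ((a + ladj a) * a) n"
      unfolding times_loop.rep_eq coeff_add tr ..
    finally show ?thesis .
  qed
  then have "a * (a + ladj a) = (a + ladj a) * a" by (rule loop_eqI)
  then show ?thesis
    unfolding distrib_left distrib_right by (rule add_left_imp_eq)
qed

section \<open>Evaluation of loops and Fourier coefficients\<close>

lemma entry_le_norm: "\<bar>X $ a $ b\<bar> \<le> norm X" for X :: mat2
  by (rule order_trans[OF component_le_norm_cart Finite_Cartesian_Product.norm_nth_le])

lemma loop_at_nth: "loop_at \<gamma> z $ a $ b = (\<Sum>\<^sub>\<infinity>j. of_real (coeff \<gamma> j $ a $ b) * z powi j)"
  by (simp add: loop_at_def)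

lemma norm_loop_at_term:
  fixes z :: "'a::real_normed_field"
  assumes "norm z = 1"
  shows "norm (of_real (coeff \<gamma> j $ a $ b) * z powi j) \<le> norm (coeff \<gamma> j)"
  using assms by (simp add: norm_mult norm_power_int entry_le_norm)

lemma loop_at_summable:
  fixes z :: "'a::{real_normed_field, banach}"
  assumes "norm z = 1"
  shows "(\<lambda>j. norm (of_real (coeff \<gamma> j $ a $ b) * z powi j)) summable_on UNIV"
    and "(\<lambda>j. of_real (coeff \<gamma> j $ a $ b) * z powi j) summable_on UNIV"
proof -
  show 1: "(\<lambda>j. norm (of_real (coeff \<gamma> j $ a $ b) * z powi j)) summable_on UNIV"
    by (rule summable_on_comparison_test[OF coeff_abs_summable[of \<gamma>]])
      (auto intro: norm_loop_at_term[OF assms])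
  then show "(\<lambda>j. of_real (coeff \<gamma> j $ a $ b) * z powi j) summable_on UNIV"
    by (rule abs_summable_summable)
qed

lemma norm_loop_at_le:
  fixes z :: "'a::{real_normed_field, banach}"
  assumes "norm z = 1"
  shows "norm (loop_at \<gamma> z $ a $ b) \<le> norm \<gamma>"
proof -
  have "norm (loop_at \<gamma> z $ a $ b) \<le> (\<Sum>\<^sub>\<infinity>j. norm (of_real (coeff \<gamma> j $ a $ b) * z powi j))"
    unfolding loop_at_nth by (rule norm_infsum_bound[OF loop_at_summable(1)[OF assms]])
  also have "\<dots> \<le> norm \<gamma>"
    unfolding norm_loop_def
    by (rule infsum_mono[OF loop_at_summable(1)[OF assms] coeff_abs_summable norm_loop_at_term[OF assms]])
  finally show ?thesis .
qed

lemma bounded_linear_loop_at: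
  fixes z :: "'a::{real_normed_field, banach}"
  assumes "norm z = 1"
  shows "bounded_linear (\<lambda>\<gamma>. loop_at \<gamma> z $ a $ b)"
proof (rule bounded_linear_intro[of _ 1])
  fix \<gamma> \<delta> :: loop and r :: real
  show "loop_at (\<gamma> + \<delta>) z $ a $ b = loop_at \<gamma> z $ a $ b + loop_at \<delta> z $ a $ b"
    unfolding loop_at_nth infsum_add[OF loop_at_summable(2)[OF assms] loop_at_summable(2)[OF assms], symmetric]
    by (simp add: coeff_add algebra_simps)
  show "loop_at (r *\<^sub>R \<gamma>) z $ a $ b = r *\<^sub>R (loop_at \<gamma> z $ a $ b)"
    unfolding loop_at_nth infsum_scaleR_right[symmetric]
    by (simp only: coeff_scaleR vector_scaleR_component real_scaleR_def of_real_mult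
        scaleR_conv_of_real[where 'a = 'a] mult.assoc)
qed (simp add: norm_loop_at_le[OF assms])

lemma loop_at_lmonom: "loop_at (lmonom k X) z $ a $ b = of_real (X $ a $ b) * z powi k"
proof -
  have "loop_at (lmonom k X) z $ a $ b = (\<Sum>\<^sub>\<infinity>j\<in>{k}. of_real (X $ a $ b) * z powi k)"
    unfolding loop_at_nth by (rule infsum_cong_neutral) (auto simp: coeff_lmonom)
  then show ?thesis by simp
qed

lemma loop_at_mult:
  fixes z :: "'a::{real_normed_field, banach}"
  assumes "norm z = 1"
  shows "loop_at (\<gamma> * \<delta>) z = loop_at \<gamma> z ** loop_at \<delta> z"
proof -
  have z: "z \<noteq> 0" using assms by auto
  note bl = bounded_linear_loop_at[OF assms]
  have R: "bounded_linear (\<lambda>\<delta>. (loop_at \<gamma> z ** loop_at \<delta> z) $ a $ b)" for \<gamma> a b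
    unfolding matrix_mult_nth2
    by (intro bounded_linear_add bounded_linear_compose[OF bounded_linear_mult_right] bl)
  have L: "bounded_linear (\<lambda>\<gamma>. (loop_at \<gamma> z ** loop_at \<delta> z) $ a $ b)" for \<delta> a b
    unfolding matrix_mult_nth2
    by (intro bounded_linear_add bounded_linear_compose[OF bounded_linear_mult_left] bl)
  have 1: "loop_at (lmonom j X * \<delta>) z $ a $ b = (loop_at (lmonom j X) z ** loop_at \<delta> z) $ a $ b"
    for j X a b
  proof (rule bounded_linear_eq_on_lmonom[where a = \<delta>])
    show "bounded_linear (\<lambda>\<delta>. loop_at (lmonom j X * \<delta>) z $ a $ b)"
      by (rule bounded_linear_compose[OF bl bounded_linear_mult_right])
  qed (rule R, simp add: lmonom_mult_lmonom loop_at_lmonom matrix_mult_nth2 power_int_add[OF disjI1[OF z]]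
      algebra_simps)
  have "loop_at (\<gamma> * \<delta>) z $ a $ b = (loop_at \<gamma> z ** loop_at \<delta> z) $ a $ b" for a b
  proof (rule bounded_linear_eq_on_lmonom[where a = \<gamma>])
    show "bounded_linear (\<lambda>\<gamma>. loop_at (\<gamma> * \<delta>) z $ a $ b)"
      by (rule bounded_linear_compose[OF bl bounded_linear_mult_left])
  qed (rule L, rule 1)
  then show ?thesis by (simp add: vec_eq_iff)
qed

lemma loop_at_ladj:
  fixes z :: "'a::{real_normed_field, banach}"
  assumes "norm z = 1"
  shows "loop_at (ladj \<gamma>) z = adj2 (loop_at \<gamma> z)"
proof -
  note bl = bounded_linear_loop_at[OF assms]
  note c = bounded_linear_compose[OF bl bounded_linear_ladj]
  have m: "bounded_linear (\<lambda>\<gamma>. - loop_at \<gamma> z $ a $ b)" for a b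
    by (rule bounded_linear_minus[OF bl])
  note e = bounded_linear_eq_on_lmonom[where a = \<gamma>]
  show ?thesis
    by (subst mat2_eq_iff, unfold adj2_nth, intro conjI)
      (rule e[OF c bl] e[OF c m], simp add: ladj_lmonom loop_at_lmonom)+
qed

lemma loop_at_ltwist:
  fixes z :: "'a::{real_normed_field, banach}"
  assumes "norm z = 1"
  shows "loop_at (ltwist \<gamma>) z = \<sigma> (loop_at \<gamma> (- z))"
proof -
  have nz: "norm (- z) = 1" using assms by simp
  note bl = bounded_linear_loop_at[OF nz]
  note c = bounded_linear_compose[OF bounded_linear_loop_at[OF assms] bounded_linear_ltwist]
  have m: "bounded_linear (\<lambda>\<gamma>. - loop_at \<gamma> (- z) $ a $ b)" for a b
    by (rule bounded_linear_minus[OF bl])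
  note e = bounded_linear_eq_on_lmonom[where a = \<gamma>]
  show ?thesis
    by (subst mat2_eq_iff, unfold \<sigma>_nth, intro conjI)
      (rule e[OF c bl] e[OF c m], simp add: ltwist_lmonom loop_at_lmonom \<sigma>_nth power_int_minus_left)+
qed

lemma loop_at_1:
  fixes z :: "'a::{real_normed_field, banach}"
  shows "loop_at 1 z = mat 1"
proof -
  have "loop_at (lmonom 0 (mat 1)) z = mat 1"
    by (subst mat2_eq_iff) (simp only: loop_at_lmonom mat_nth2 of_real_1 of_real_0 power_int_0_right, simp)
  then show ?thesis by simp
qed

lemma continuous_on_loop_at: "continuous_on (sphere 0 1) (\<lambda>z :: complex. loop_at \<gamma> z $ a $ b)"
proof -
  have "uniform_limit (sphere 0 1) (\<lambda>F z. \<Sum>j\<in>F. of_real (coeff \<gamma> j $ a $ b) * z powi j)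
      (\<lambda>z :: complex. \<Sum>\<^sub>\<infinity>j. of_real (coeff \<gamma> j $ a $ b) * z powi j) (finite_subsets_at_top UNIV)"
    by (rule Weierstrass_m_test_general[OF _ coeff_abs_summable[of \<gamma>]]) (auto intro: norm_loop_at_term)
  moreover have "\<forall>\<^sub>F F in finite_subsets_at_top UNIV.
      continuous_on (sphere 0 1) (\<lambda>z :: complex. \<Sum>j\<in>F. of_real (coeff \<gamma> j $ a $ b) * z powi j)"
    by (intro always_eventually allI continuous_intros) auto
  ultimately show ?thesis
    unfolding loop_at_nth by (intro uniform_limit_theorem) auto
qed

lemma contour_integral_powi:
  "contour_integral (circlepath 0 1) (\<lambda>z :: complex. z powi m) = (if m = -1 then 2 * pi * \<i> else 0)"
proof (cases "m = -1")
  case True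
  have "contour_integral (circlepath 0 1) (\<lambda>z :: complex. 1 / (z - 0)) = 2 * of_real pi * \<i>"
    by (rule contour_integral_circlepath) simp
  then show ?thesis using True by (simp add: power_int_minus field_simps)
next
  case False
  then have nz: "of_int (m + 1) \<noteq> (0 :: complex)" by (subst of_int_eq_0_iff) simp
  have "((\<lambda>z. z powi m) has_contour_integral 0) (circlepath 0 1)"
  proof (rule Cauchy_theorem_primitive[of "- {0}" "\<lambda>z. z powi (m + 1) / of_int (m + 1)"])
    fix z :: complex assume "z \<in> - {0}"
    then have "((\<lambda>z. z powi (m + 1)) has_field_derivative of_int (m + 1) * z powi (m + 1 - 1) * 1)
        (at z within - {0})"
      by (intro DERIV_power_int) (auto intro!: derivative_eq_intros)
    from DERIV_cdivide[OF this, of "of_int (m + 1)"]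
    show "((\<lambda>z. z powi (m + 1) / of_int (m + 1)) has_field_derivative z powi m) (at z within - {0})"
      using nz by (simp del: of_int_add)
  qed auto
  then show ?thesis using False by (simp add: contour_integral_unique)
qed

text \<open>Both sides are bounded linear in \<open>\<gamma>\<close>, so monomials suffice and no
  sum has to be exchanged with the integral.\<close>

lemma coeff_contour_integral:
  "contour_integral (circlepath 0 1) (\<lambda>z. loop_at \<gamma> z $ a $ b * z powi (- n - 1)) =
     2 * pi * \<i> * of_real (coeff \<gamma> n $ a $ b)"
proof -
  let ?I = "\<lambda>\<gamma>. contour_integral (circlepath 0 1) (\<lambda>z. loop_at \<gamma> z $ a $ b * z powi (- n - 1))"
  have ci: "(\<lambda>z. loop_at \<gamma> z $ a $ b * z powi (- n - 1)) contour_integrable_on circlepath 0 1" for \<gamma>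
    by (rule contour_integrable_continuous_circlepath)
      (auto intro!: continuous_intros continuous_on_loop_at simp: path_image_circlepath)
  show ?thesis
  proof (rule bounded_linear_eq_on_lmonom[where a = \<gamma>])
    show "bounded_linear ?I"
    proof (rule bounded_linear_intro[of _ "2 * pi"])
      fix \<gamma> \<delta> :: loop and r :: real
      show "?I (\<gamma> + \<delta>) = ?I \<gamma> + ?I \<delta>"
        unfolding contour_integral_add[OF ci ci, symmetric]
        by (rule contour_integral_eq)
          (simp add: path_image_circlepath linear_add[OF bounded_linear.linear[OF bounded_linear_loop_at]]
            algebra_simps)
      have "?I (r *\<^sub>R \<gamma>) = of_real r * ?I \<gamma>"
        unfolding contour_integral_lmul[OF ci, symmetric]
        by (rule contour_integral_eq)
          (simp add: path_image_circlepath linear_cmul[OF bounded_linear.linear[OF bounded_linear_loop_at]]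
            algebra_simps scaleR_conv_of_real)
      then show "?I (r *\<^sub>R \<gamma>) = r *\<^sub>R ?I \<gamma>" by (simp add: scaleR_conv_of_real)
      have "norm (?I \<gamma>) \<le> norm \<gamma> * (2 * pi * 1)"
        by (rule has_contour_integral_bound_circlepath[OF has_contour_integral_integral[OF ci]])
          (auto simp: norm_mult norm_power_int norm_loop_at_le)
      then show "norm (?I \<gamma>) \<le> norm \<gamma> * (2 * pi)" by simp
    qed
    show "bounded_linear (\<lambda>\<gamma>. 2 * pi * \<i> * of_real (coeff \<gamma> n $ a $ b))"
      by (intro bounded_linear_compose[OF bounded_linear_mult_right]
          bounded_linear_compose[OF bounded_linear_of_real]
          bounded_linear_compose[OF bounded_linear_vec_nth]
          bounded_linear_coeff)
    fix k X
    have pw: "z powi k * z powi (- n - 1) = z powi (k - n - 1)" if "norm z = 1" for z :: complex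
      using that by (subst power_int_add[symmetric]) (auto simp: algebra_simps)
    have "?I (lmonom k X) =
        contour_integral (circlepath 0 1) (\<lambda>z. of_real (X $ a $ b) * z powi (k - n - 1))"
      by (rule contour_integral_eq)
        (simp add: path_image_circlepath loop_at_lmonom pw mult.assoc)
    also have "\<dots> = of_real (X $ a $ b) * contour_integral (circlepath 0 1) (\<lambda>z. z powi (k - n - 1))"
      by (rule contour_integral_lmul, rule contour_integrable_continuous_circlepath)
        (auto intro!: continuous_intros simp: path_image_circlepath)
    finally show "?I (lmonom k X) = 2 * pi * \<i> * of_real (coeff (lmonom k X) n $ a $ b)"
      by (simp add: contour_integral_powi coeff_lmonom)
  qed
qed

lemma loop_at_inject:
  assumes "\<And>z :: complex. norm z = 1 \<Longrightarrow> loop_at \<gamma> z = loop_at \<delta> z"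
  shows "\<gamma> = \<delta>"
proof (rule loop_eqI)
  fix n
  have "contour_integral (circlepath 0 1) (\<lambda>z. loop_at \<gamma> z $ a $ b * z powi (- n - 1)) =
        contour_integral (circlepath 0 1) (\<lambda>z. loop_at \<delta> z $ a $ b * z powi (- n - 1))" for a b
    by (rule contour_integral_eq) (simp add: path_image_circlepath assms)
  then have "coeff \<gamma> n $ a $ b = coeff \<delta> n $ a $ b" for a b
    by (simp add: coeff_contour_integral)
  then show "coeff \<gamma> n = coeff \<delta> n" by (simp add: vec_eq_iff)
qed

section \<open>A coefficient description of the loop groups\<close>

text \<open>Absolute convergence on every circle around 0. It amounts to a holomorphic extension to
  the punctured plane, but is read off the coefficients and is visibly stable under
  products.\<close>

definition dilatable :: "loop \<Rightarrow> bool"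
  where "dilatable \<gamma> \<longleftrightarrow> (\<forall>r>0. (\<lambda>j. r powi j * norm (coeff \<gamma> j)) summable_on UNIV)"

lemma summable_on_half_powi: "(\<lambda>n::int. (1/2::real) ^ nat \<bar>n\<bar>) summable_on UNIV"
proof -
  have g: "(\<lambda>n::nat. (1/2::real) ^ n) summable_on UNIV"
    by (rule summable_nonneg_imp_summable_on) (auto intro: summable_geometric)
  have 1: "(\<lambda>n::int. (1/2::real) ^ nat \<bar>n\<bar>) summable_on {0..}"
    by (rule summable_on_reindex_bij_witness[of _ int nat, THEN iffD2, OF _ _ _ _ _ g]) auto
  have 2: "(\<lambda>n::int. (1/2::real) ^ nat \<bar>n\<bar>) summable_on {..0}"
    by (rule summable_on_reindex_bij_witness[of _ "\<lambda>n. - int n" "\<lambda>n. nat (- n)", THEN iffD2, OF _ _ _ _ _ g]) auto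
  have "{0..} \<union> {..0::int} = UNIV" by auto
  then show ?thesis using summable_on_union[OF 1 2] by simp
qed

text \<open>Cauchy's estimate: the integrand has its only pole at 0, so its residue is the same for
  all radii. It is identified with the coefficient on the unit circle and bounded on the circle of
  radius \<open>R\<close>.\<close>

lemma holomorphic_imp_dilatable:
  fixes F :: "complex \<Rightarrow> complex^2^2"
  assumes hol: "\<And>a b. (\<lambda>z. F z $ a $ b) holomorphic_on (- {0})"
    and F: "\<And>z. norm z = 1 \<Longrightarrow> F z = loop_at \<gamma> z"
  shows "dilatable \<gamma>"
proof -
  have bound: "\<exists>M\<ge>0. \<forall>n. \<bar>coeff \<gamma> n $ a $ b\<bar> \<le> M * R powi (- n)" if "R > 0" for R :: real and a b
  proof -
    have "compact ((\<lambda>z. F z $ a $ b) ` sphere 0 R)"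
      by (rule compact_continuous_image[OF continuous_on_subset[OF holomorphic_on_imp_continuous_on[OF hol]]])
        (use that in auto)
    then obtain M where M: "M > 0" "\<And>z. norm z = R \<Longrightarrow> norm (F z $ a $ b) \<le> M"
      unfolding compact_eq_bounded_closed bounded_pos by auto
    have "\<bar>coeff \<gamma> n $ a $ b\<bar> \<le> M * R powi (- n)" for n
    proof -
      let ?f = "\<lambda>z. F z $ a $ b * z powi (- n - 1)"
      have h: "?f holomorphic_on (UNIV - {0})"
        using hol by (intro holomorphic_intros) (auto simp: Compl_eq_Diff_UNIV)
      have "(?f has_contour_integral 2 * pi * \<i> * residue ?f 0) (circlepath 0 1)"
        by (rule base_residue[OF _ _ _ h]) auto
      moreover have "contour_integral (circlepath 0 1) ?f =
          contour_integral (circlepath 0 1) (\<lambda>z. loop_at \<gamma> z $ a $ b * z powi (- n - 1))"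
        by (rule contour_integral_eq) (simp add: path_image_circlepath F)
      ultimately have r: "residue ?f 0 = of_real (coeff \<gamma> n $ a $ b)"
        using contour_integral_unique coeff_contour_integral by fastforce
      have "(?f has_contour_integral 2 * pi * \<i> * residue ?f 0) (circlepath 0 R)"
        by (rule base_residue[OF _ _ that h]) auto
      then have "norm (2 * pi * \<i> * residue ?f 0) \<le> (M * R powi (- n - 1)) * (2 * pi * R)"
        by (rule has_contour_integral_bound_circlepath)
          (use M that in \<open>auto simp: norm_mult norm_power_int intro!: mult_right_mono\<close>)
      also have "\<dots> = 2 * pi * (M * R powi (- n))"
        using that power_int_add_1[of R "- n - 1"] by (simp add: algebra_simps)
      finally show ?thesis unfolding r by (simp add: norm_mult)
    qed
    then show ?thesis using M(1) by (intro exI[of _ M]) auto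
  qed
  have ent: "(\<lambda>j. r powi j * \<bar>coeff \<gamma> j $ a $ b\<bar>) summable_on UNIV" if r: "r > 0" for r :: real and a b
  proof -
    \<comment> \<open>The radius 2r serves the indices j \<ge> 0 and the radius r/2 the negative
      ones; either way the term is at most a constant times 2^(-|j|).\<close>
    obtain M1 where M1: "M1 \<ge> 0" "\<And>n. \<bar>coeff \<gamma> n $ a $ b\<bar> \<le> M1 * (2 * r) powi (- n)"
      using bound[of "2 * r" a b] r by (metis mult_pos_pos half_gt_zero zero_less_numeral)
    obtain M2 where M2: "M2 \<ge> 0" "\<And>n. \<bar>coeff \<gamma> n $ a $ b\<bar> \<le> M2 * (r / 2) powi (- n)"
      using bound[of "r / 2" a b] r by (metis mult_pos_pos half_gt_zero zero_less_numeral)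
    have "r powi j * \<bar>coeff \<gamma> j $ a $ b\<bar> \<le> (M1 + M2) * (1/2) ^ nat \<bar>j\<bar>" for j
    proof (cases "j \<ge> 0")
      case True
      have "r powi j * \<bar>coeff \<gamma> j $ a $ b\<bar> \<le> r powi j * (M1 * (2 * r) powi (- j))"
        using r by (intro mult_left_mono M1) auto
      also have "\<dots> = M1 * (1/2) ^ nat \<bar>j\<bar>"
        using r True by (simp add: power_int_minus power_int_mult_distrib power_int_def field_simps)
      also have "\<dots> \<le> (M1 + M2) * (1/2) ^ nat \<bar>j\<bar>"
        using M2 by (intro mult_right_mono) auto
      finally show ?thesis .
    next
      case False
      have "r powi j * \<bar>coeff \<gamma> j $ a $ b\<bar> \<le> r powi j * (M2 * (r / 2) powi (- j))"
        using r by (intro mult_left_mono M2) auto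
      also have "\<dots> = M2 * (1/2) ^ nat \<bar>j\<bar>"
        using r False by (simp add: power_int_def field_simps)
      also have "\<dots> \<le> (M1 + M2) * (1/2) ^ nat \<bar>j\<bar>"
        using M1 by (intro mult_right_mono) auto
      finally show ?thesis .
    qed
    then show ?thesis
      using r by (intro summable_on_comparison_test[OF summable_on_cmult_right[OF summable_on_half_powi]]) auto
  qed
  show ?thesis
    unfolding dilatable_def
  proof (intro allI impI)
    fix r :: real assume r: "r > 0"
    let ?g = "\<lambda>a b j. r powi j * \<bar>coeff \<gamma> j $ a $ b\<bar>"
    have "(\<lambda>j. ?g 1 1 j + ?g 1 2 j + (?g 2 1 j + ?g 2 2 j)) summable_on UNIV"
      by (intro summable_on_add ent r)
    then show "(\<lambda>j. r powi j * norm (coeff \<gamma> j)) summable_on UNIV"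
    proof (rule summable_on_comparison_test)
      fix j
      have "norm (coeff \<gamma> j) \<le> \<bar>coeff \<gamma> j $ 1 $ 1\<bar> + \<bar>coeff \<gamma> j $ 1 $ 2\<bar> + (\<bar>coeff \<gamma> j $ 2 $ 1\<bar> + \<bar>coeff \<gamma> j $ 2 $ 2\<bar>)"
        using norm_le_l1_cart[of "coeff \<gamma> j $ 1"] norm_le_l1_cart[of "coeff \<gamma> j $ 2"]
          L2_set_le_sum[of UNIV "\<lambda>i. norm (coeff \<gamma> j $ i)"]
        by (simp add: sum_2 norm_vec_def)
      from mult_left_mono[OF this, of "r powi j"]
      show "r powi j * norm (coeff \<gamma> j) \<le> ?g 1 1 j + ?g 1 2 j + (?g 2 1 j + ?g 2 2 j)"
        using r by (simp add: algebra_simps)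
    qed (use r in auto)
  qed
qed

text \<open>The series is p(z) + (1/z) q(1/z) with two entire power series; the negative indices are
  enumerated as -n - 1, which leaves the factor 1/z.\<close>

lemma holomorphic_laurent:
  fixes c :: "int \<Rightarrow> real"
  assumes s: "\<And>r. r > 0 \<Longrightarrow> (\<lambda>j. r powi j * \<bar>c j\<bar>) summable_on UNIV"
  shows "(\<lambda>z :: complex. \<Sum>\<^sub>\<infinity>j. of_real (c j) * z powi j) holomorphic_on - {0}"
proof -
  let ?f = "\<lambda>(z :: complex) j. of_real (c j) * z powi j"
  have sm: "(\<lambda>j. norm (?f z j)) summable_on A" if "z \<noteq> 0" for z A
    using summable_on_subset_banach[OF s[of "norm z"], of A] that
    by (simp add: norm_mult norm_power_int mult.commute)
  define p where "p = (\<lambda>z :: complex. \<Sum>n. of_real (c (int n)) * z ^ n)"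
  define q where "q = (\<lambda>z :: complex. \<Sum>n. of_real (c (- int n - 1)) * z ^ n)"
  have sp: "summable (\<lambda>n. norm (of_real (c (int n)) * z ^ n))" if "z \<noteq> 0" for z :: complex
  proof -
    have "(\<lambda>n. norm (of_real (c (int n)) * z ^ n)) summable_on UNIV"
      by (rule summable_on_reindex_bij_witness[of _ nat int, THEN iffD2, OF _ _ _ _ _ sm[OF that, of "{0..}"]])
        (auto simp: norm_mult norm_power power_int_def)
    then show ?thesis by (rule summable_on_imp_summable)
  qed
  have sq: "summable (\<lambda>n. norm (of_real (c (- int n - 1)) * inverse z ^ n))" if "z \<noteq> 0" for z :: complex
  proof -
    have "(\<lambda>n. norm (of_real (c (- int n - 1)) * inverse z ^ n)) summable_on UNIV"
    proof (rule summable_on_reindex_bij_witness[of _ "\<lambda>j. nat (- j - 1)" "\<lambda>n. - int n - 1", THEN iffD2,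
          OF _ _ _ _ _ summable_on_cmult_right[OF sm[OF that, of "{..<0}"], of "norm z"]])
      fix n :: nat
      have "z powi (- int n - 1) = inverse z ^ n * inverse z"
        by (simp add: power_int_def nat_add_distrib power_add field_simps)
      then show "norm z * norm (?f z (- int n - 1)) = norm (of_real (c (- int n - 1)) * inverse z ^ n)"
        using that by (simp add: norm_mult norm_inverse)
    qed auto
    then show ?thesis by (rule summable_on_imp_summable)
  qed
  have hp: "p holomorphic_on UNIV"
  proof -
    have "p holomorphic_on ball 0 r" for r
    proof (rule power_series_holomorphic[where a = "\<lambda>n. of_real (c (int n))"])
      fix w :: complex
      have "summable (\<lambda>n. of_real (c (int n)) * w ^ n)"
        using sp[of w, THEN summable_norm_cancel] by (cases "w = 0") auto
      then show "(\<lambda>n. of_real (c (int n)) * (w - 0) ^ n) sums p w"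
        unfolding p_def by (simp add: summable_sums)
    qed
    then have "p holomorphic_on (\<Union>r. ball 0 r)"
      by (intro holomorphic_on_UN_open) auto
    moreover have "(\<Union>r. ball 0 r) = (UNIV :: complex set)"
      by (auto intro: gt_ex)
    ultimately show ?thesis by simp
  qed
  have hq: "q holomorphic_on UNIV"
  proof -
    have "q holomorphic_on ball 0 r" for r
    proof (rule power_series_holomorphic[where a = "\<lambda>n. of_real (c (- int n - 1))"])
      fix w :: complex
      have "summable (\<lambda>n. of_real (c (- int n - 1)) * w ^ n)"
        using sq[of "inverse w", THEN summable_norm_cancel] by (cases "w = 0") auto
      then show "(\<lambda>n. of_real (c (- int n - 1)) * (w - 0) ^ n) sums q w"
        unfolding q_def by (simp add: summable_sums)
    qed
    then have "q holomorphic_on (\<Union>r. ball 0 r)"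
      by (intro holomorphic_on_UN_open) auto
    moreover have "(\<Union>r. ball 0 r) = (UNIV :: complex set)"
      by (auto intro: gt_ex)
    ultimately show ?thesis by simp
  qed
  have inf_sum: "infsum g UNIV = suminf g" if "summable (\<lambda>n. norm (g n))" for g :: "nat \<Rightarrow> complex"
    by (rule infsumI, rule norm_summable_imp_has_sum[OF that])
      (rule summable_sums[OF summable_norm_cancel[OF that]])
  have eq: "(\<Sum>\<^sub>\<infinity>j. ?f z j) = p z + inverse z * q (inverse z)" if "z \<noteq> 0" for z
  proof -
    have "(\<Sum>\<^sub>\<infinity>j\<in>{0..} \<union> {..<0}. ?f z j) = (\<Sum>\<^sub>\<infinity>j\<in>{0..}. ?f z j) + (\<Sum>\<^sub>\<infinity>j\<in>{..<0}. ?f z j)"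
      by (rule infsum_Un_disjoint[OF abs_summable_summable abs_summable_summable])
        (rule sm[OF that], rule sm[OF that], auto)
    moreover have "{0..} \<union> {..<0::int} = UNIV" by auto
    moreover have "(\<Sum>\<^sub>\<infinity>j\<in>{0..}. ?f z j) = (\<Sum>\<^sub>\<infinity>n. of_real (c (int n)) * z ^ n)"
      by (rule infsum_reindex_bij_witness[of _ int nat]) (auto simp: power_int_def)
    moreover have "\<dots> = p z"
      unfolding p_def by (rule inf_sum[OF sp[OF that]])
    moreover have "(\<Sum>\<^sub>\<infinity>j\<in>{..<0}. ?f z j) = (\<Sum>\<^sub>\<infinity>n. inverse z * (of_real (c (- int n - 1)) * inverse z ^ n))"
    proof (rule infsum_reindex_bij_witness[of _ "\<lambda>j. nat (- j - 1)" "\<lambda>n. - int n - 1", symmetric])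
      fix n :: nat
      have "z powi (- int n - 1) = inverse z * inverse z ^ n"
        by (simp add: power_int_def nat_add_distrib power_add field_simps)
      then show "?f z (- int n - 1) = inverse z * (of_real (c (- int n - 1)) * inverse z ^ n)"
        by simp
    qed auto
    moreover have "\<dots> = inverse z * q (inverse z)"
      unfolding q_def infsum_cmult_right' inf_sum[OF sq[OF that]] ..
    ultimately show ?thesis by simp
  qed
  have "(\<lambda>z. p z + inverse z * q (inverse z)) holomorphic_on - {0}"
    by (intro holomorphic_intros holomorphic_on_compose_gen[OF _ hq, unfolded o_def]
        holomorphic_on_subset[OF hp]) auto
  then show ?thesis by (rule holomorphic_transform) (simp add: eq)
qed

lemma dilatable_imp_holomorphic:
  assumes "dilatable \<gamma>"
  shows "(\<lambda>z :: complex. loop_at \<gamma> z $ a $ b) holomorphic_on - {0}"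
  unfolding loop_at_nth
proof (rule holomorphic_laurent)
  fix r :: real assume r: "r > 0"
  then have "(\<lambda>j. r powi j * norm (coeff \<gamma> j)) summable_on UNIV"
    using assms unfolding dilatable_def by blast
  then show "(\<lambda>j. r powi j * \<bar>coeff \<gamma> j $ a $ b\<bar>) summable_on UNIV"
    by (rule summable_on_comparison_test) (use r in \<open>auto intro: mult_left_mono entry_le_norm\<close>)
qed

text \<open>Evaluation on the circle is multiplicative and injective, so the pointwise conditions
  become identities in the algebra. In the converse direction the extension is
  \<open>loop_at \<gamma>\<close> itself, whose series converges off 0.\<close>

lemma tLG_iff: "\<gamma> \<in> tLG \<longleftrightarrow> \<gamma> * ladj \<gamma> = 1 \<and> ltwist \<gamma> = \<gamma> \<and> dilatable \<gamma>"
proof safe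
  assume g: "\<gamma> \<in> tLG"
  then have LG: "det (loop_at \<gamma> z) = 1" "\<sigma> (loop_at \<gamma> z) = loop_at \<gamma> (- z)" if "norm z = 1" for z :: complex
    using that by (auto simp: tLG_def LG_def)
  show "\<gamma> * ladj \<gamma> = 1"
    by (rule loop_at_inject) (simp add: loop_at_mult loop_at_ladj loop_at_1 mult_adj2 LG)
  show "ltwist \<gamma> = \<gamma>"
    by (rule loop_at_inject) (simp add: loop_at_ltwist LG)
  show "dilatable \<gamma>"
    using g by (auto simp: tLG_def intro: holomorphic_imp_dilatable)
next
  assume 1: "\<gamma> * ladj \<gamma> = 1" and 2: "ltwist \<gamma> = \<gamma>" and 3: "dilatable \<gamma>"
  have d: "det (loop_at \<gamma> z) = 1" if "norm z = 1" for z :: complex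
  proof -
    have "mat (det (loop_at \<gamma> z)) = (mat 1 :: complex^2^2)"
      using loop_at_mult[OF that, of \<gamma> "ladj \<gamma>"] by (simp add: 1 loop_at_ladj[OF that] mult_adj2 loop_at_1)
    then show ?thesis by (metis mat_nth2(1))
  qed
  have t: "\<sigma> (loop_at \<gamma> z) = loop_at \<gamma> (- z)" if "norm z = 1" for z :: complex
    using loop_at_ltwist[of "- z" \<gamma>] that by (simp add: 2)
  show "\<gamma> \<in> tLG"
    using d t dilatable_imp_holomorphic[OF 3] unfolding tLG_def LG_def by blast
qed

subsection \<open>Group operations\<close>

lemma coeff_Loop_powi:
  assumes "(\<lambda>j. r powi j * norm (coeff a j)) summable_on UNIV" "r > 0"
  shows "coeff (Loop (\<lambda>j. r powi j *\<^sub>R coeff a j)) n = r powi n *\<^sub>R coeff a n"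
  using assms by (simp add: Loop_inverse)

text \<open>Dilation is multiplicative: the product of the dilated loops has the coefficients r^n
  times those of \<open>a * b\<close>. The radius is fixed because in the factorization different
  radii need different arguments.\<close>

lemma dilation_summable_mult:
  fixes r :: real
  assumes a: "(\<lambda>j. r powi j * norm (coeff a j)) summable_on UNIV"
    and b: "(\<lambda>j. r powi j * norm (coeff b j)) summable_on UNIV" and r: "r > 0"
  shows "(\<lambda>j. r powi j * norm (coeff (a * b) j)) summable_on UNIV"
proof -
  let ?d = "\<lambda>a. Loop (\<lambda>j. r powi j *\<^sub>R coeff a j)"
  have "coeff (?d a * ?d b) n = r powi n *\<^sub>R coeff (a * b) n" for n
  proof -
    have "(r powi j *\<^sub>R X) ** (r powi (n - j) *\<^sub>R Y) = r powi n *\<^sub>R (X ** Y)" for j and X Y :: mat2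
      using r by (simp add: mat2.scaleR_left mat2.scaleR_right flip: power_int_add)
    then show ?thesis
      unfolding times_loop.rep_eq coeff_Loop_powi[OF a r] coeff_Loop_powi[OF b r]
      by (simp add: infsum_scaleR_right)
  qed
  then show ?thesis
    using coeff_abs_summable[of "?d a * ?d b"] r by simp
qed

lemma dilatable_mult: "dilatable a \<Longrightarrow> dilatable b \<Longrightarrow> dilatable (a * b)"
  by (simp add: dilatable_def dilation_summable_mult)

lemma dilatable_ladj: "dilatable a \<Longrightarrow> dilatable (ladj a)"
  by (simp add: dilatable_def coeff_ladj norm_adj2)

lemma dilatable_lmonom: "dilatable (lmonom k X)"
  unfolding dilatable_def
  by (intro allI impI, rule finite_nonzero_values_imp_summable_on, rule finite_subset[of _ "{k}"])
    (auto simp: coeff_lmonom)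

lemma ladj_mult_self: "\<gamma> \<in> tLG \<Longrightarrow> ladj \<gamma> * \<gamma> = 1"
  by (simp add: tLG_iff mult_ladj_commute[symmetric])

lemma mult_ladj_self: "\<gamma> \<in> tLG \<Longrightarrow> \<gamma> * ladj \<gamma> = 1"
  by (simp add: tLG_iff)

lemma one_in_tLG: "1 \<in> tLG"
  using dilatable_lmonom[of 0 "mat 1"] by (simp add: tLG_iff)

lemma ltwist_ladj: "ltwist (ladj a) = ladj (ltwist a)"
  by (rule loop_eqI) (simp add: coeff_ladj coeff_ltwist mat2_eq_iff \<sigma>_nth)

lemma tLG_mult:
  assumes "a \<in> tLG" "b \<in> tLG"
  shows "a * b \<in> tLG"
proof -
  have "a * b * (ladj b * ladj a) = a * (b * ladj b) * ladj a" by (simp add: mult.assoc)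
  then show ?thesis using assms
    by (simp add: tLG_iff ladj_mult ltwist_mult dilatable_mult)
qed

lemma tLG_ladj: "a \<in> tLG \<Longrightarrow> ladj a \<in> tLG"
  by (simp add: tLG_iff ltwist_ladj dilatable_ladj mult_ladj_commute[symmetric])

lemma linv_eq_ladj:
  assumes "\<gamma> \<in> tLG"
  shows "linv \<gamma> = ladj \<gamma>"
  unfolding linv_def
proof (rule the_equality)
  fix \<delta> assume "\<gamma> * \<delta> = 1 \<and> \<delta> * \<gamma> = 1"
  then show "\<delta> = ladj \<gamma>"
    by (metis ladj_mult_self[OF assms] mult.assoc mult.left_neutral mult.right_neutral)
qed (simp add: mult_ladj_self ladj_mult_self assms)

section \<open>Birkhoff factorization near the identity\<close>

text \<open>\<open>ldeg s k a\<close> bounds the powers of \<open>\<lambda>\<close> in \<open>a\<close> by \<open>k\<close>, from above if \<open>s > 0\<close> and from below if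
  \<open>s < 0\<close>. The sign \<open>s\<close> allows both factorizations to be treated at once.\<close>

definition ldeg :: "int \<Rightarrow> int \<Rightarrow> loop \<Rightarrow> bool"
  where "ldeg s k a \<longleftrightarrow> (\<forall>j. s * (j - k) > 0 \<longrightarrow> coeff a j = 0)"

definition tLG_side :: "int \<Rightarrow> loop set"
  where "tLG_side s = {\<gamma>\<in>tLG. ldeg s 0 \<gamma>}"

definition tLG_star :: "int \<Rightarrow> loop set"
  where "tLG_star s = {\<gamma>\<in>tLG_side s. coeff \<gamma> 0 = mat 1}"

lemma tLG_side_simps:
  "tLG_plus = tLG_side (-1)" "tLG_minus = tLG_side 1"
  "tLG_plus_star = tLG_star (-1)" "tLG_minus_star = tLG_star 1"
  by (auto simp: tLG_side_def tLG_star_def tLG_plus_def tLG_minus_def tLG_plus_star_def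
      tLG_minus_star_def ldeg_def)

text \<open>In each term of the convolution the excesses of the two indices over \<open>k\<close>
  and \<open>l\<close> add up to the total excess, so one of them has the forbidden sign if the
  total has. At the index \<open>k + l\<close> only the term j = k escapes.\<close>

lemma ldeg_mult:
  assumes "ldeg s k a" "ldeg s l b"
  shows "ldeg s (k + l) (a * b)"
    and "s \<noteq> 0 \<Longrightarrow> coeff (a * b) (k + l) = coeff a k ** coeff b l"
proof -
  have 0: "coeff a j ** coeff b (n - j) = 0" if "s * (n - (k + l)) > 0" for n j
  proof -
    have "s * (j - k) + s * ((n - j) - l) > 0" using that by (simp add: algebra_simps)
    then have "s * (j - k) > 0 \<or> s * ((n - j) - l) > 0" by linarith
    then show ?thesis using assms by (auto simp: ldeg_def mat2.zero_left mat2.zero_right)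
  qed
  show "ldeg s (k + l) (a * b)"
    by (simp add: ldeg_def times_loop.rep_eq 0)
  assume s: "s \<noteq> 0"
  have "coeff a j ** coeff b (k + l - j) = 0" if "j \<noteq> k" for j
  proof -
    have "s * (j - k) \<noteq> 0" using s that by simp
    moreover have "s * (j - k) + s * ((k + l - j) - l) = 0" by (simp add: algebra_simps)
    ultimately have "s * (j - k) > 0 \<or> s * ((k + l - j) - l) > 0" by linarith
    then show ?thesis using assms by (auto simp: ldeg_def mat2.zero_left mat2.zero_right)
  qed
  then have "coeff (a * b) (k + l) = (\<Sum>\<^sub>\<infinity>j\<in>{k}. coeff a k ** coeff b l)"
    unfolding times_loop.rep_eq by (intro infsum_cong_neutral) auto
  then show "coeff (a * b) (k + l) = coeff a k ** coeff b l" by simp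
qed

lemma ldeg_ladj: "ldeg s k a \<Longrightarrow> ldeg s k (ladj a)"
  by (simp add: ldeg_def coeff_ladj mat2_eq_iff)

lemma ldeg_lmonom: "ldeg s k (lmonom k X)"
  by (auto simp: ldeg_def coeff_lmonom)

lemma ldeg_both:
  assumes "ldeg s 0 a" "ldeg (- s) 0 a" "s \<noteq> 0"
  shows "a = lmonom 0 (coeff a 0)"
proof (rule loop_eqI)
  fix j :: int
  have "j = 0 \<or> s * j \<noteq> 0" using assms(3) by simp
  then have "j = 0 \<or> s * j > 0 \<or> - s * j > 0" by linarith
  then show "coeff a j = coeff (lmonom 0 (coeff a 0)) j"
    using assms(1,2) by (auto simp: ldeg_def coeff_lmonom)
qed

lemma tLG_sideD: "a \<in> tLG_side s \<Longrightarrow> a \<in> tLG" "a \<in> tLG_side s \<Longrightarrow> ldeg s 0 a"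
  by (simp_all add: tLG_side_def)

lemma tLG_starD:
  "a \<in> tLG_star s \<Longrightarrow> a \<in> tLG" "a \<in> tLG_star s \<Longrightarrow> ldeg s 0 a" "a \<in> tLG_star s \<Longrightarrow> coeff a 0 = mat 1"
  by (simp_all add: tLG_star_def tLG_side_def)

lemma tLG_side_mult: "a \<in> tLG_side s \<Longrightarrow> b \<in> tLG_side s \<Longrightarrow> a * b \<in> tLG_side s"
  using ldeg_mult(1)[of s 0 a 0 b] by (simp add: tLG_side_def tLG_mult)

lemma tLG_side_ladj: "a \<in> tLG_side s \<Longrightarrow> ladj a \<in> tLG_side s"
  by (simp add: tLG_side_def tLG_ladj ldeg_ladj)

lemma tLG_star_mult:
  assumes "s \<noteq> 0" "a \<in> tLG_star s" "b \<in> tLG_star s"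
  shows "a * b \<in> tLG_star s"
  using assms tLG_side_mult[of a s b] ldeg_mult(2)[of s 0 a 0 b]
  by (auto simp: tLG_star_def dest: tLG_sideD(2))

lemma tLG_star_ladj: "a \<in> tLG_star s \<Longrightarrow> ladj a \<in> tLG_star s"
  by (simp add: tLG_star_def tLG_side_ladj coeff_ladj)

lemma one_in_tLG_star: "1 \<in> tLG_star s"
  by (auto simp: tLG_star_def tLG_side_def one_in_tLG ldeg_def coeff_one)

text \<open>The loop \<open>ladj F' * F\<close> equals \<open>L' * ladj L\<close>, so its powers are
  bounded by 0 from both sides; it is constant, and the normalization of the first factors makes it
  1.\<close>

lemma factor_unique:
  assumes s: "s \<noteq> 0" and F: "F \<in> tLG_star (- s)" "F' \<in> tLG_star (- s)"
    and L: "L \<in> tLG_side s" "L' \<in> tLG_side s" and eq: "F * L = F' * L'"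
  shows "F = F'" "L = L'"
proof -
  note tF = tLG_starD(1)[OF F(1)] tLG_starD(1)[OF F(2)]
    and tL = tLG_sideD(1)[OF L(1)] tLG_sideD(1)[OF L(2)]
  have "ladj F' * F = ladj F' * (F * L) * ladj L"
    by (simp add: mult.assoc mult_ladj_self[OF tL(1)])
  also have "\<dots> = (ladj F' * F') * L' * ladj L"
    by (simp add: eq mult.assoc)
  finally have e: "ladj F' * F = L' * ladj L"
    by (simp add: ladj_mult_self[OF tF(2)])
  have st: "ladj F' * F \<in> tLG_star (- s)"
    using s F by (intro tLG_star_mult tLG_star_ladj) auto
  moreover have "ldeg s 0 (ladj F' * F)"
    unfolding e by (rule tLG_sideD(2)[OF tLG_side_mult[OF L(2) tLG_side_ladj[OF L(1)]]])
  ultimately have "ladj F' * F = lmonom 0 (coeff (ladj F' * F) 0)"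
    using s tLG_starD(2)[OF st] by (intro ldeg_both) auto
  then have 1: "ladj F' * F = 1"
    using tLG_starD(3)[OF st] by simp
  then have "F' * (ladj F' * F) = F'" by simp
  then show FF: "F = F'" by (simp add: mult_ladj_self[OF tF(2)] flip: mult.assoc)
  have "ladj F * (F * L) = ladj F * (F * L')" using eq FF by simp
  then show "L = L'" by (simp add: ladj_mult_self[OF tF(1)] flip: mult.assoc)
qed

text \<open>The power 0 is excluded: the first factor is normalized, so constant terms belong to the
  second one.\<close>

definition pospart :: "int \<Rightarrow> loop \<Rightarrow> loop"
  where "pospart s = lmap (\<lambda>j X. if s * j > 0 then X else 0)"

lemma coeffwise_pospart: "coeffwise (\<lambda>j X. if s * j > 0 then X else 0)"
  by (rule coeffwiseI[of _ 1]) (auto simp: linear_iff)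

lemma coeff_pospart: "coeff (pospart s a) j = (if s * j > 0 then coeff a j else 0)"
  by (simp add: pospart_def coeff_lmap[OF coeffwise_pospart])

lemma bounded_linear_pospart: "bounded_linear (pospart s)"
  unfolding pospart_def by (rule bounded_linear_lmap[OF coeffwise_pospart])

lemma norm_pospart_le: "norm (pospart s a) \<le> norm a"
  using norm_lmap_le[OF coeffwise_pospart, where K = 1] by (simp add: pospart_def)

lemmas pospart_add = linear_add[OF bounded_linear.linear[OF bounded_linear_pospart]]
  and pospart_diff = linear_diff[OF bounded_linear.linear[OF bounded_linear_pospart]]
  and pospart_minus = linear_neg[OF bounded_linear.linear[OF bounded_linear_pospart]]
  and pospart_zero = linear_0[OF bounded_linear.linear[OF bounded_linear_pospart]]

lemma pospart_pospart: "pospart s (pospart s a) = pospart s a"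
  by (rule loop_eqI) (simp add: coeff_pospart)

lemma pospart_eq_0_iff: "pospart s a = 0 \<longleftrightarrow> ldeg s 0 a"
  by (auto simp: ldeg_def coeff_pospart coeff_inject[symmetric] fun_eq_iff)

lemma pospart_1: "pospart s 1 = 0"
  by (rule loop_eqI) (simp add: coeff_pospart coeff_one)

lemma ltwist_pospart: "ltwist (pospart s a) = pospart s (ltwist a)"
  by (rule loop_eqI) (simp add: coeff_pospart coeff_ltwist linear_0[OF linear_\<sigma>])

text \<open>On the powers that occur, r^j is a nonnegative power of r^(-s) \<le> 1. A loop with
  one-sided powers thus admits half of the dilations for free.\<close>

lemma dilation_summable_side:
  fixes r :: real
  assumes s: "s = 1 \<or> s = -1" and a: "ldeg s 0 a" and r: "r > 0" "r powi s \<ge> 1"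
  shows "(\<lambda>j. r powi j * norm (coeff a j)) summable_on UNIV"
proof (rule summable_on_comparison_test[OF coeff_abs_summable[of a]])
  fix j
  show "r powi j * norm (coeff a j) \<le> norm (coeff a j)"
  proof (cases "s * j > 0")
    case True
    then show ?thesis using a by (simp add: ldeg_def)
  next
    case False
    then obtain n where j: "j = - s * int n"
      using s by (metis minus_mult_minus mult_1 mult_minus1 nonneg_int_cases not_less neg_0_le_iff_le minus_minus)
    have "r powi (- s) \<le> 1"
      using r by (simp add: power_int_minus inverse_le_1_iff)
    then have "(r powi (- s)) ^ n \<le> 1"
      using r by (intro power_le_one) auto
    then have "r powi j \<le> 1"
      unfolding j power_int_mult by (simp add: power_int_def)
    then show ?thesis by (simp add: mult_left_le_one_le r less_imp_le)
  qed
qed (use r in auto)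

text \<open>The inverse of the first factor is \<open>1 + v\<close>, where \<open>v\<close> solves the linear equation stating that
  \<open>(1 + v) \<gamma>\<close> has no powers in the range of \<open>pospart s\<close>.\<close>

lemma factor_near_one:
  assumes s: "s = 1 \<or> s = -1" and g: "\<gamma> \<in> tLG" "norm (\<gamma> - 1) \<le> 1 / 2"
  obtains a b v where "a \<in> tLG_star (- s)" "b \<in> tLG_side s" "\<gamma> = a * b" "ladj a = 1 + v"
    "v = - pospart s (\<gamma> - 1) - pospart s (v * (\<gamma> - 1))"
proof -
  have s0: "s \<noteq> 0" using s by auto
  define T where "T v = - pospart s (\<gamma> - 1) - pospart s (v * (\<gamma> - 1))" for v
  have "dist (T v) (T w) \<le> (1 / 2) * dist v w" for v w
  proof -
    have "T v - T w = pospart s ((w - v) * (\<gamma> - 1))"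
      by (simp add: T_def left_diff_distrib pospart_diff)
    then have "dist (T v) (T w) \<le> norm ((w - v) * (\<gamma> - 1))"
      by (simp add: dist_norm norm_pospart_le)
    also have "\<dots> \<le> norm (w - v) * norm (\<gamma> - 1)" by (rule norm_mult_ineq)
    also have "\<dots> \<le> norm (w - v) * (1 / 2)" using g(2) by (rule mult_left_mono) simp
    finally show ?thesis by (simp add: dist_norm norm_minus_commute)
  qed
  then have "\<exists>!v. T v = v" by (intro banach_fix_type[of "1/2"]) auto
  then obtain v where v: "T v = v" "\<And>w. T w = w \<Longrightarrow> w = v" by blast
  have "v = pospart s (- (\<gamma> - 1) - v * (\<gamma> - 1))"
    using v(1) by (simp only: T_def pospart_diff pospart_minus)
  then have Pv: "pospart s v = v" by (metis pospart_pospart)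
  define u where "u = 1 + v"
  have "pospart s (u * \<gamma>) = pospart s (\<gamma> - 1) + pospart s v + pospart s (v * (\<gamma> - 1))"
    by (simp add: u_def algebra_simps pospart_1 pospart_add pospart_diff)
  also have "\<dots> = 0"
  proof -
    have "a + w + b = 0" if "w = - a - b" for a b w :: loop using that by simp
    from this[OF v(1)[symmetric, unfolded T_def]] show ?thesis by (simp only: Pv)
  qed
  finally have dg: "ldeg s 0 (u * \<gamma>)" by (simp add: pospart_eq_0_iff)
  have du: "ldeg (- s) 0 u"
    unfolding ldeg_def
  proof (intro allI impI)
    fix j assume j: "- s * (j - 0) > 0"
    then have "j \<noteq> 0" "\<not> s * j > 0" by auto
    moreover have "coeff v j = (if s * j > 0 then coeff v j else 0)"
      by (metis Pv coeff_pospart)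
    ultimately show "coeff u j = 0" by (simp add: u_def coeff_add coeff_one)
  qed
  have u0: "coeff u 0 = mat 1"
    using arg_cong[OF Pv, of "\<lambda>a. coeff a 0"] by (simp add: u_def coeff_add coeff_one coeff_pospart)
  have gg: "\<gamma> * ladj \<gamma> = 1" using g(1) by (rule mult_ladj_self)
  \<comment> \<open>The determinant of \<open>u\<close> is not known yet. By the degree of
    \<open>u\<close>, the loop \<open>u * ladj u\<close> has powers on one side of 0 only; as
    \<open>\<gamma>\<close> cancels, it also equals
    \<open>(u * \<gamma>) * ladj (u * \<gamma>)\<close>, whose powers lie on the other side. So it
    is constant, with value given by the constant term of \<open>u\<close>.\<close>
  have uu: "u * ladj u = 1"
  proof -
    have e: "u * ladj u = (u * \<gamma>) * ladj (u * \<gamma>)"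
      by (simp add: ladj_mult mult.assoc) (simp add: gg flip: mult.assoc)
    have "ldeg s (0 + 0) (u * ladj u)"
      unfolding e by (intro ldeg_mult(1) ldeg_ladj dg)
    moreover have "ldeg (- s) (0 + 0) (u * ladj u)"
      by (intro ldeg_mult(1) ldeg_ladj du)
    ultimately have "u * ladj u = lmonom 0 (coeff (u * ladj u) (0 + 0))"
      using ldeg_both[of s "u * ladj u"] s0 by simp
    also have "coeff (u * ladj u) (0 + 0) = mat 1"
      using s0 by (subst ldeg_mult(2)[OF du ldeg_ladj[OF du]]) (simp_all add: u0 coeff_ladj)
    finally show ?thesis by simp
  qed
  \<comment> \<open>\<open>T\<close> commutes with the twist because \<open>\<gamma>\<close> is
    fixed by it, so the twist of the fixed point is again a fixed point.\<close>
  have tw: "ltwist u = u"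
  proof -
    interpret ltw: bounded_linear ltwist by (rule bounded_linear_ltwist)
    have tg: "ltwist \<gamma> = \<gamma>" using g(1) by (simp add: tLG_iff)
    have "T (ltwist v) = ltwist (T v)"
      by (simp add: T_def ltw.diff ltw.neg ltwist_pospart ltwist_mult tg)
    then have "ltwist v = v" using v by metis
    then show ?thesis by (simp add: u_def ltw.add)
  qed
  \<comment> \<open>The one-sided powers of \<open>u\<close> settle the radii with r^(-s) \<ge> 1.
    For the others \<open>u\<close> is rewritten as \<open>(u * \<gamma>) * ladj \<gamma>\<close>,
    where the first factor is one-sided in the opposite sense and the second admits all
    dilations.\<close>
  have dl: "dilatable u"
    unfolding dilatable_def
  proof (intro allI impI)
    fix r :: real assume r: "r > 0"
    show "(\<lambda>j. r powi j * norm (coeff u j)) summable_on UNIV"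
    proof (cases "r powi s \<ge> 1")
      case True
      have "u = (u * \<gamma>) * ladj \<gamma>" by (simp add: mult.assoc gg)
      moreover have "(\<lambda>j. r powi j * norm (coeff (u * \<gamma> * ladj \<gamma>) j)) summable_on UNIV"
        using dilatable_ladj[of \<gamma>] g(1) r
        by (intro dilation_summable_mult[OF dilation_summable_side[OF s dg r True]])
          (simp_all add: tLG_iff dilatable_def)
      ultimately show ?thesis by simp
    next
      case False
      then have "r powi (- s) \<ge> 1"
        using r by (simp add: power_int_minus one_le_inverse_iff)
      then show ?thesis
        using s by (intro dilation_summable_side[OF _ du r]) auto
    qed
  qed
  have ut: "u \<in> tLG" using uu tw dl by (simp add: tLG_iff)
  show thesis
  proof (rule that[of "ladj u" "u * \<gamma>" v])
    show "ladj u \<in> tLG_star (- s)"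
      using ut du u0 by (simp add: tLG_star_def tLG_side_def tLG_ladj ldeg_ladj coeff_ladj)
    show "u * \<gamma> \<in> tLG_side s"
      using ut g(1) dg by (simp add: tLG_side_def tLG_mult)
    show "\<gamma> = ladj u * (u * \<gamma>)"
      by (simp add: ladj_mult_self[OF ut] flip: mult.assoc)
    show "ladj (ladj u) = 1 + v" by (simp add: u_def)
    show "v = - pospart s (\<gamma> - 1) - pospart s (v * (\<gamma> - 1))"
      using v(1) by (simp add: T_def)
  qed
qed

text \<open>Only a limit of \<open>v\<close> is assumed, no derivative: since \<open>g\<close>
  vanishes at \<open>p\<close>, the product is at most the norm of \<open>v\<close> times a constant
  multiple of the distance to \<open>p\<close>. This lets the equation for \<open>v\<close> be
  differentiated before \<open>v\<close> is known to be differentiable.\<close>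

lemma has_derivative_mult_zero:
  fixes v g :: "'a::real_normed_vector \<Rightarrow> 'b::real_normed_algebra"
  assumes g: "(g has_derivative g') (at p)" "g p = 0" and v: "(v \<longlongrightarrow> 0) (at p)"
  shows "((\<lambda>q. v q * g q) has_derivative (\<lambda>_. 0)) (at p)"
proof -
  interpret g': bounded_linear g' using g(1) by (rule has_derivative_bounded_linear)
  obtain K where K: "\<And>h. norm (g' h) \<le> norm h * K" using g'.bounded by blast
  let ?q = "\<lambda>q. norm (g q - g p - g' (q - p)) / norm (q - p)"
  have q: "(?q \<longlongrightarrow> 0) (at p)" using g(1) by (simp add: has_derivative_iff_norm)
  have "((\<lambda>q. norm (v q) * (?q q + K)) \<longlongrightarrow> norm (0::'b) * (0 + K)) (at p)"
    by (intro tendsto_intros v q)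
  then have lim: "((\<lambda>q. norm (v q) * (?q q + K)) \<longlongrightarrow> 0) (at p)" by simp
  have "norm (norm (v q * g q - v p * g p - 0) / norm (q - p)) \<le> norm (v q) * (?q q + K)" if "q \<noteq> p" for q
  proof -
    have "norm (g q) \<le> norm (g q - g p - g' (q - p)) + norm (g' (q - p))"
      using norm_triangle_ineq[of "g q - g' (q - p)" "g' (q - p)"] by (simp add: g(2))
    also have "\<dots> \<le> ?q q * norm (q - p) + norm (q - p) * K"
      using that K[of "q - p"] by simp
    finally have "norm (g q) \<le> (?q q + K) * norm (q - p)" by (simp add: algebra_simps)
    then have "norm (v q * g q) \<le> norm (v q) * ((?q q + K) * norm (q - p))"
      by (meson mult_left_mono norm_ge_zero norm_mult_ineq order_trans)
    then show ?thesis using that by (simp add: g(2) divide_le_eq mult.assoc)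
  qed
  then have "((\<lambda>q. norm (v q * g q - v p * g p - 0) / norm (q - p)) \<longlongrightarrow> 0) (at p)"
    by (intro Lim_null_comparison[OF _ lim]) (auto simp: eventually_at intro: exI[of _ 1])
  then show ?thesis by (simp add: has_derivative_iff_norm)
qed

text \<open>Since \<open>\<gamma> q = F(p)\<inverse> \<Psi>(q) L(p)\<inverse>\<close> is the identity at \<open>q = p\<close>, the quadratic term in the equation
  for \<open>v\<close> does not contribute to the derivative.\<close>

lemma has_derivative_factor:
  fixes \<Psi> F L :: "'a::real_normed_vector \<Rightarrow> loop"
  assumes s: "s = 1 \<or> s = -1" and U: "open U" "p \<in> U"
    and F: "\<And>q. q \<in> U \<Longrightarrow> F q \<in> tLG_star (- s)" and L: "\<And>q. q \<in> U \<Longrightarrow> L q \<in> tLG_side s"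
    and \<Psi>: "\<And>q. q \<in> U \<Longrightarrow> \<Psi> q = F q * L q" and d: "(\<Psi> has_derivative \<Psi>') (at p)"
  shows "(F has_derivative (\<lambda>h. - (F p * ladj (pospart s (ladj (F p) * \<Psi>' h * ladj (L p)))))) (at p)"
proof -
  have s0: "s \<noteq> 0" using s by auto
  note Fp = F[OF U(2)] and Lp = L[OF U(2)]
  note tF = tLG_starD(1)[OF Fp] and tL = tLG_sideD(1)[OF Lp]
  interpret la: bounded_linear ladj by (rule bounded_linear_ladj)
  define \<gamma> where "\<gamma> q = ladj (F p) * \<Psi> q * ladj (L p)" for q
  define v where "v q = ladj (ladj (F p) * F q) - 1" for q
  have g1: "\<gamma> p = 1"
  proof -
    have "\<gamma> p = (ladj (F p) * F p) * (L p * ladj (L p))"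
      unfolding \<gamma>_def \<Psi>[OF U(2)] by (simp only: mult.assoc)
    then show ?thesis by (simp add: ladj_mult_self[OF tF] mult_ladj_self[OF tL])
  qed
  have dg: "(\<gamma> has_derivative (\<lambda>h. ladj (F p) * \<Psi>' h * ladj (L p))) (at p)"
    unfolding \<gamma>_def
    by (rule bounded_linear.has_derivative[OF bounded_linear_mult_left
          bounded_linear.has_derivative[OF bounded_linear_mult_right d]])
  then have cg: "(\<gamma> \<longlongrightarrow> 1) (at p)"
    using has_derivative_continuous[OF dg] by (simp add: continuous_at g1)
  have ev: "\<forall>\<^sub>F q in at p. norm (\<gamma> q - 1) \<le> 1 / 2 \<and> q \<in> U"
  proof (intro eventually_conj)
    have "\<forall>\<^sub>F q in at p. dist (\<gamma> q) 1 < 1 / 2" using cg by (rule tendstoD) simp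
    then show "\<forall>\<^sub>F q in at p. norm (\<gamma> q - 1) \<le> 1 / 2"
      by (rule eventually_mono) (simp add: dist_norm)
    show "\<forall>\<^sub>F q in at p. q \<in> U"
      using U by (simp add: eventually_at_topological) blast
  qed
  \<comment> \<open>The loops \<open>ladj (F p) * F q\<close> and \<open>L q * ladj (L p)\<close>
    factor \<open>\<gamma> q\<close>. By uniqueness they are the factors produced by the
    contraction, so \<open>v q\<close> inherits its fixed-point equation.\<close>
  have veq: "v q = - pospart s (\<gamma> q - 1) - pospart s (v q * (\<gamma> q - 1))"
    if q: "norm (\<gamma> q - 1) \<le> 1 / 2" "q \<in> U" for q
  proof -
    have "\<gamma> q = (ladj (F p) * F q) * (L q * ladj (L p))"
      unfolding \<gamma>_def \<Psi>[OF q(2)] by (simp only: mult.assoc)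
    moreover have 1: "ladj (F p) * F q \<in> tLG_star (- s)"
      using s0 by (intro tLG_star_mult tLG_star_ladj Fp F q) simp
    moreover have 2: "L q * ladj (L p) \<in> tLG_side s"
      by (intro tLG_side_mult tLG_side_ladj Lp L q)
    ultimately have gt: "\<gamma> q \<in> tLG" "\<gamma> q = (ladj (F p) * F q) * (L q * ladj (L p))"
      by (auto intro: tLG_mult dest: tLG_starD(1) tLG_sideD(1))
    obtain a b w where w: "a \<in> tLG_star (- s)" "b \<in> tLG_side s" "\<gamma> q = a * b" "ladj a = 1 + w"
      "w = - pospart s (\<gamma> q - 1) - pospart s (w * (\<gamma> q - 1))"
      using factor_near_one[OF s gt(1) q(1)] by blast
    have "ladj (F p) * F q = a"
      using factor_unique(1)[OF s0 1 w(1) 2 w(2)] gt(2) w(3) by simp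
    then have "v q = w" using w(4) by (simp add: v_def)
    then show ?thesis using w(5) by simp
  qed
  \<comment> \<open>The term with \<open>v\<close> on the right is at most half the norm of
    \<open>v q\<close> and is absorbed on the left; this gives continuity of \<open>v\<close> at
    \<open>p\<close>.\<close>
  have vb: "norm (v q) \<le> 2 * norm (\<gamma> q - 1)" if q: "norm (\<gamma> q - 1) \<le> 1 / 2" "q \<in> U" for q
  proof -
    have "norm (v q) \<le> norm (pospart s (\<gamma> q - 1)) + norm (pospart s (v q * (\<gamma> q - 1)))"
      by (subst veq[OF q]) (metis norm_minus_cancel norm_triangle_ineq4)
    also have "\<dots> \<le> norm (\<gamma> q - 1) + norm (v q) * norm (\<gamma> q - 1)"
      by (intro add_mono norm_pospart_le order_trans[OF norm_pospart_le norm_mult_ineq])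
    also have "norm (v q) * norm (\<gamma> q - 1) \<le> norm (v q) * (1 / 2)"
      using q(1) by (rule mult_left_mono) simp
    finally show ?thesis by simp
  qed
  have "((\<lambda>q. 2 * norm (\<gamma> q - 1)) \<longlongrightarrow> 2 * norm (1 - 1 :: loop)) (at p)"
    by (intro tendsto_intros cg)
  then have lim: "((\<lambda>q. 2 * norm (\<gamma> q - 1)) \<longlongrightarrow> 0) (at p)" by simp
  have "\<forall>\<^sub>F q in at p. norm (v q) \<le> 2 * norm (\<gamma> q - 1)"
    by (rule eventually_mono[OF ev]) (blast intro: vb)
  then have cv: "(v \<longlongrightarrow> 0) (at p)"
    by (rule Lim_null_comparison) (rule lim)
  have vp: "v p = 0" by (simp add: v_def ladj_mult_self[OF tF])
  have dg1: "((\<lambda>q. \<gamma> q - 1) has_derivative (\<lambda>h. ladj (F p) * \<Psi>' h * ladj (L p))) (at p)"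
    using has_derivative_diff[OF dg has_derivative_const[of 1]] by simp
  note P = bounded_linear.has_derivative[OF bounded_linear_pospart]
  have "((\<lambda>q. v q * (\<gamma> q - 1)) has_derivative (\<lambda>_. 0)) (at p)"
    by (rule has_derivative_mult_zero[OF dg1 _ cv]) (simp add: g1)
  then have "((\<lambda>q. - pospart s (\<gamma> q - 1) - pospart s (v q * (\<gamma> q - 1))) has_derivative
      (\<lambda>h. - pospart s (ladj (F p) * \<Psi>' h * ladj (L p)) - pospart s 0)) (at p)"
    by (rule has_derivative_diff[OF has_derivative_minus[OF P[OF dg1]] P])
  then have "(v has_derivative
      (\<lambda>h. - pospart s (ladj (F p) * \<Psi>' h * ladj (L p)) - pospart s 0)) (at p)"
  proof (rule has_derivative_transform_eventually)
    show "\<forall>\<^sub>F q in at p. - pospart s (\<gamma> q - 1) - pospart s (v q * (\<gamma> q - 1)) = v q"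
      by (rule eventually_mono[OF ev]) (metis veq)
  qed (simp_all add: g1 vp pospart_zero)
  then have "((\<lambda>q. F p * ladj (1 + v q)) has_derivative
      (\<lambda>h. F p * ladj (0 + (- pospart s (ladj (F p) * \<Psi>' h * ladj (L p)) - pospart s 0)))) (at p)"
    by (rule bounded_linear.has_derivative[OF bounded_linear_mult_right
          la.has_derivative[OF has_derivative_add[OF has_derivative_const]]])
  moreover have "F p * ladj (1 + v q) = F q" for q
    by (simp add: v_def ladj_mult mult_ladj_self[OF tF] flip: mult.assoc)
  ultimately show ?thesis by (simp add: pospart_zero la.neg)
qed

text \<open>Conjugation by \<open>L\<close> cannot raise the degree in the direction of
  \<open>s\<close>. Of the three monomials only the one of power \<open>s\<close> therefore reaches
  the range of \<open>pospart s\<close>, and only through its leading coefficient.\<close>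

lemma pospart_conjugate:
  assumes s: "s = 1 \<or> s = -1" and L: "L \<in> tLG_side s"
  shows "pospart s (L * (lmonom 0 A + lmonom s B + lmonom (- s) C) * ladj L) =
    lmonom s (coeff L 0 ** B ** adj2 (coeff L 0))"
proof -
  note dL = tLG_sideD(2)[OF L]
  have k: "ldeg s (0 + k + 0) (L * lmonom k X * ladj L)" for k X
    by (intro ldeg_mult(1) dL ldeg_lmonom ldeg_ladj)
  have z: "pospart s (L * lmonom k X * ladj L) = 0" if "s * k \<le> 0" for k X
    unfolding pospart_eq_0_iff ldeg_def
  proof (intro allI impI)
    fix j :: int assume "0 < s * (j - 0)"
    then have "0 < s * (j - (0 + k + 0))" using that by (simp add: algebra_simps)
    then show "coeff (L * lmonom k X * ladj L) j = 0" using k by (simp only: ldeg_def)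
  qed
  have "coeff (pospart s (L * lmonom s B * ladj L)) j = coeff (lmonom s (coeff L 0 ** B ** adj2 (coeff L 0))) j" for j
  proof (cases "j = s")
    case True
    have "coeff (L * lmonom s B * ladj L) (0 + s + 0) = coeff (L * lmonom s B) (0 + s) ** coeff (ladj L) 0"
      using s by (intro ldeg_mult(2)[of s] ldeg_mult(1)[of s] dL ldeg_lmonom ldeg_ladj) auto
    also have "coeff (L * lmonom s B) (0 + s) = coeff L 0 ** B"
      by (simp add: coeff_mult_lmonom)
    finally show ?thesis using True s by (auto simp: coeff_pospart coeff_lmonom coeff_ladj)
  next
    case False
    then have "s * j > 0 \<Longrightarrow> 0 < s * (j - (0 + s + 0))" using s by auto
    then show ?thesis using False k[of s B] by (auto simp: coeff_pospart coeff_lmonom ldeg_def)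
  qed
  then have "pospart s (L * lmonom s B * ladj L) = lmonom s (coeff L 0 ** B ** adj2 (coeff L 0))"
    by (rule loop_eqI)
  moreover have "pospart s (L * lmonom 0 A * ladj L) = 0" by (rule z) simp
  moreover have "pospart s (L * lmonom (- s) C * ladj L) = 0" by (rule z) simp
  ultimately show ?thesis by (simp add: distrib_left distrib_right pospart_add)
qed

section \<open>Calculus of smooth maps on the plane\<close>

abbreviation partials :: "'b::real_normed_vector \<Rightarrow> 'b \<Rightarrow> plane \<Rightarrow> 'b"
  where "partials a b \<equiv> (\<lambda>h. fst h *\<^sub>R a + snd h *\<^sub>R b)"

lemma Ck_on_SucI:
  assumes "\<And>p. p \<in> U \<Longrightarrow> (f has_derivative partials (fx p) (fy p)) (at p)" "Ck_on n U fx" "Ck_on n U fy"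
  shows "Ck_on (Suc n) U f"
  unfolding Ck_on.simps by (intro exI[of _ fx] exI[of _ fy] conjI ballI assms)

lemma Ck_on_cong:
  assumes "open U" "Ck_on n U f" "\<And>p. p \<in> U \<Longrightarrow> f p = g p"
  shows "Ck_on n U g"
proof (cases n)
  case 0
  then show ?thesis using assms by (simp cong: continuous_on_cong)
next
  case (Suc m)
  obtain fx fy where f: "\<And>p. p \<in> U \<Longrightarrow> (f has_derivative partials (fx p) (fy p)) (at p)"
    "Ck_on m U fx" "Ck_on m U fy"
    using assms(2) unfolding Suc by auto
  show ?thesis
    unfolding Suc
    by (rule Ck_on_SucI[OF has_derivative_transform_within_open[OF f(1) assms(1)] f(2,3)])
      (assumption | erule assms(3))+
qed

lemma Ck_on_SucD: "Ck_on (Suc n) U f \<Longrightarrow> Ck_on n U f"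
proof (induction n arbitrary: f)
  case 0
  then show ?case
    by (auto intro!: continuous_at_imp_continuous_on dest: has_derivative_continuous)
next
  case (Suc n)
  from Suc.prems obtain fx fy where f: "\<forall>p\<in>U. (f has_derivative partials (fx p) (fy p)) (at p)"
    "Ck_on (Suc n) U fx" "Ck_on (Suc n) U fy"
    by (subst (asm) Ck_on.simps(2)) blast
  show ?case by (rule Ck_on_SucI[OF bspec[OF f(1)] Suc.IH[OF f(2)] Suc.IH[OF f(3)]])
qed

lemma Ck_on_const: "Ck_on n U (\<lambda>_. c)"
proof (induction n arbitrary: c)
  case (Suc n)
  have "((\<lambda>_. c) has_derivative partials 0 0) (at p)" for p :: plane
    by (simp add: has_derivative_const)
  then show ?case by (rule Ck_on_SucI[OF _ Suc Suc])
qed simp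

lemma Ck_on_linear:
  assumes "bounded_linear h" "Ck_on n U f"
  shows "Ck_on n U (\<lambda>p. h (f p))"
  using assms(2)
proof (induction n arbitrary: f)
  case 0
  then show ?case by (simp add: bounded_linear.continuous_on[OF assms(1)])
next
  case (Suc n)
  obtain fx fy where f: "\<And>p. p \<in> U \<Longrightarrow> (f has_derivative partials (fx p) (fy p)) (at p)"
    "Ck_on n U fx" "Ck_on n U fy"
    using Suc.prems by auto
  interpret h: bounded_linear h by (rule assms(1))
  have "((\<lambda>p. h (f p)) has_derivative partials (h (fx p)) (h (fy p))) (at p)" if "p \<in> U" for p
    using h.has_derivative[OF f(1)[OF that]] by (simp add: h.add h.scaleR)
  then show ?case by (rule Ck_on_SucI) (auto intro: Suc.IH f)
qed

lemma Ck_on_add: "Ck_on n U f \<Longrightarrow> Ck_on n U g \<Longrightarrow> Ck_on n U (\<lambda>p. f p + g p)"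
proof (induction n arbitrary: f g)
  case 0
  then show ?case by (simp add: continuous_on_add)
next
  case (Suc n)
  obtain fx fy where f: "\<And>p. p \<in> U \<Longrightarrow> (f has_derivative partials (fx p) (fy p)) (at p)"
    "Ck_on n U fx" "Ck_on n U fy"
    using Suc.prems(1) by auto
  obtain gx gy where g: "\<And>p. p \<in> U \<Longrightarrow> (g has_derivative partials (gx p) (gy p)) (at p)"
    "Ck_on n U gx" "Ck_on n U gy"
    using Suc.prems(2) by auto
  have "((\<lambda>p. f p + g p) has_derivative partials (fx p + gx p) (fy p + gy p)) (at p)" if "p \<in> U" for p
    using has_derivative_add[OF f(1)[OF that] g(1)[OF that]] by (simp add: algebra_simps)
  then show ?case by (rule Ck_on_SucI) (auto intro: Suc.IH f g)
qed

lemma Ck_on_bilinear: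
  assumes "bounded_bilinear B"
  shows "Ck_on n U f \<Longrightarrow> Ck_on n U g \<Longrightarrow> Ck_on n U (\<lambda>p. B (f p) (g p))"
proof (induction n arbitrary: f g)
  case 0
  then show ?case by (simp add: bounded_bilinear.continuous_on[OF assms])
next
  case (Suc n)
  interpret B: bounded_bilinear B by (rule assms)
  obtain fx fy where f: "\<And>p. p \<in> U \<Longrightarrow> (f has_derivative partials (fx p) (fy p)) (at p)"
    "Ck_on n U fx" "Ck_on n U fy"
    using Suc.prems(1) by auto
  obtain gx gy where g: "\<And>p. p \<in> U \<Longrightarrow> (g has_derivative partials (gx p) (gy p)) (at p)"
    "Ck_on n U gx" "Ck_on n U gy"
    using Suc.prems(2) by auto
  note fg = Suc.prems[THEN Ck_on_SucD]
  show ?case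
  proof (rule Ck_on_SucI)
    show "((\<lambda>p. B (f p) (g p)) has_derivative
        partials (B (f p) (gx p) + B (fx p) (g p)) (B (f p) (gy p) + B (fy p) (g p))) (at p)"
      if "p \<in> U" for p
      using B.FDERIV[OF f(1)[OF that] g(1)[OF that]]
      by (simp add: B.add_left B.add_right B.scaleR_left B.scaleR_right algebra_simps)
    show "Ck_on n U (\<lambda>p. B (f p) (gx p) + B (fx p) (g p))"
      by (rule Ck_on_add[OF Suc.IH[OF fg(1) g(2)] Suc.IH[OF f(2) fg(2)]])
    show "Ck_on n U (\<lambda>p. B (f p) (gy p) + B (fy p) (g p))"
      by (rule Ck_on_add[OF Suc.IH[OF fg(1) g(3)] Suc.IH[OF f(3) fg(2)]])
  qed
qed

lemmas Ck_on_mult = Ck_on_bilinear[OF bounded_bilinear_mult]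
  and Ck_on_matrix_mult = Ck_on_bilinear[OF matrix_bilinear]
  and Ck_on_coeff = Ck_on_linear[OF bounded_linear_coeff]
  and Ck_on_lmonom = Ck_on_linear[OF bounded_linear_lmonom]
  and Ck_on_ladj = Ck_on_linear[OF bounded_linear_ladj]

text \<open>Meant for equations whose right-hand side involves the unknown map itself, such as f_x =
  f a: every order of differentiability of \<open>f\<close> passes to its partial derivatives and so
  raises itself by one.\<close>

lemma smooth_on_bootstrap:
  assumes d: "\<And>p. p \<in> U \<Longrightarrow> (f has_derivative partials (fx p) (fy p)) (at p)"
    and step: "\<And>n. Ck_on n U f \<Longrightarrow> Ck_on n U fx \<and> Ck_on n U fy"
  shows "smooth_on U f"
  unfolding smooth_on_def
proof
  show "Ck_on n U f" for n
  proof (induction n)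
    case 0
    show ?case using d by (auto intro!: continuous_at_imp_continuous_on dest: has_derivative_continuous)
  next
    case (Suc n)
    show ?case using step[OF Suc] by (intro Ck_on_SucI[OF d]) auto
  qed
qed

lemma pd_eqI:
  assumes "(f has_derivative partials a b) (at p)"
  shows "pdx f p = a" "pdy f p = b"
    and "((\<lambda>t. f (t, snd p)) has_vector_derivative a) (at (fst p))"
    and "((\<lambda>t. f (fst p, t)) has_vector_derivative b) (at (snd p))"
proof -
  have "((\<lambda>t. (t, snd p)) has_derivative (\<lambda>t. (t, 0))) (at (fst p))"
    by (auto intro!: derivative_eq_intros)
  from has_derivative_compose[OF this, of f "partials a b"] assms
  show x: "((\<lambda>t. f (t, snd p)) has_vector_derivative a) (at (fst p))"
    by (simp add: has_vector_derivative_def)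
  have "((\<lambda>t. (fst p, t)) has_derivative (\<lambda>t. (0, t))) (at (snd p))"
    by (auto intro!: derivative_eq_intros)
  from has_derivative_compose[OF this, of f "partials a b"] assms
  show y: "((\<lambda>t. f (fst p, t)) has_vector_derivative b) (at (snd p))"
    by (simp add: has_vector_derivative_def)
  show "pdx f p = a" "pdy f p = b"
    using x y by (simp_all add: pdx_def pdy_def vector_derivative_at)
qed

lemma smooth_on_has_derivative:
  assumes "smooth_on U f" "p \<in> U"
  shows "(f has_derivative partials (pdx f p) (pdy f p)) (at p)"
proof -
  have "Ck_on (Suc 0) U f" using assms(1) unfolding smooth_on_def by blast
  then obtain a b where d: "(f has_derivative partials a b) (at p)" using assms(2) by auto
  then show ?thesis by (simp only: pd_eqI(1,2)[OF d])
qed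

lemma smooth_on_pd:
  assumes "open U" "smooth_on U f"
  shows "smooth_on U (pdx f)" "smooth_on U (pdy f)"
proof -
  have "Ck_on n U (pdx f) \<and> Ck_on n U (pdy f)" for n
  proof -
    have "Ck_on (Suc n) U f" using assms(2) unfolding smooth_on_def by blast
    then obtain fx fy where f: "\<And>p. p \<in> U \<Longrightarrow> (f has_derivative partials (fx p) (fy p)) (at p)"
      "Ck_on n U fx" "Ck_on n U fy"
      by auto
    show ?thesis
      by (intro conjI Ck_on_cong[OF assms(1) f(2)] Ck_on_cong[OF assms(1) f(3)] pd_eqI(1,2)[OF f(1), symmetric])
  qed
  then show "smooth_on U (pdx f)" "smooth_on U (pdy f)" by (auto simp: smooth_on_def)
qed

lemma Ck_on_subset: "Ck_on n U f \<Longrightarrow> V \<subseteq> U \<Longrightarrow> Ck_on n V f"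
proof (induction n arbitrary: f)
  case (Suc n)
  from Suc.prems(1) obtain fx fy where f: "\<forall>p\<in>U. (f has_derivative partials (fx p) (fy p)) (at p)"
    "Ck_on n U fx" "Ck_on n U fy"
    by auto
  note V = Suc.prems(2)
  show ?case
    by (rule Ck_on_SucI[OF bspec[OF f(1)] Suc.IH[OF f(2) V] Suc.IH[OF f(3) V]]) (rule subsetD[OF V])
qed (auto intro: continuous_on_subset)

lemma smooth_on_subset: "smooth_on U f \<Longrightarrow> V \<subseteq> U \<Longrightarrow> smooth_on V f"
  unfolding smooth_on_def by (blast intro: Ck_on_subset)

lemma smooth_on_cong: "open U \<Longrightarrow> smooth_on U f \<Longrightarrow> (\<And>p. p \<in> U \<Longrightarrow> f p = g p) \<Longrightarrow> smooth_on U g"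
  unfolding smooth_on_def by (blast intro: Ck_on_cong)

lemma smooth_on_imp_continuous_on: "smooth_on U f \<Longrightarrow> continuous_on U f"
  unfolding smooth_on_def by (metis Ck_on.simps(1))

lemma smooth_on_const: "smooth_on U (\<lambda>_. c)"
  by (simp add: smooth_on_def Ck_on_const)

lemma smooth_on_linear: "bounded_linear h \<Longrightarrow> smooth_on U f \<Longrightarrow> smooth_on U (\<lambda>p. h (f p))"
  by (simp add: smooth_on_def Ck_on_linear)

lemma smooth_on_add: "smooth_on U f \<Longrightarrow> smooth_on U g \<Longrightarrow> smooth_on U (\<lambda>p. f p + g p)"
  by (simp add: smooth_on_def Ck_on_add)

lemma smooth_on_bilinear:
  "bounded_bilinear B \<Longrightarrow> smooth_on U f \<Longrightarrow> smooth_on U g \<Longrightarrow> smooth_on U (\<lambda>p. B (f p) (g p))"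
  by (simp add: smooth_on_def Ck_on_bilinear)

lemmas smooth_on_mult = smooth_on_bilinear[OF bounded_bilinear_mult]
  and smooth_on_matrix_mult = smooth_on_bilinear[OF matrix_bilinear]
  and smooth_on_coeff = smooth_on_linear[OF bounded_linear_coeff]
  and smooth_on_ladj = smooth_on_linear[OF bounded_linear_ladj]

lemma open_box_around:
  fixes p :: plane
  assumes "open U" "p \<in> U"
  obtains e where "e > 0" "\<And>x y. \<bar>x - fst p\<bar> < e \<Longrightarrow> \<bar>y - snd p\<bar> < e \<Longrightarrow> (x, y) \<in> U"
proof -
  obtain A B where AB: "open A" "open B" "p \<in> A \<times> B" "A \<times> B \<subseteq> U"
    using assms by (rule open_prod_elim)
  obtain d where d: "d > 0" "\<And>x. dist x (fst p) < d \<Longrightarrow> x \<in> A"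
    using AB(1,3) unfolding open_dist by (metis mem_Times_iff)
  obtain e where e: "e > 0" "\<And>x. dist x (snd p) < e \<Longrightarrow> x \<in> B"
    using AB(2,3) unfolding open_dist by (metis mem_Times_iff)
  show thesis
    by (rule that[of "min d e"]) (use d e AB(4) in \<open>auto simp: dist_real_def\<close>)
qed

lemma constant_on_interval:
  fixes g :: "real \<Rightarrow> 'b::real_normed_vector"
  assumes "\<And>t. \<bar>t - c\<bar> < e \<Longrightarrow> (g has_vector_derivative 0) (at t)" "\<bar>t - c\<bar> < e"
  shows "g t = g c"
proof -
  have d: "\<And>x. x \<in> ball c e \<Longrightarrow> (g has_vector_derivative 0) (at x within ball c e)"
    by (rule has_vector_derivative_at_within[OF assms(1)]) (auto simp: dist_real_def abs_minus_commute)
  obtain k where "\<And>x. x \<in> ball c e \<Longrightarrow> g x = k"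
    using has_vector_derivative_zero_constant[OF convex_ball d] by metis
  then show ?thesis using assms(2) by (auto simp: dist_real_def abs_minus_commute)
qed

text \<open>A map that is locally independent of one coordinate has partial derivatives with the same
  property; \<open>G\<close> below is a function of the 1-jet of \<open>f\<close>.\<close>

lemma pdy_jet_zero:
  fixes f :: "plane \<Rightarrow> 'b::real_normed_vector" and G :: "'b \<Rightarrow> 'b \<Rightarrow> 'c::real_normed_vector"
  assumes U: "open U" "p \<in> U"
    and d: "\<And>q. q \<in> U \<Longrightarrow> (f has_derivative partials (fx q) 0) (at q)"
    and A: "\<And>q. q \<in> U \<Longrightarrow> A q = G (f q) (fx q)"
  shows "pdy A p = 0"
proof -
  obtain e where e: "e > 0" "\<And>x y. \<bar>x - fst p\<bar> < e \<Longrightarrow> \<bar>y - snd p\<bar> < e \<Longrightarrow> (x, y) \<in> U"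
    using open_box_around[OF U] by blast
  have c: "f (x, t) = f (x, snd p)" if "\<bar>x - fst p\<bar> < e" "\<bar>t - snd p\<bar> < e" for x t
    by (rule constant_on_interval[OF _ that(2)]) (use pd_eqI(4)[OF d[OF e(2)[OF that(1)]]] in auto)
  have cx: "fx (fst p, t) = fx p" if t: "\<bar>t - snd p\<bar> < e" for t
  proof -
    have "((\<lambda>x. f (x, t)) has_vector_derivative fx (fst p, t)) (at (fst p))"
      using pd_eqI(3)[OF d[of "(fst p, t)"]] e t by simp
    then have "((\<lambda>x. f (x, snd p)) has_vector_derivative fx (fst p, t)) (at (fst p))"
      by (rule has_vector_derivative_transform_within_open[where S = "ball (fst p) e"])
        (use e(1) t in \<open>auto simp: dist_real_def abs_minus_commute intro: c\<close>)
    moreover have "((\<lambda>x. f (x, snd p)) has_vector_derivative fx p) (at (fst p))"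
      using pd_eqI(3)[OF d[OF U(2)]] .
    ultimately show ?thesis by (rule vector_derivative_unique_at)
  qed
  have Ac: "A (fst p, t) = A p" if "\<bar>t - snd p\<bar> < e" for t
    using that e c[of "fst p" t] cx[OF that] A[of "(fst p, t)"] A[OF U(2)] by simp
  have "((\<lambda>t. A (fst p, t)) has_vector_derivative 0) (at (snd p))"
    by (rule has_vector_derivative_transform_within_open[where S = "ball (snd p) e", OF has_vector_derivative_const])
      (use e(1) in \<open>auto simp: dist_real_def abs_minus_commute Ac\<close>)
  then show ?thesis by (simp add: pdy_def vector_derivative_at)
qed

lemma pdx_jet_zero:
  fixes f :: "plane \<Rightarrow> 'b::real_normed_vector" and G :: "'b \<Rightarrow> 'b \<Rightarrow> 'c::real_normed_vector"
  assumes U: "open U" "p \<in> U"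
    and d: "\<And>q. q \<in> U \<Longrightarrow> (f has_derivative partials 0 (fy q)) (at q)"
    and A: "\<And>q. q \<in> U \<Longrightarrow> A q = G (f q) (fy q)"
  shows "pdx A p = 0"
proof -
  have sw: "open (prod.swap -` U)" by (intro open_vimage U continuous_intros)
  have "pdy (\<lambda>q. A (prod.swap q)) (prod.swap p) = 0"
  proof (rule pdy_jet_zero[OF sw])
    fix q assume q: "q \<in> prod.swap -` U"
    have "(prod.swap has_derivative prod.swap) (at q)"
      unfolding prod.swap_def by (auto intro!: derivative_eq_intros)
    from has_derivative_compose[OF this d[of "prod.swap q"]] q
    show "((\<lambda>q. f (prod.swap q)) has_derivative partials (fy (prod.swap q)) 0) (at q)"
      by simp
    show "A (prod.swap q) = G (f (prod.swap q)) (fy (prod.swap q))" using A q by simp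
  qed (use U in simp)
  then show ?thesis by (simp add: pdx_def pdy_def)
qed

section \<open>Splitting an extended framing\<close>

lemma adj2_traceless: "X $ 1 $ 1 + X $ 2 $ 2 = 0 \<Longrightarrow> adj2 X = - X" for X :: mat2
  by (simp add: mat2_eq_iff eq_neg_iff_add_eq_0 add.commute)

lemma m_sub_iff: "X \<in> m_sub \<longleftrightarrow> X $ 1 $ 1 = 0 \<and> X $ 2 $ 2 = 0"
  by (auto simp: m_sub_def trace2)

lemma k_sub_iff: "X \<in> k_sub \<longleftrightarrow> X $ 1 $ 1 + X $ 2 $ 2 = 0 \<and> X $ 1 $ 2 = 0 \<and> X $ 2 $ 1 = 0"
  by (auto simp: k_sub_def trace2)

lemma tLG_coeff_0:
  assumes "\<gamma> \<in> tLG"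
  shows "coeff \<gamma> 0 $ 1 $ 2 = 0" "coeff \<gamma> 0 $ 2 $ 1 = 0"
proof -
  have "coeff (ltwist \<gamma>) 0 = coeff \<gamma> 0" using assms by (simp add: tLG_iff)
  then have "\<sigma> (coeff \<gamma> 0) = coeff \<gamma> 0" by (simp add: coeff_ltwist)
  then have "\<sigma> (coeff \<gamma> 0) $ 1 $ 2 = coeff \<gamma> 0 $ 1 $ 2" "\<sigma> (coeff \<gamma> 0) $ 2 $ 1 = coeff \<gamma> 0 $ 2 $ 1"
    by simp_all
  then show "coeff \<gamma> 0 $ 1 $ 2 = 0" "coeff \<gamma> 0 $ 2 $ 1 = 0" by (simp_all add: \<sigma>_nth)
qed

lemma tLG_side_coeff_0:
  assumes "s \<noteq> 0" "\<gamma> \<in> tLG_side s"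
  shows "coeff \<gamma> 0 ** adj2 (coeff \<gamma> 0) = mat 1"
proof -
  note d = tLG_sideD(2)[OF assms(2)]
  have "coeff (\<gamma> * ladj \<gamma>) (0 + 0) = coeff \<gamma> 0 ** coeff (ladj \<gamma>) 0"
    by (rule ldeg_mult(2)[OF d ldeg_ladj[OF d] assms(1)])
  then show ?thesis
    using mult_ladj_self[OF tLG_sideD(1)[OF assms(2)]] by (simp add: coeff_one coeff_ladj)
qed

lemma conjugate_m_sub:
  assumes "X \<in> m_sub" "D $ 1 $ 2 = 0" "D $ 2 $ 1 = 0"
  shows "D ** X ** adj2 D \<in> m_sub"
  using assms by (simp add: m_sub_iff matrix_mult_nth2)

text \<open>After \<open>has_derivative_factor\<close> and \<open>pospart_conjugate\<close> the
  differential of \<open>F\<close> contains only the power \<open>s\<close>, conjugated by the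
  diagonal constant term of \<open>L\<close>. As \<open>L\<close> is \<open>ladj F * \<Psi>\<close>,
  the new coefficients are as smooth as \<open>F\<close> and the bootstrap applies.\<close>

lemma factor_smooth:
  fixes \<Psi> F L :: "plane \<Rightarrow> loop"
  assumes s: "s = 1 \<or> s = -1" and U: "open U"
    and F: "\<And>q. q \<in> U \<Longrightarrow> F q \<in> tLG_star (- s)" and L: "\<And>q. q \<in> U \<Longrightarrow> L q \<in> tLG_side s"
    and \<Psi>: "\<And>q. q \<in> U \<Longrightarrow> \<Psi> q = F q * L q" and sm: "smooth_on U \<Psi>"
    and d: "\<And>q. q \<in> U \<Longrightarrow> (\<Psi> has_derivative
        (\<lambda>h. \<Psi> q * (lmonom 0 (a q h) + lmonom s (partials (X q) (Y q) h) + lmonom (- s) (c q h)))) (at q)"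
    and XY: "smooth_on U X" "smooth_on U Y" "\<And>q. q \<in> U \<Longrightarrow> X q \<in> m_sub" "\<And>q. q \<in> U \<Longrightarrow> Y q \<in> m_sub"
  defines "C \<equiv> (\<lambda>Z q. coeff (L q) 0 ** Z q ** adj2 (coeff (L q) 0))"
  shows "\<And>q. q \<in> U \<Longrightarrow> (F has_derivative partials (F q * lmonom s (C X q)) (F q * lmonom s (C Y q))) (at q)"
    and "smooth_on U F" "smooth_on U (C X)" "smooth_on U (C Y)"
    and "\<And>q. q \<in> U \<Longrightarrow> C X q \<in> m_sub" "\<And>q. q \<in> U \<Longrightarrow> C Y q \<in> m_sub"
proof -
  have m: "C X q \<in> m_sub" "C Y q \<in> m_sub" if "q \<in> U" for q
    unfolding C_def using tLG_coeff_0[OF tLG_sideD(1)[OF L[OF that]]]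
    by (simp_all add: conjugate_m_sub XY that)
  show "\<And>q. q \<in> U \<Longrightarrow> C X q \<in> m_sub" "\<And>q. q \<in> U \<Longrightarrow> C Y q \<in> m_sub" by (fact m)+
  have dF: "(F has_derivative partials (F q * lmonom s (C X q)) (F q * lmonom s (C Y q))) (at q)"
    if q: "q \<in> U" for q
  proof -
    note tF = tLG_starD(1)[OF F[OF q]]
    let ?c = "\<lambda>h. lmonom 0 (a q h) + lmonom s (partials (X q) (Y q) h) + lmonom (- s) (c q h)"
    have "- (F q * ladj (pospart s (ladj (F q) * (\<Psi> q * ?c h) * ladj (L q)))) =
        partials (F q * lmonom s (C X q)) (F q * lmonom s (C Y q)) h" for h
    proof -
      have "ladj (F q) * (\<Psi> q * ?c h) * ladj (L q) = (ladj (F q) * F q) * (L q * ?c h * ladj (L q))"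
        unfolding \<Psi>[OF q] by (simp only: mult.assoc)
      then have "pospart s (ladj (F q) * (\<Psi> q * ?c h) * ladj (L q)) =
          lmonom s (coeff (L q) 0 ** partials (X q) (Y q) h ** adj2 (coeff (L q) 0))"
        by (simp only: ladj_mult_self[OF tF] mult_1_left pospart_conjugate[OF s L[OF q]])
      also have "\<dots> = lmonom s (partials (C X q) (C Y q) h)"
        by (simp add: C_def mat2.add_left mat2.add_right mat2.scaleR_left mat2.scaleR_right)
      finally have P: "pospart s (ladj (F q) * (\<Psi> q * ?c h) * ladj (L q)) = lmonom s (partials (C X q) (C Y q) h)" .
      \<comment> \<open>On traceless matrices the adjugate is the negative, which cancels the minus
        sign in the derivative formula.\<close>
      have "adj2 (partials (C X q) (C Y q) h) = - partials (C X q) (C Y q) h"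
        using m[OF q] by (intro adj2_traceless) (simp add: m_sub_iff)
      then show ?thesis
        unfolding P ladj_lmonom by (simp only: lmonom_minus lmonom_add lmonom_scaleR distrib_left
            mult_minus_right minus_minus mult_scaleR_right)
    qed
    then show ?thesis
      using has_derivative_factor[OF s U q F L \<Psi> d[OF q]] by simp
  qed
  then show "\<And>q. q \<in> U \<Longrightarrow> (F has_derivative partials (F q * lmonom s (C X q)) (F q * lmonom s (C Y q))) (at q)"
    by blast
  have Leq: "ladj (F q) * \<Psi> q = L q" if "q \<in> U" for q
    unfolding \<Psi>[OF that] by (simp add: ladj_mult_self[OF tLG_starD(1)[OF F[OF that]]] flip: mult.assoc)
  have CC: "Ck_on n U (C Z)" if "Ck_on n U F" "smooth_on U Z" for n Z
  proof -
    have l: "Ck_on n U (\<lambda>q. coeff (L q) 0)"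
    proof (rule Ck_on_coeff, rule Ck_on_cong[OF U])
      show "Ck_on n U (\<lambda>q. ladj (F q) * \<Psi> q)"
        using sm that(1) by (intro Ck_on_mult Ck_on_ladj) (auto simp: smooth_on_def)
    qed (rule Leq)
    then show ?thesis
      unfolding C_def using that(2)
      by (intro Ck_on_matrix_mult Ck_on_linear[OF linear_conv_bounded_linear[THEN iffD1, OF linear_adj2]])
        (auto simp: smooth_on_def)
  qed
  show sF: "smooth_on U F"
    by (rule smooth_on_bootstrap[OF dF]) (auto intro!: Ck_on_mult Ck_on_lmonom CC XY)
  then show "smooth_on U (C X)" "smooth_on U (C Y)"
    using XY CC by (auto simp: smooth_on_def)
qed

section \<open>Openness of the big cells and the potentials of a splitting\<close>

definition big_cell :: "int \<Rightarrow> loop set"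
  where "big_cell s = {a * b | a b. a \<in> tLG_star (- s) \<and> b \<in> tLG_side s}"

lemma big_cell_simps: "big_cell_minus_plus = big_cell (-1)" "big_cell_plus_minus = big_cell 1"
  by (simp_all add: big_cell_minus_plus_def big_cell_plus_minus_def big_cell_def tLG_side_simps)

text \<open>Translating by the inverses of the factors \<open>a\<close> and \<open>b\<close> moves
  \<open>\<alpha>\<close> to 1, where the contraction applies; the factors found there combine with
  \<open>a\<close> on the left and \<open>b\<close> on the right. The radius 1 / (2K) guarantees the
  distance 1/2 required near 1.\<close>

lemma big_cell_neighbourhood:
  assumes s: "s = 1 \<or> s = -1" and "\<alpha> \<in> big_cell s"
  obtains e where "e > 0" "\<And>\<gamma>. \<gamma> \<in> tLG \<Longrightarrow> dist \<gamma> \<alpha> < e \<Longrightarrow> \<gamma> \<in> big_cell s"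
proof -
  obtain a b where a: "a \<in> tLG_star (- s)" and b: "b \<in> tLG_side s" and ab: "\<alpha> = a * b"
    using assms by (auto simp: big_cell_def)
  note ta = tLG_starD(1)[OF a] and tb = tLG_sideD(1)[OF b]
  define K where "K = norm (ladj a) * norm (ladj b) + 1"
  have K: "K > 0" unfolding K_def by (rule add_nonneg_pos) auto
  have "\<gamma> \<in> big_cell s" if g: "\<gamma> \<in> tLG" "dist \<gamma> \<alpha> < 1 / (2 * K)" for \<gamma>
  proof -
    define \<delta> where "\<delta> = ladj a * \<gamma> * ladj b"
    have t: "\<delta> \<in> tLG" unfolding \<delta>_def by (intro tLG_mult tLG_ladj ta tb g)
    have "ladj a * (a * b) * ladj b = (ladj a * a) * (b * ladj b)" by (simp only: mult.assoc)
    then have "\<delta> - 1 = ladj a * (\<gamma> - \<alpha>) * ladj b"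
      by (simp add: \<delta>_def ab right_diff_distrib left_diff_distrib ladj_mult_self[OF ta] mult_ladj_self[OF tb])
    then have "norm (\<delta> - 1) \<le> norm (ladj a) * norm (\<gamma> - \<alpha>) * norm (ladj b)"
      by (simp add: order_trans[OF norm_mult_ineq mult_right_mono[OF norm_mult_ineq norm_ge_zero]])
    also have "\<dots> \<le> K * norm (\<gamma> - \<alpha>)"
      by (simp add: K_def algebra_simps)
    also have "\<dots> \<le> K * (1 / (2 * K))"
      using g(2) K by (intro mult_left_mono) (auto simp: dist_norm)
    finally have "norm (\<delta> - 1) \<le> 1 / 2" using K by simp
    then obtain c d where c: "c \<in> tLG_star (- s)" "d \<in> tLG_side s" "\<delta> = c * d"
      using factor_near_one[OF s t] by metis
    have "a * \<delta> * b = (a * ladj a) * \<gamma> * (ladj b * b)"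
      unfolding \<delta>_def by (simp only: mult.assoc)
    then have "\<gamma> = (a * c) * (d * b)"
      by (simp add: c(3) mult_ladj_self[OF ta] ladj_mult_self[OF tb] mult.assoc)
    moreover have "a * c \<in> tLG_star (- s)" "d * b \<in> tLG_side s"
      using s a b c by (blast intro: tLG_star_mult tLG_side_mult | force intro: tLG_star_mult)+
    ultimately show ?thesis unfolding big_cell_def by blast
  qed
  then show thesis using K by (intro that[of "1 / (2 * K)"]) auto
qed

text \<open>The definition of a framing imposes no regularity on its coefficient functions.
  Smoothness of \<open>B\<close> and \<open>E\<close> follows because they are the coefficients of
  \<lambda> and 1/\<lambda> in the logarithmic derivatives of \<open>\<Psi>\<close>.\<close>

lemma extended_framing_derivative:
  assumes U: "open U" and fr: "extended_framing U \<psi> \<Psi>"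
  obtains A B C E where
    "\<forall>p\<in>U. B p \<in> m_sub" "\<forall>p\<in>U. E p \<in> m_sub" "smooth_on U B" "smooth_on U E"
    "\<forall>p\<in>U. (\<Psi> has_derivative (\<lambda>h. \<Psi> p * (lmonom 0 (partials (A p) (C p) h) +
       lmonom 1 (fst h *\<^sub>R B p) + lmonom (-1) (snd h *\<^sub>R E p)))) (at p)"
proof -
  have sm: "smooth_on U \<Psi>" and t: "\<And>p. p \<in> U \<Longrightarrow> \<Psi> p \<in> tLG"
    using fr by (auto simp: extended_framing_def)
  obtain A B C E where c: "\<And>p. p \<in> U \<Longrightarrow> B p \<in> m_sub" "\<And>p. p \<in> U \<Longrightarrow> E p \<in> m_sub"
    "\<And>p. p \<in> U \<Longrightarrow> linv (\<Psi> p) * pdx \<Psi> p = lmonom 0 (A p) + lmonom 1 (B p)"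
    "\<And>p. p \<in> U \<Longrightarrow> linv (\<Psi> p) * pdy \<Psi> p = lmonom 0 (C p) + lmonom (-1) (E p)"
    using fr unfolding extended_framing_def by blast
  have s: "smooth_on U (\<lambda>p. coeff (ladj (\<Psi> p) * pdx \<Psi> p) 1)" "smooth_on U (\<lambda>p. coeff (ladj (\<Psi> p) * pdy \<Psi> p) (-1))"
    by (intro smooth_on_coeff smooth_on_mult smooth_on_ladj smooth_on_pd U sm)+
  have BE: "coeff (ladj (\<Psi> p) * pdx \<Psi> p) 1 = B p" "coeff (ladj (\<Psi> p) * pdy \<Psi> p) (-1) = E p" if "p \<in> U" for p
    using c(3,4)[OF that] by (simp_all add: linv_eq_ladj[OF t[OF that]] coeff_add coeff_lmonom)
  show thesis
  proof (rule that[of B E A C]; (intro ballI)?)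
    show "smooth_on U B" "smooth_on U E"
      by (rule smooth_on_cong[OF U s(1)], rule BE(1), assumption)
        (rule smooth_on_cong[OF U s(2)], rule BE(2), assumption)
    fix p assume p: "p \<in> U"
    have e: "\<Psi> p * (linv (\<Psi> p) * Z) = Z" for Z
      by (simp add: linv_eq_ladj[OF t[OF p]] mult_ladj_self[OF t[OF p]] flip: mult.assoc)
    have "pdx \<Psi> p = \<Psi> p * (lmonom 0 (A p) + lmonom 1 (B p))" "pdy \<Psi> p = \<Psi> p * (lmonom 0 (C p) + lmonom (-1) (E p))"
      using e[of "pdx \<Psi> p"] e[of "pdy \<Psi> p"] c(3,4)[OF p] by simp_all
    then have "partials (pdx \<Psi> p) (pdy \<Psi> p) h = \<Psi> p * (lmonom 0 (partials (A p) (C p) h) +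
       lmonom 1 (fst h *\<^sub>R B p) + lmonom (-1) (snd h *\<^sub>R E p))" for h
      by (simp add: lmonom_add lmonom_scaleR algebra_simps)
    then show "(\<Psi> has_derivative (\<lambda>h. \<Psi> p * (lmonom 0 (partials (A p) (C p) h) +
       lmonom 1 (fst h *\<^sub>R B p) + lmonom (-1) (snd h *\<^sub>R E p)))) (at p)"
      using smooth_on_has_derivative[OF sm p] by simp
  qed (use c in auto)
qed

text \<open>For \<open>\<Psi>p * Lm\<close> the sign is s = 1, and of the differential of
  \<open>\<Psi>\<close> only the \<lambda>-term survives, which comes with dx. For
  \<open>\<Psi>m * Lp\<close> the sign is -1 and only the dy-term survives. So each first factor
  depends locally on one coordinate.\<close>

lemma splitting_factors:
  assumes U: "open U" and fr: "extended_framing D \<psi> \<Psi>" and D: "open D" "U \<subseteq> D"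
    and sp: "splits_on U \<Psi> \<Psi>m Lp \<Psi>p Lm"
  obtains H1 H2 where
    "smooth_on U \<Psi>m" "smooth_on U \<Psi>p" "smooth_on U H1" "smooth_on U H2"
    "\<forall>p\<in>U. H1 p \<in> m_sub" "\<forall>p\<in>U. H2 p \<in> m_sub"
    "\<forall>p\<in>U. (\<Psi>p has_derivative partials (\<Psi>p p * lmonom 1 (H1 p)) 0) (at p)"
    "\<forall>p\<in>U. (\<Psi>m has_derivative partials 0 (\<Psi>m p * lmonom (-1) (H2 p))) (at p)"
    "\<forall>p\<in>U. pdy H1 p = 0" "\<forall>p\<in>U. pdx H2 p = 0"
proof -
  obtain A B C E where c': "\<forall>p\<in>D. B p \<in> m_sub" "\<forall>p\<in>D. E p \<in> m_sub" "smooth_on D B" "smooth_on D E"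
    "\<forall>p\<in>D. (\<Psi> has_derivative (\<lambda>h. \<Psi> p * (lmonom 0 (partials (A p) (C p) h) +
       lmonom 1 (fst h *\<^sub>R B p) + lmonom (-1) (snd h *\<^sub>R E p)))) (at p)"
    by (rule extended_framing_derivative[OF D(1) fr])
  note c = c'[rule_format]
  have sm: "smooth_on U \<Psi>" "smooth_on U B" "smooth_on U E" "smooth_on U (\<lambda>_. 0 :: mat2)"
    using fr c D(2) by (auto simp: extended_framing_def smooth_on_const intro: smooth_on_subset)
  have 0: "0 \<in> m_sub" by (simp add: m_sub_iff)
  have sp1: "\<And>p. p \<in> U \<Longrightarrow> \<Psi>p p \<in> tLG_star (- 1)" "\<And>p. p \<in> U \<Longrightarrow> Lm p \<in> tLG_side 1"
    "\<And>p. p \<in> U \<Longrightarrow> \<Psi> p = \<Psi>p p * Lm p"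
    and sp2: "\<And>p. p \<in> U \<Longrightarrow> \<Psi>m p \<in> tLG_star (- (- 1))" "\<And>p. p \<in> U \<Longrightarrow> Lp p \<in> tLG_side (- 1)"
    "\<And>p. p \<in> U \<Longrightarrow> \<Psi> p = \<Psi>m p * Lp p"
    using sp by (auto simp: splits_on_def tLG_side_simps)
  define H1 where "H1 = (\<lambda>q. coeff (Lm q) 0 ** B q ** adj2 (coeff (Lm q) 0))"
  define H2 where "H2 = (\<lambda>q. coeff (Lp q) 0 ** E q ** adj2 (coeff (Lp q) 0))"
  have d1: "(\<Psi> has_derivative (\<lambda>h. \<Psi> p * (lmonom 0 (partials (A p) (C p) h) +
       lmonom 1 (partials (B p) 0 h) + lmonom (- 1) (snd h *\<^sub>R E p)))) (at p)" if "p \<in> U" for p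
    using c(5)[of p] that D(2) by (auto simp: lmonom_zero)
  have d2: "(\<Psi> has_derivative (\<lambda>h. \<Psi> p * (lmonom 0 (partials (A p) (C p) h) +
       lmonom (- 1) (partials 0 (E p) h) + lmonom (- (- 1)) (fst h *\<^sub>R B p)))) (at p)" if "p \<in> U" for p
    using c(5)[of p] that D(2) by (auto simp: lmonom_zero algebra_simps)
  have BE: "B p \<in> m_sub" "E p \<in> m_sub" if "p \<in> U" for p
    using c(1,2)[OF subsetD[OF D(2) that]] .
  note f1 = factor_smooth[of 1, OF _ U sp1 sm(1) d1 sm(2) sm(4) BE(1) 0, folded H1_def]
  note f2 = factor_smooth[of "-1", OF _ U sp2 sm(1) d2 sm(4) sm(3) 0 BE(2), folded H2_def]
  have p1: "(\<Psi>p has_derivative partials (\<Psi>p p * lmonom 1 (H1 p)) 0) (at p)" if "p \<in> U" for p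
    using f1(1)[OF _ _ _ _ _ _ that] that by (simp add: mat2.zero_left mat2.zero_right lmonom_zero H1_def)
  have p2: "(\<Psi>m has_derivative partials 0 (\<Psi>m p * lmonom (-1) (H2 p))) (at p)" if "p \<in> U" for p
    using f2(1)[OF _ _ _ _ _ _ that] that by (simp add: mat2.zero_left mat2.zero_right lmonom_zero H2_def)
  \<comment> \<open>\<open>H1\<close> is expressed through the 1-jet of \<open>\<Psi>p\<close>, so
    that \<open>pdy_jet_zero\<close> carries the independence of y over to the potential.\<close>
  have g1: "H1 p = coeff (ladj (\<Psi>p p) * (\<Psi>p p * lmonom 1 (H1 p))) 1" if "p \<in> U" for p
    using ladj_mult_self[OF tLG_starD(1)[OF sp1(1)[OF that]]] by (simp add: coeff_lmonom flip: mult.assoc)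
  have g2: "H2 p = coeff (ladj (\<Psi>m p) * (\<Psi>m p * lmonom (-1) (H2 p))) (-1)" if "p \<in> U" for p
    using ladj_mult_self[OF tLG_starD(1)[OF sp2(1)[OF that]]] by (simp add: coeff_lmonom flip: mult.assoc)
  show thesis
  proof (rule that[of H1 H2]; (intro ballI)?)
    show "smooth_on U \<Psi>m" "smooth_on U \<Psi>p" "smooth_on U H1" "smooth_on U H2"
      using f1(2,3) f2(2,4) by (auto simp: H1_def H2_def)
    show "pdy H1 p = 0" if "p \<in> U" for p
      by (rule pdy_jet_zero[OF U that p1, where G = "\<lambda>a b. coeff (ladj a * b) 1"]) (auto intro: g1)
    show "pdx H2 p = 0" if "p \<in> U" for p
      by (rule pdx_jet_zero[OF U that p2, where G = "\<lambda>a b. coeff (ladj a * b) (-1)"]) (auto intro: g2)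
    show "H1 p \<in> m_sub" "H2 p \<in> m_sub" if "p \<in> U" for p
      using f1(5) f2(6) that by (auto simp: H1_def H2_def)
  qed (use p1 p2 in auto)
qed

text \<open>\<open>\<Psi>\<close> is continuous with values in \<open>tLG\<close>, within which each
  big cell contains a neighbourhood of each of its points. The origin is regular because
  \<open>\<Psi>\<close> is 1 there.\<close>

lemma regular_set:
  assumes D: "open D" "(0, 0) \<in> D" and fr: "extended_framing D \<psi> \<Psi>"
  defines "U \<equiv> D - sing_set D \<Psi>"
  shows "open U" "(0, 0) \<in> U" "\<exists>\<Psi>m Lp \<Psi>p Lm. splits_on U \<Psi> \<Psi>m Lp \<Psi>p Lm"
proof -
  have t: "\<Psi> p \<in> tLG" if "p \<in> D" for p using fr that by (auto simp: extended_framing_def)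
  have cont: "continuous_on D \<Psi>"
    using fr by (auto simp: extended_framing_def intro: smooth_on_imp_continuous_on)
  have U: "p \<in> U \<longleftrightarrow> p \<in> D \<and> \<Psi> p \<in> big_cell (-1) \<and> \<Psi> p \<in> big_cell 1" for p
    by (auto simp: U_def sing_set_def big_cell_simps)
  have nb: "\<forall>\<^sub>F q in nhds p. q \<in> D \<and> \<Psi> q \<in> big_cell s"
    if p: "p \<in> D" and bc: "\<Psi> p \<in> big_cell s" and s: "s = 1 \<or> s = -1" for p s
  proof -
    obtain e where e: "e > 0" "\<And>\<gamma>. \<gamma> \<in> tLG \<Longrightarrow> dist \<gamma> (\<Psi> p) < e \<Longrightarrow> \<gamma> \<in> big_cell s"
      using big_cell_neighbourhood[OF s bc] by blast
    have "isCont \<Psi> p" using cont D(1) p by (simp add: continuous_on_eq_continuous_at)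
    then have "(\<Psi> \<longlongrightarrow> \<Psi> p) (nhds p)"
      by (simp add: isCont_def tendsto_at_iff_tendsto_nhds)
    then have "\<forall>\<^sub>F q in nhds p. dist (\<Psi> q) (\<Psi> p) < e"
      using e(1) by (rule tendstoD)
    moreover have "\<forall>\<^sub>F q in nhds p. q \<in> D" using D(1) p by (rule eventually_nhds_in_open)
    ultimately show ?thesis by eventually_elim (auto intro: e t)
  qed
  have "\<forall>\<^sub>F q in nhds p. q \<in> U" if "p \<in> U" for p
    using nb[of p 1] nb[of p "-1"] that by (simp add: U eventually_conj_iff)
  then show "open U"
    unfolding eventually_nhds open_subopen[of U] by (meson subsetI)
  have "1 \<in> big_cell s" for s
    using one_in_tLG_star[of "- s"] one_in_tLG_star[of s] unfolding big_cell_def tLG_star_def by force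
  then show "(0, 0) \<in> U" using D(2) fr by (simp add: U extended_framing_def)
  have "\<forall>p\<in>U. \<exists>a b c d. a \<in> tLG_star 1 \<and> b \<in> tLG_side (-1) \<and> c \<in> tLG_star (-1) \<and> d \<in> tLG_side 1 \<and>
      \<Psi> p = a * b \<and> \<Psi> p = c * d"
  proof
    fix p assume "p \<in> U"
    then have "\<Psi> p \<in> big_cell (-1)" "\<Psi> p \<in> big_cell 1" by (simp_all add: U)
    then show "\<exists>a b c d. a \<in> tLG_star 1 \<and> b \<in> tLG_side (-1) \<and> c \<in> tLG_star (-1) \<and> d \<in> tLG_side 1 \<and>
        \<Psi> p = a * b \<and> \<Psi> p = c * d"
      unfolding big_cell_def mem_Collect_eq minus_minus by metis
  qed
  then show "\<exists>\<Psi>m Lp \<Psi>p Lm. splits_on U \<Psi> \<Psi>m Lp \<Psi>p Lm"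
    unfolding splits_on_def tLG_side_simps by metis
qed

lemma lmonom_mult_cancel:
  assumes "\<gamma> \<in> tLG"
  shows "lpow (- k) * linv \<gamma> * (\<gamma> * lmonom k X) = lmonom 0 X"
proof -
  have "lpow (- k) * linv \<gamma> * (\<gamma> * lmonom k X) = lpow (- k) * (linv \<gamma> * \<gamma>) * lmonom k X"
    by (simp only: mult.assoc)
  then show ?thesis
    by (simp add: linv_eq_ladj[OF assms] ladj_mult_self[OF assms] lmonom_mult_lmonom)
qed

lemma splitting_potentials:
  assumes U: "open U" and fr: "extended_framing D \<psi> \<Psi>" and D: "open D" "U \<subseteq> D"
    and sp: "splits_on U \<Psi> \<Psi>m Lp \<Psi>p Lm"
  shows "smooth_on U \<Psi>m \<and> smooth_on U \<Psi>p \<and>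
    (\<exists>\<eta>1 \<eta>2.
      (\<forall>p\<in>U. \<forall>h. lmonom 0 (\<eta>1 p h) = lpow (-1) * linv (\<Psi>p p) * ext_d \<Psi>p p h \<and>
                  lmonom 0 (\<eta>2 p h) = lpow 1 * linv (\<Psi>m p) * ext_d \<Psi>m p h) \<and>
      valued_in U m_sub \<eta>1 \<and> lorentz_holomorphic U \<eta>1 \<and>
      valued_in U m_sub \<eta>2 \<and> lorentz_antiholomorphic U \<eta>2)"
proof -
  obtain H1 H2 where H': "smooth_on U \<Psi>m" "smooth_on U \<Psi>p" "smooth_on U H1" "smooth_on U H2"
    "\<forall>p\<in>U. H1 p \<in> m_sub" "\<forall>p\<in>U. H2 p \<in> m_sub"
    "\<forall>p\<in>U. (\<Psi>p has_derivative partials (\<Psi>p p * lmonom 1 (H1 p)) 0) (at p)"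
    "\<forall>p\<in>U. (\<Psi>m has_derivative partials 0 (\<Psi>m p * lmonom (-1) (H2 p))) (at p)"
    "\<forall>p\<in>U. pdy H1 p = 0" "\<forall>p\<in>U. pdx H2 p = 0"
    by (rule splitting_factors[OF assms])
  note H = H'[rule_format]
  have t: "\<Psi>p p \<in> tLG" "\<Psi>m p \<in> tLG" if "p \<in> U" for p
    using sp that by (auto simp: splits_on_def tLG_side_simps dest: tLG_starD(1))
  let ?\<eta>1 = "\<lambda>p h. fst h *\<^sub>R H1 p" and ?\<eta>2 = "\<lambda>p h. snd h *\<^sub>R H2 p"
  have e: "lmonom 0 (?\<eta>1 p h) = lpow (-1) * linv (\<Psi>p p) * ext_d \<Psi>p p h \<and>
      lmonom 0 (?\<eta>2 p h) = lpow 1 * linv (\<Psi>m p) * ext_d \<Psi>m p h" if p: "p \<in> U" for p and h :: plane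
  proof -
    have "ext_d \<Psi>p p h = fst h *\<^sub>R (\<Psi>p p * lmonom 1 (H1 p))" "ext_d \<Psi>m p h = snd h *\<^sub>R (\<Psi>m p * lmonom (-1) (H2 p))"
      unfolding ext_d_def frechet_derivative_at[OF H(7)[OF p], symmetric]
        frechet_derivative_at[OF H(8)[OF p], symmetric] by simp_all
    moreover note lmonom_mult_cancel[OF t(1)[OF p], of 1 "H1 p"]
      and lmonom_mult_cancel[OF t(2)[OF p], of "-1" "H2 p", unfolded minus_minus]
    ultimately show ?thesis
      by (simp only: lmonom_scaleR mult_scaleR_right)
  qed
  have "r *\<^sub>R X \<in> m_sub" if "X \<in> m_sub" for r X using that by (simp add: m_sub_iff)
  then have "valued_in U m_sub ?\<eta>1" "valued_in U m_sub ?\<eta>2"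
    using H(5,6) by (simp_all add: valued_in_def)
  moreover have "lorentz_holomorphic U ?\<eta>1" "lorentz_antiholomorphic U ?\<eta>2"
    unfolding lorentz_holomorphic_def lorentz_antiholomorphic_def using H by blast+
  ultimately show ?thesis using H(1,2) e by (intro conjI exI[of _ ?\<eta>1] exI[of _ ?\<eta>2]) auto
qed

section \<open>Flat linear systems\<close>

text \<open>The zero set is closed by continuity. It is open because on a ball whose radius times
  the bound of \<open>\<kappa>\<close> is at most 1/2, the mean value inequality bounds the maximum
  of the norm of \<open>e\<close> by half of itself. Only an estimate of the derivative is assumed,
  so the lemma also covers quantities whose equation is not of the form e' = e a.\<close>

lemma linear_system_unique:
  fixes e :: "plane \<Rightarrow> 'b::real_normed_vector"
  assumes V: "open V" "connected V" and p0: "p0 \<in> V" "e p0 = 0"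
    and d: "\<And>p. p \<in> V \<Longrightarrow> (e has_derivative e' p) (at p)"
    and bd: "\<And>p h. p \<in> V \<Longrightarrow> norm (e' p h) \<le> \<kappa> p * norm (e p) * norm h"
    and \<kappa>: "continuous_on V \<kappa>" and p: "p \<in> V"
  shows "e p = 0"
proof -
  define Z where "Z = {p \<in> V. e p = 0}"
  have cont: "continuous_on V e"
    using d by (auto intro!: continuous_at_imp_continuous_on dest: has_derivative_continuous)
  have cl: "closedin (top_of_set V) Z"
    unfolding Z_def by (rule continuous_closedin_preimage_constant[OF cont])
  have "\<exists>r>0. ball q r \<subseteq> Z" if q: "q \<in> Z" for q
  proof -
    obtain r where r: "r > 0" "cball q r \<subseteq> V"
      using V(1) q unfolding Z_def open_contains_cball by blast
    have "compact (\<kappa> ` cball q r)"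
      by (rule compact_continuous_image[OF continuous_on_subset[OF \<kappa> r(2)]]) simp
    then obtain K where K: "K > 0" "\<And>p. p \<in> cball q r \<Longrightarrow> \<bar>\<kappa> p\<bar> \<le> K"
      unfolding compact_eq_bounded_closed bounded_pos by auto
    define \<rho> where "\<rho> = min r (1 / (2 * K))"
    have \<rho>: "\<rho> > 0" "\<rho> \<le> r" "K * \<rho> \<le> 1 / 2"
      using r(1) K(1) by (auto simp: \<rho>_def min_def field_simps)
    have sub: "cball q \<rho> \<subseteq> V" "cball q \<rho> \<subseteq> cball q r" using \<rho>(2) r(2) by auto
    have "\<exists>m\<in>cball q \<rho>. \<forall>p\<in>cball q \<rho>. norm (e p) \<le> norm (e m)"
      by (rule continuous_attains_sup[OF compact_cball _ continuous_on_norm[OF continuous_on_subset[OF cont sub(1)]]])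
        (use \<rho>(1) in auto)
    then obtain m where m: "m \<in> cball q \<rho>" "\<And>p. p \<in> cball q \<rho> \<Longrightarrow> norm (e p) \<le> norm (e m)" by blast
    have "norm (e m - e q) \<le> (K * norm (e m)) * norm (m - q)"
    proof (rule differentiable_bound[where f' = e'])
      fix p assume p: "p \<in> cball q \<rho>"
      then show "(e has_derivative e' p) (at p within cball q \<rho>)"
        using sub(1) by (intro has_derivative_at_withinI[OF d]) blast
      show "onorm (e' p) \<le> K * norm (e m)"
      proof (rule onorm_le)
        fix h
        have "norm (e' p h) \<le> \<kappa> p * norm (e p) * norm h" using p sub(1) by (intro bd) auto
        also have "\<dots> \<le> K * norm (e m) * norm h"
          using K(2)[of p] K(1) m(2)[OF p] p sub(2) by (intro mult_right_mono mult_mono) auto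
        finally show "norm (e' p h) \<le> K * norm (e m) * norm h" .
      qed
    qed (use m \<rho> in auto)
    also have "\<dots> \<le> (K * norm (e m)) * \<rho>"
      using m(1) K(1) by (intro mult_left_mono) (auto simp: dist_norm norm_minus_commute)
    also have "\<dots> \<le> (1 / 2) * norm (e m)"
      using mult_right_mono[OF \<rho>(3), of "norm (e m)"] by (simp add: mult.commute mult.left_commute)
    finally have "norm (e m) \<le> 0" using q by (simp add: Z_def)
    then have "e p = 0" if "p \<in> cball q \<rho>" for p using m(2)[OF that] by simp
    then show ?thesis using \<rho>(1) sub(1) unfolding Z_def by (intro exI[of _ \<rho>]) auto
  qed
  then have "open Z" by (auto simp: open_contains_ball)
  then have "openin (top_of_set V) Z" by (simp add: Z_def open_subset subset_iff)
  then have "Z = V" using cl V(2) p0 unfolding connected_clopen Z_def by blast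
  then show ?thesis using p by (auto simp: Z_def)
qed

text \<open>The integral from \<open>c\<close> to \<open>x\<close>, rescaled to the unit interval: no case distinction between
  \<open>x < c\<close> and \<open>x > c\<close> is needed, and dependence on parameters is continuous.\<close>

definition seg_integral :: "(real \<Rightarrow> 'a::banach) \<Rightarrow> real \<Rightarrow> real \<Rightarrow> 'a"
  where "seg_integral h c x = (x - c) *\<^sub>R integral {0..1} (\<lambda>t. h (c + t * (x - c)))"

lemma seg_in_interval:
  fixes c x t :: real
  assumes "c \<in> {l..r}" "x \<in> {l..r}" "t \<in> {0..1}"
  shows "c + t * (x - c) \<in> {l..r}"
proof -
  have "(1 - t) *\<^sub>R c + t *\<^sub>R x \<in> {l..r}"
    using assms by (intro convexD_alt) auto
  then show ?thesis by (simp add: algebra_simps)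
qed

lemma seg_integral_eq_diff:
  fixes h :: "real \<Rightarrow> 'a::banach"
  assumes H: "\<And>x. x \<in> {l..r} \<Longrightarrow> (H has_vector_derivative h x) (at x within {l..r})"
    and c: "c \<in> {l..r}" and x: "x \<in> {l..r}"
  shows "seg_integral h c x = H x - H c"
proof -
  let ?g = "\<lambda>t. c + t * (x - c)"
  have im: "?g ` {0..1} \<subseteq> {l..r}" using seg_in_interval[OF c x] by auto
  have "((\<lambda>t. (x - c) *\<^sub>R h (?g t)) has_integral (H \<circ> ?g) 1 - (H \<circ> ?g) 0) {0..1}"
  proof (rule fundamental_theorem_of_calculus)
    fix t :: real assume t: "t \<in> {0..1}"
    show "(H \<circ> ?g has_vector_derivative (x - c) *\<^sub>R h (?g t)) (at t within {0..1})"
    proof (rule vector_diff_chain_within)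
      show "(?g has_vector_derivative x - c) (at t within {0..1})"
        by (auto intro!: derivative_eq_intros simp flip: has_real_derivative_iff_has_vector_derivative)
      show "(H has_vector_derivative h (?g t)) (at (?g t) within ?g ` {0..1})"
        by (rule has_vector_derivative_within_subset[OF H im]) (use im t in blast)
    qed
  qed simp
  then show ?thesis
    unfolding seg_integral_def by (auto dest!: integral_unique)
qed

lemma seg_integral_derivative:
  fixes h :: "real \<Rightarrow> 'a::banach"
  assumes h: "continuous_on {l..r} h" and c: "c \<in> {l..r}" and x: "x \<in> {l..r}"
  shows "((\<lambda>x. seg_integral h c x) has_vector_derivative h x) (at x within {l..r})"
proof -
  obtain H where H: "\<And>x. x \<in> {l..r} \<Longrightarrow> (H has_vector_derivative h x) (at x within {l..r})"
    using antiderivative_continuous[OF h] by blast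
  have "((\<lambda>x. H x - H c) has_vector_derivative h x) (at x within {l..r})"
    using has_vector_derivative_diff[OF H[OF x] has_vector_derivative_const[of "H c"]] by simp
  then show ?thesis
    by (rule has_vector_derivative_transform[OF x, rotated]) (rule seg_integral_eq_diff[OF H c])
qed

lemma norm_seg_integral_le:
  fixes h :: "real \<Rightarrow> 'a::banach"
  assumes h: "continuous_on {l..r} h" and c: "c \<in> {l..r}" and x: "x \<in> {l..r}"
    and B: "\<And>x. x \<in> {l..r} \<Longrightarrow> norm (h x) \<le> B"
  shows "norm (seg_integral h c x) \<le> (r - l) * B"
proof -
  have "norm (integral {0..1} (\<lambda>t. h (c + t * (x - c)))) \<le> B * (1 - 0)"
    by (rule integral_bound)
      (auto intro!: continuous_on_compose2[OF h] continuous_intros seg_in_interval[OF c x, simplified] B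
        simp: seg_in_interval[OF c x, simplified])
  moreover have "B \<ge> 0" using B[OF c] norm_ge_zero order_trans by blast
  moreover have "\<bar>x - c\<bar> \<le> r - l" using c x by auto
  ultimately show ?thesis
    unfolding seg_integral_def norm_scaleR using c by (intro mult_mono) auto
qed

lemma seg_integral_self [simp]: "seg_integral h c c = 0"
  by (simp add: seg_integral_def)

lemma continuous_on_seg_integral:
  fixes k :: "'p::topological_space \<Rightarrow> real \<Rightarrow> 'a::banach"
  assumes k: "continuous_on (S \<times> {l..r}) (\<lambda>(p, t). k p t)" and c: "c \<in> {l..r}"
    and \<xi>: "continuous_on S \<xi>" "\<And>p. p \<in> S \<Longrightarrow> \<xi> p \<in> {l..r}"
  shows "continuous_on S (\<lambda>p. seg_integral (k p) c (\<xi> p))"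
proof -
  have "continuous_on (S \<times> cbox 0 1) (\<lambda>(p, t). k p (c + t * (\<xi> p - c)))"
    unfolding case_prod_unfold
    by (rule continuous_on_compose2[OF k, of _ "\<lambda>z. (fst z, c + snd z * (\<xi> (fst z) - c))", unfolded case_prod_unfold fst_conv snd_conv])
      (auto intro!: continuous_intros continuous_on_compose2[OF \<xi>(1)] seg_in_interval[OF c \<xi>(2), simplified]
        simp: seg_in_interval[OF c \<xi>(2), simplified])
  then have "continuous_on S (\<lambda>p. integral (cbox 0 1) (\<lambda>t. k p (c + t * (\<xi> p - c))))"
    by (rule integral_continuous_on_param)
  then show ?thesis
    unfolding seg_integral_def cbox_interval by (intro continuous_intros \<xi>(1))
qed

text \<open>The system \<open>f\<^sub>x = f a\<close>, \<open>f\<^sub>y = f b\<close> is first integrated along the horizontal line through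
  the base point and then along vertical lines, by a contraction argument.\<close>

lemma box_integral_equation:
  fixes a b :: "plane \<Rightarrow> 'a::{real_normed_algebra, banach}"
  assumes x0: "x0 \<in> {x1..x2}" and y0: "y0 \<in> {y1..y2}"
    and ca: "continuous_on ({x1..x2} \<times> {y1..y2}) a" and cb: "continuous_on ({x1..x2} \<times> {y1..y2}) b"
    and K: "\<And>p. p \<in> {x1..x2} \<times> {y1..y2} \<Longrightarrow> norm (a p) \<le> K \<and> norm (b p) \<le> K"
    and small: "(x2 - x1) * K \<le> 1 / 4" "(y2 - y1) * K \<le> 1 / 4"
  obtains f where "continuous_on ({x1..x2} \<times> {y1..y2}) f"
    "\<And>x y. x \<in> {x1..x2} \<Longrightarrow> y \<in> {y1..y2} \<Longrightarrow> f (x, y) =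
      g + seg_integral (\<lambda>s. f (s, y0) * a (s, y0)) x0 x + seg_integral (\<lambda>t. f (x, t) * b (x, t)) y0 y"
proof -
  define Q where "Q = {x1..x2} \<times> {y1..y2}"
  have Qc: "Q = cbox (x1, y1) (x2, y2)" by (simp add: Q_def cbox_Pair_eq)
  define G where "G f = (\<lambda>p. g + seg_integral (\<lambda>s. f (s, y0) * a (s, y0)) x0 (fst p) +
      seg_integral (\<lambda>t. f (fst p, t) * b (fst p, t)) y0 (snd p))" for f :: "plane \<Rightarrow> 'a"
  have x: "continuous_on {x1..x2} (\<lambda>s. f (s, y0) * a (s, y0))" if "continuous_on Q f" for f :: "plane \<Rightarrow> 'a"
    by (intro continuous_intros continuous_on_compose2[OF that] continuous_on_compose2[OF ca])
      (use y0 in \<open>auto simp: Q_def\<close>)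
  have y: "continuous_on {y1..y2} (\<lambda>t. f (x, t) * b (x, t))" if "continuous_on Q f" "x \<in> {x1..x2}" for f :: "plane \<Rightarrow> 'a" and x
    by (intro continuous_intros continuous_on_compose2[OF that(1)] continuous_on_compose2[OF cb])
      (use that(2) in \<open>auto simp: Q_def\<close>)
  have G: "continuous_on Q (G f)" if f: "continuous_on Q f" for f
  proof -
    have "continuous_on (Q \<times> {x1..x2}) (\<lambda>(p, s). f (s, y0) * a (s, y0))"
      unfolding case_prod_unfold by (rule continuous_on_compose2[OF x[OF f]]) (auto intro!: continuous_intros)
    moreover have "continuous_on (Q \<times> {y1..y2}) (\<lambda>(p, t). f (fst p, t) * b (fst p, t))"
      unfolding case_prod_unfold
      by (intro continuous_intros continuous_on_compose2[OF f] continuous_on_compose2[OF cb])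
        (auto simp: Q_def)
    ultimately show ?thesis
      unfolding G_def
      by (intro continuous_on_add continuous_on_const continuous_on_seg_integral[OF _ x0] continuous_on_seg_integral[OF _ y0])
        (auto intro!: continuous_intros simp: Q_def)
  qed
  \<comment> \<open>The fixed-point theorem needs a complete type, here the bounded continuous maps
    on the whole plane. The retraction \<open>clamp\<close> onto the rectangle prolongs the values
    of \<open>G f\<close> to such a map.\<close>
  let ?cl = "clamp (x1, y1) (x2, y2)"
  have ne: "x1 \<le> x2" "y1 \<le> y2" using x0 y0 by auto
  have cl: "?cl p \<in> Q" for p :: plane
    unfolding Qc by (rule clamp_in_interval) (use ne in \<open>auto simp: Basis_prod_def\<close>)
  define T where "T f = Bcontfun (\<lambda>p. G (apply_bcontfun f) (?cl p))" for f :: "plane \<Rightarrow>\<^sub>C 'a"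
  have cf: "continuous_on Q (apply_bcontfun f)" for f :: "plane \<Rightarrow>\<^sub>C 'a"
    by simp
  have T: "apply_bcontfun (T f) = (\<lambda>p. G (apply_bcontfun f) (?cl p))" for f
    unfolding T_def
  proof (rule Bcontfun_inverse)
    have "compact (G f ` Q)" by (rule compact_continuous_image[OF G[OF cf]]) (simp add: Qc)
    then obtain B where B: "\<forall>z\<in>G f ` Q. norm z \<le> B"
      by (auto dest!: compact_imp_bounded simp: bounded_iff)
    have "continuous_on UNIV (\<lambda>p. G f (?cl p))"
      by (rule clamp_continuous_on) (use G[OF cf] in \<open>simp add: Qc\<close>)
    then show "(\<lambda>p. G f (?cl p)) \<in> bcontfun"
      by (rule bcontfun_normI[where b = B]) (use B cl in blast)
  qed
  have "dist (T f) (T h) \<le> (1 / 2) * dist f h" for f h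
  proof (rule dist_bound)
    fix p :: plane
    obtain x y where q: "?cl p = (x, y)" "x \<in> {x1..x2}" "y \<in> {y1..y2}"
      using cl[of p] by (cases "?cl p") (auto simp: Q_def)
    let ?d = "dist f h"
    have fh: "norm (f q - h q) \<le> ?d" for q
      using dist_bounded[of f q h] by (simp add: dist_norm)
    have i1: "seg_integral (\<lambda>s. f (s, y0) * a (s, y0)) x0 x - seg_integral (\<lambda>s. h (s, y0) * a (s, y0)) x0 x =
        seg_integral (\<lambda>s. (f (s, y0) - h (s, y0)) * a (s, y0)) x0 x"
    proof -
      have "(\<lambda>t. f (x0 + t * (x - x0), y0) * a (x0 + t * (x - x0), y0)) integrable_on {0..1}" for f :: "plane \<Rightarrow>\<^sub>C 'a"
        using seg_in_interval[OF x0 q(2)]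
        by (intro integrable_continuous_real continuous_on_compose2[OF x[OF cf]] continuous_intros) auto
      then show ?thesis
        by (simp add: seg_integral_def integral_diff left_diff_distrib flip: scaleR_diff_right)
    qed
    have i2: "seg_integral (\<lambda>t. f (x, t) * b (x, t)) y0 y - seg_integral (\<lambda>t. h (x, t) * b (x, t)) y0 y =
        seg_integral (\<lambda>t. (f (x, t) - h (x, t)) * b (x, t)) y0 y"
    proof -
      have "(\<lambda>t. f (x, y0 + t * (y - y0)) * b (x, y0 + t * (y - y0))) integrable_on {0..1}" for f :: "plane \<Rightarrow>\<^sub>C 'a"
        using seg_in_interval[OF y0 q(3)]
        by (intro integrable_continuous_real continuous_on_compose2[OF y[OF cf q(2)]] continuous_intros) auto
      then show ?thesis
        by (simp add: seg_integral_def integral_diff left_diff_distrib flip: scaleR_diff_right)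
    qed
    have cm: "continuous_on Q (\<lambda>q. f q - h q)" by (intro continuous_intros) auto
    have n1: "norm (seg_integral (\<lambda>s. (f (s, y0) - h (s, y0)) * a (s, y0)) x0 x) \<le> (x2 - x1) * (?d * K)"
      by (rule norm_seg_integral_le[OF x[OF cm] x0 q(2)])
        (use K y0 in \<open>auto intro!: order_trans[OF norm_mult_ineq] mult_mono fh\<close>)
    have n2: "norm (seg_integral (\<lambda>t. (f (x, t) - h (x, t)) * b (x, t)) y0 y) \<le> (y2 - y1) * (?d * K)"
      by (rule norm_seg_integral_le[OF y[OF cm q(2)] y0 q(3)])
        (use K q(2) in \<open>auto intro!: order_trans[OF norm_mult_ineq] mult_mono fh\<close>)
    have "dist (T f p) (T h p) = norm ((seg_integral (\<lambda>s. f (s, y0) * a (s, y0)) x0 x - seg_integral (\<lambda>s. h (s, y0) * a (s, y0)) x0 x) +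
        (seg_integral (\<lambda>t. f (x, t) * b (x, t)) y0 y - seg_integral (\<lambda>t. h (x, t) * b (x, t)) y0 y))"
      by (simp add: T G_def q(1) dist_norm algebra_simps)
    also have "\<dots> \<le> (x2 - x1) * (?d * K) + (y2 - y1) * (?d * K)"
      unfolding i1 i2 by (rule order_trans[OF norm_triangle_ineq add_mono[OF n1 n2]])
    also have "\<dots> = ((x2 - x1) * K + (y2 - y1) * K) * ?d" by (simp add: algebra_simps)
    also have "\<dots> \<le> (1 / 2) * ?d" using small by (intro mult_right_mono) auto
    finally show "dist (T f p) (T h p) \<le> (1 / 2) * ?d" .
  qed
  then have "\<exists>!f. T f = f" by (intro banach_fix_type[of "1/2"]) auto
  then obtain f where f: "T f = f" by blast
  have "f (x, y) = G f (x, y)" if "x \<in> {x1..x2}" "y \<in> {y1..y2}" for x y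
  proof -
    have "?cl (x, y) = (x, y)" using that by (intro clamp_cancel_cbox) (simp add: cbox_Pair_eq)
    then show ?thesis using T[of f] f by metis
  qed
  then show thesis using cf[of f] that[of f] by (simp add: G_def Q_def)
qed

text \<open>It remains to verify \<open>f\<^sub>x = f a\<close> off that line. The map \<open>u\<close> with \<open>u\<^sub>x = f a\<close> and \<open>u = f\<close> at
  \<open>x = x\<^sub>0\<close> satisfies \<open>u\<^sub>y = u b + \<integral> (f - u) b\<^sub>x\<close> by flatness, so that \<open>f - u\<close> solves a homogeneous
  linear equation.\<close>

lemma flat_box_solution:
  fixes a b ay bx :: "plane \<Rightarrow> 'a::{real_normed_algebra, banach}"
  defines "Q \<equiv> \<lambda>x1 x2 y1 y2. {x1..x2} \<times> {y1..y2 :: real}"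
  assumes x0: "x0 \<in> {x1..x2}" and y0: "y0 \<in> {y1..y2}"
    and cont: "continuous_on (Q x1 x2 y1 y2) a" "continuous_on (Q x1 x2 y1 y2) b"
      "continuous_on (Q x1 x2 y1 y2) ay" "continuous_on (Q x1 x2 y1 y2) bx"
    and da: "\<And>x y. x \<in> {x1..x2} \<Longrightarrow> y \<in> {y1..y2} \<Longrightarrow>
      ((\<lambda>t. a (x, t)) has_vector_derivative ay (x, y)) (at y within {y1..y2})"
    and db: "\<And>x y. x \<in> {x1..x2} \<Longrightarrow> y \<in> {y1..y2} \<Longrightarrow>
      ((\<lambda>t. b (t, y)) has_vector_derivative bx (x, y)) (at x within {x1..x2})"
    and flat: "\<And>p. p \<in> Q x1 x2 y1 y2 \<Longrightarrow> ay p + b p * a p = bx p + a p * b p"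
    and K: "\<And>p. p \<in> Q x1 x2 y1 y2 \<Longrightarrow> norm (a p) \<le> K \<and> norm (b p) \<le> K \<and> norm (bx p) \<le> K"
    and small: "(x2 - x1) * K \<le> 1 / 4" "(y2 - y1) * K \<le> 1 / 4" "x2 - x1 \<le> 1"
  obtains f where "f (x0, y0) = g"
    "\<And>p. p \<in> {x1<..<x2} \<times> {y1<..<y2} \<Longrightarrow> (f has_derivative partials (f p * a p) (f p * b p)) (at p)"
proof -
  define R where "R = Q x1 x2 y1 y2"
  note RQ = R_def Q_def
  note cont = cont[folded R_def] and flat = flat[folded R_def] and K = K[folded R_def]
  have inR: "(x, y) \<in> R" if "x \<in> {x1..x2}" "y \<in> {y1..y2}" for x y using that by (simp add: RQ)
  obtain f where cf: "continuous_on R f" and f: "\<And>x y. x \<in> {x1..x2} \<Longrightarrow> y \<in> {y1..y2} \<Longrightarrow> f (x, y) =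
      g + seg_integral (\<lambda>s. f (s, y0) * a (s, y0)) x0 x + seg_integral (\<lambda>t. f (x, t) * b (x, t)) y0 y"
    using box_integral_equation[OF x0 y0 cont(1,2)[unfolded RQ] _ small(1,2), of g] K unfolding RQ by blast
  have sec1: "continuous_on {x1..x2} (\<lambda>s. h (s, y))" if "continuous_on R h" "y \<in> {y1..y2}" for h :: "plane \<Rightarrow> 'a" and y
    by (rule continuous_on_compose2[OF that(1)]) (use that(2) in \<open>auto intro!: continuous_intros inR\<close>)
  have sec2: "continuous_on {y1..y2} (\<lambda>t. h (x, t))" if "continuous_on R h" "x \<in> {x1..x2}" for h :: "plane \<Rightarrow> 'a" and x
    by (rule continuous_on_compose2[OF that(1)]) (use that(2) in \<open>auto intro!: continuous_intros inR\<close>)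
  note cfa = continuous_on_mult[OF cf cont(1)] and cfb = continuous_on_mult[OF cf cont(2)]
  have f0: "f (x, y0) = g + seg_integral (\<lambda>s. f (s, y0) * a (s, y0)) x0 x" if "x \<in> {x1..x2}" for x
    using f[OF that y0] by simp
  have f00: "f (x0, y0) = g" using f0[OF x0] by simp
  have fy: "((\<lambda>t. f (x, t)) has_vector_derivative f (x, y) * b (x, y)) (at y within {y1..y2})"
    if x: "x \<in> {x1..x2}" and y: "y \<in> {y1..y2}" for x y
  proof -
    let ?c = "g + seg_integral (\<lambda>s. f (s, y0) * a (s, y0)) x0 x"
    have "((\<lambda>t. ?c + seg_integral (\<lambda>t. f (x, t) * b (x, t)) y0 t) has_vector_derivative 0 + f (x, y) * b (x, y))
        (at y within {y1..y2})"
      by (intro has_vector_derivative_add has_vector_derivative_const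
          seg_integral_derivative[OF sec2[OF cfb x] y0 y])
    then have "((\<lambda>t. ?c + seg_integral (\<lambda>t. f (x, t) * b (x, t)) y0 t) has_vector_derivative f (x, y) * b (x, y))
        (at y within {y1..y2})" by simp
    then show ?thesis
      by (rule has_vector_derivative_transform[OF y, rotated]) (rule f[OF x])
  qed
  define u where "u p = f (x0, snd p) + seg_integral (\<lambda>s. f (s, snd p) * a (s, snd p)) x0 (fst p)" for p
  have ux: "((\<lambda>s. u (s, y)) has_vector_derivative f (x, y) * a (x, y)) (at x within {x1..x2})"
    if x: "x \<in> {x1..x2}" and y: "y \<in> {y1..y2}" for x y
    using has_vector_derivative_add[OF has_vector_derivative_const
        seg_integral_derivative[OF sec1[OF cfa y] x0 x]]
    by (simp add: u_def)
  have cu: "continuous_on R u"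
    unfolding u_def
  proof (intro continuous_on_add continuous_on_seg_integral[OF _ x0])
    show "continuous_on R (\<lambda>p. f (x0, snd p))"
      by (rule continuous_on_compose2[OF cf]) (use x0 in \<open>auto intro!: continuous_intros simp: RQ\<close>)
    show "continuous_on (R \<times> {x1..x2}) (\<lambda>(p, s). f (s, snd p) * a (s, snd p))"
      unfolding case_prod_unfold
      by (rule continuous_on_compose2[OF cfa]) (auto intro!: continuous_intros simp: RQ)
  qed (auto intro!: continuous_intros simp: RQ)
  \<comment> \<open>This is the y-derivative of f a, computed from f_y = f b.\<close>
  define w where "w p = f p * b p * a p + f p * ay p" for p
  have cw: "continuous_on R w"
    unfolding w_def by (intro continuous_intros cf cont)
  have uy: "((\<lambda>t. u (x, t)) has_vector_derivative
      f (x0, y) * b (x0, y) + seg_integral (\<lambda>s. w (s, y)) x0 x) (at y within {y1..y2})"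
    if x: "x \<in> {x1..x2}" and y: "y \<in> {y1..y2}" for x y
  proof -
    note seg = seg_in_interval[OF x0 x]
    let ?s = "\<lambda>\<theta>. x0 + \<theta> * (x - x0)"
    have "((\<lambda>t. integral (cbox 0 1) (\<lambda>\<theta>. f (?s \<theta>, t) * a (?s \<theta>, t))) has_vector_derivative
        integral (cbox 0 1) (\<lambda>\<theta>. w (?s \<theta>, y))) (at y within {y1..y2})"
    proof (rule leibniz_rule_vector_derivative[where fx = "\<lambda>t \<theta>. w (?s \<theta>, t)"])
      fix t \<theta> :: real assume t: "t \<in> {y1..y2}" "\<theta> \<in> cbox 0 1"
      then have s: "?s \<theta> \<in> {x1..x2}" using seg by auto
      from has_vector_derivative_mult[OF fy[OF s t(1)] da[OF s t(1)]]
      show "((\<lambda>t. f (?s \<theta>, t) * a (?s \<theta>, t)) has_vector_derivative w (?s \<theta>, t)) (at t within {y1..y2})"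
        by (simp add: w_def add.commute)
    next
      fix t assume t: "t \<in> {y1..y2}"
      have "continuous_on (cbox 0 1) (\<lambda>\<theta>. f (?s \<theta>, t) * a (?s \<theta>, t))"
        by (rule continuous_on_compose2[OF sec1[OF cfa t]]) (use seg in \<open>auto intro!: continuous_intros\<close>)
      then show "(\<lambda>\<theta>. f (?s \<theta>, t) * a (?s \<theta>, t)) integrable_on cbox 0 1"
        by (rule integrable_continuous)
    next
      show "continuous_on ({y1..y2} \<times> cbox 0 1) (\<lambda>(t, \<theta>). w (?s \<theta>, t))"
        unfolding case_prod_unfold
        by (rule continuous_on_compose2[OF cw]) (use seg in \<open>auto intro!: continuous_intros inR\<close>)
    qed (use y in auto)
    then have "((\<lambda>t. (x - x0) *\<^sub>R integral (cbox 0 1) (\<lambda>\<theta>. f (?s \<theta>, t) * a (?s \<theta>, t))) has_vector_derivative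
        (x - x0) *\<^sub>R integral (cbox 0 1) (\<lambda>\<theta>. w (?s \<theta>, y))) (at y within {y1..y2})"
      by (rule bounded_linear.has_vector_derivative[OF bounded_linear_scaleR_right])
    from has_vector_derivative_add[OF fy[OF x0 y] this]
    show ?thesis by (simp add: u_def seg_integral_def cbox_interval)
  qed
  have u0: "u (x0, y) = f (x0, y)" for y by (simp add: u_def)
  \<comment> \<open>The product u b is recovered by integrating its x-derivative u b_x + f a b from
    \<open>x0\<close>, where \<open>u\<close> agrees with \<open>f\<close>.\<close>
  have ub: "u (x, y) * b (x, y) = f (x0, y) * b (x0, y) +
      seg_integral (\<lambda>s. u (s, y) * bx (s, y) + f (s, y) * a (s, y) * b (s, y)) x0 x"
    if x: "x \<in> {x1..x2}" and y: "y \<in> {y1..y2}" for x y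
  proof -
    have "seg_integral (\<lambda>s. u (s, y) * bx (s, y) + f (s, y) * a (s, y) * b (s, y)) x0 x =
        u (x, y) * b (x, y) - u (x0, y) * b (x0, y)"
      by (rule seg_integral_eq_diff[OF _ x0 x]) (intro has_vector_derivative_mult ux db y)
    then show ?thesis by (simp add: u0)
  qed
  define e where "e p = f p - u p" for p
  have ce: "continuous_on R e" unfolding e_def by (intro continuous_intros cf cu)
  have "\<exists>m\<in>R. \<forall>p\<in>R. norm (e p) \<le> norm (e m)"
    by (rule continuous_attains_sup[OF _ _ continuous_on_norm[OF ce]])
      (use x0 y0 in \<open>auto intro!: compact_Times simp: RQ\<close>)
  then obtain m where m: "m \<in> R" "\<And>p. p \<in> R \<Longrightarrow> norm (e p) \<le> norm (e m)" by blast
  let ?M = "norm (e m)"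
  have K0: "K \<ge> 0" using K[OF m(1)] norm_ge_zero order_trans by blast
  \<comment> \<open>Here flatness enters: it turns \<open>w\<close> into f b_x + f a b, so that only
    the term with \<open>e = f - u\<close> is left under the integral.\<close>
  have dif: "u (x, y) * b (x, y) - (f (x0, y) * b (x0, y) + seg_integral (\<lambda>s. w (s, y)) x0 x) =
      - seg_integral (\<lambda>s. e (s, y) * bx (s, y)) x0 x" if x: "x \<in> {x1..x2}" and y: "y \<in> {y1..y2}" for x y
  proof -
    note seg = seg_in_interval[OF x0 x]
    have "w p = f p * bx p + f p * a p * b p" if "p \<in> R" for p
      using arg_cong[OF flat[OF that], of "\<lambda>z. f p * z"] by (simp add: w_def algebra_simps)
    then have "u p * bx p + f p * a p * b p - w p = - (e p * bx p)" if "p \<in> R" for p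
      using that by (simp add: e_def algebra_simps)
    then have eq: "u (s, y) * bx (s, y) + f (s, y) * a (s, y) * b (s, y) - w (s, y) = - (e (s, y) * bx (s, y))"
      if "s \<in> {x1..x2}" for s using inR[OF that y] .
    have int: "(\<lambda>\<theta>. h (x0 + \<theta> * (x - x0), y)) integrable_on {0..1}" if "continuous_on R h" for h :: "plane \<Rightarrow> 'a"
      by (intro integrable_continuous_real continuous_on_compose2[OF sec1[OF that y]])
        (use seg in \<open>auto intro!: continuous_intros\<close>)
    have c1: "continuous_on R (\<lambda>p. u p * bx p + f p * a p * b p)"
      by (intro continuous_intros cu cf cont)
    have "seg_integral (\<lambda>s. u (s, y) * bx (s, y) + f (s, y) * a (s, y) * b (s, y)) x0 x - seg_integral (\<lambda>s. w (s, y)) x0 x =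
        (x - x0) *\<^sub>R integral {0..1} (\<lambda>\<theta>. - (e (x0 + \<theta> * (x - x0), y) * bx (x0 + \<theta> * (x - x0), y)))"
      unfolding seg_integral_def scaleR_diff_right[symmetric] integral_diff[OF int[OF c1] int[OF cw], symmetric]
      by (intro arg_cong[where f = "\<lambda>z. (x - x0) *\<^sub>R z"] integral_cong eq seg) simp
    then show ?thesis using ub[OF x y] by (simp add: seg_integral_def)
  qed
  \<comment> \<open>\<open>e\<close> vanishes on the horizontal line through the base point and its
    y-derivative is at most 2 M K, where M is the maximum of its norm. As the height times K is at
    most 1/4, this forces M \<le> M / 2.\<close>
  have small_e: "norm (e (x, y)) \<le> ?M / 2" if x: "x \<in> {x1..x2}" and y: "y \<in> {y1..y2}" for x y
  proof -
    let ?e' = "\<lambda>t. f (x, t) * b (x, t) - (f (x0, t) * b (x0, t) + seg_integral (\<lambda>s. w (s, t)) x0 x)"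
    have d: "((\<lambda>t. e (x, t)) has_vector_derivative ?e' t) (at t within {y1..y2})" if "t \<in> {y1..y2}" for t
      unfolding e_def by (intro has_vector_derivative_diff fy uy x that)
    have n: "norm (?e' t) \<le> 2 * (?M * K)" if t: "t \<in> {y1..y2}" for t
    proof -
      have eb: "norm (e p * b p) \<le> ?M * K" "norm (e p * bx p) \<le> ?M * K" if "p \<in> R" for p
        using m(2)[OF that] K[OF that] by (auto intro!: order_trans[OF norm_mult_ineq] mult_mono)
      have "?e' t = e (x, t) * b (x, t) - seg_integral (\<lambda>s. e (s, t) * bx (s, t)) x0 x"
        using dif[OF x t] by (simp add: e_def algebra_simps)
      then have "norm (?e' t) \<le> norm (e (x, t) * b (x, t)) + norm (seg_integral (\<lambda>s. e (s, t) * bx (s, t)) x0 x)"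
        by (simp add: norm_triangle_ineq4)
      also have "norm (seg_integral (\<lambda>s. e (s, t) * bx (s, t)) x0 x) \<le> (x2 - x1) * (?M * K)"
        by (rule norm_seg_integral_le[OF sec1[OF _ t] x0 x]) (auto intro!: continuous_intros ce cont eb inR t)
      also have "\<dots> \<le> 1 * (?M * K)" using small(3) K0 by (intro mult_right_mono) auto
      finally show ?thesis using eb(1)[OF inR[OF x t]] by simp
    qed
    have "norm (e (x, y) - e (x, y0)) \<le> (2 * (?M * K)) * norm (y - y0)"
    proof (rule differentiable_bound[where S = "{y1..y2}"])
      fix t assume t: "t \<in> {y1..y2}"
      show "((\<lambda>t. e (x, t)) has_derivative (\<lambda>h. h *\<^sub>R ?e' t)) (at t within {y1..y2})"
        using d[OF t] by (simp add: has_vector_derivative_def)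
      show "onorm (\<lambda>h. h *\<^sub>R ?e' t) \<le> 2 * (?M * K)"
      proof (rule onorm_le)
        show "norm (h *\<^sub>R ?e' t) \<le> 2 * (?M * K) * norm h" for h :: real
          using mult_left_mono[OF n[OF t], of "\<bar>h\<bar>"] by (simp add: mult.commute)
      qed
    qed (use y y0 in auto)
    also have "\<dots> \<le> (2 * (?M * K)) * (y2 - y1)"
      using K0 y y0 by (intro mult_left_mono) auto
    also have "\<dots> \<le> ?M / 2"
      using mult_left_mono[OF small(2), of "2 * ?M"] by (simp add: algebra_simps)
    finally show ?thesis
      using f0[OF x] f00 by (simp add: e_def u_def)
  qed
  have "norm (e m) \<le> ?M / 2" using small_e[of "fst m" "snd m"] m(1) by (auto simp: RQ)
  then have "e p = 0" if "p \<in> R" for p using m(2)[OF that] by simp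
  then have fu: "f p = u p" if "p \<in> R" for p using that by (simp add: e_def)
  have fx: "((\<lambda>s. f (s, y)) has_vector_derivative f (x, y) * a (x, y)) (at x within {x1..x2})"
    if x: "x \<in> {x1..x2}" and y: "y \<in> {y1..y2}" for x y
    using ux[OF x y] by (rule has_vector_derivative_transform[OF x, rotated]) (rule fu[OF inR[OF _ y]])
  show thesis
  proof (rule that[of f])
    show "f (x0, y0) = g" by (rule f00)
    fix p assume "p \<in> {x1<..<x2} \<times> {y1<..<y2}"
    then obtain x y where p: "p = (x, y)" "x \<in> {x1<..<x2}" "y \<in> {y1<..<y2}" by auto
    then have xy: "x \<in> {x1..x2}" "y \<in> {y1..y2}" by auto
    \<comment> \<open>Total differentiability from the two partial derivatives, the one in y being
      continuous.\<close>
    have "((\<lambda>(x, y). f (x, y)) has_derivative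
        (\<lambda>(tx, ty). tx *\<^sub>R (f (x, y) * a (x, y)) + blinfun_scaleR_left (f (x, y) * b (x, y)) ty))
        (at (x, y) within {x1..x2} \<times> {y1..y2})"
    proof (rule has_derivative_partialsI)
      show "((\<lambda>x. f (x, y)) has_derivative (\<lambda>tx. tx *\<^sub>R (f (x, y) * a (x, y)))) (at x within {x1..x2})"
        using fx[OF xy] by (simp add: has_vector_derivative_def)
      show "((\<lambda>y. f (x, y)) has_derivative blinfun_apply (blinfun_scaleR_left (f (x, y) * b (x, y)))) (at y within {y1..y2})"
        if "x \<in> {x1..x2}" "y \<in> {y1..y2}" for x y
        using fy[OF that] by (simp add: has_vector_derivative_def blinfun_scaleR_left.rep_eq)
      have "continuous_on R (\<lambda>p. blinfun_scaleR_left (f p * b p))"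
        by (rule bounded_linear.continuous_on[OF bounded_linear_blinfun_scaleR_left cfb])
      then show "continuous (at (x, y) within {x1..x2} \<times> {y1..y2}) (\<lambda>(x, y). blinfun_scaleR_left (f (x, y) * b (x, y)))"
        using inR[OF xy] by (simp add: RQ continuous_on_eq_continuous_within case_prod_unfold)
    qed (use xy in auto)
    then have "(f has_derivative partials (f p * a p) (f p * b p)) (at (x, y) within {x1..x2} \<times> {y1..y2})"
      by (simp add: case_prod_unfold blinfun_scaleR_left.rep_eq p(1))
    moreover have "at (x, y) within {x1..x2} \<times> {y1..y2} = at p"
      unfolding p(1)
      by (rule at_within_open_subset[where S = "{x1<..<x2} \<times> {y1<..<y2}"])
        (use p in \<open>auto intro: open_Times\<close>)
    ultimately show "(f has_derivative partials (f p * a p) (f p * b p)) (at p)" by (simp only:)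
  qed
qed

section \<open>Uniqueness and global continuation of solutions\<close>

definition solves :: "(plane \<Rightarrow> 'a::real_normed_algebra) \<Rightarrow> (plane \<Rightarrow> 'a) \<Rightarrow> plane set \<Rightarrow> (plane \<Rightarrow> 'a) \<Rightarrow> bool"
  where "solves a b V f \<longleftrightarrow> (\<forall>p\<in>V. (f has_derivative partials (f p * a p) (f p * b p)) (at p))"

lemma solves_subset: "solves a b V f \<Longrightarrow> W \<subseteq> V \<Longrightarrow> solves a b W f"
  by (auto simp: solves_def)

lemma solves_unique:
  assumes V: "open V" "connected V" and ab: "continuous_on V a" "continuous_on V b"
    and f: "solves a b V f" "solves a b V g" and p: "p0 \<in> V" "f p0 = g p0" "p \<in> V"
  shows "f p = g p"
proof -
  have "f p - g p = 0"
  proof (rule linear_system_unique[OF V p(1) _ _ _ _ p(3), where e = "\<lambda>p. f p - g p"])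
    show "f p0 - g p0 = 0" using p(2) by simp
    show "((\<lambda>p. f p - g p) has_derivative partials ((f q - g q) * a q) ((f q - g q) * b q)) (at q)" if "q \<in> V" for q
      using has_derivative_diff[of f _ "at q" g] f that
      by (auto simp: solves_def algebra_simps dest!: bspec[where x = q])
    show "continuous_on V (\<lambda>p. norm (a p) + norm (b p))" by (intro continuous_intros ab)
    fix q h :: plane assume "q \<in> V"
    have h: "\<bar>fst h\<bar> \<le> norm h" "\<bar>snd h\<bar> \<le> norm h"
      using norm_fst_le[of "fst h" "snd h"] norm_snd_le[of "snd h" "fst h"] by simp_all
    have n: "norm (r *\<^sub>R ((f q - g q) * c)) \<le> norm c * norm (f q - g q) * norm h" if "\<bar>r\<bar> \<le> norm h" for r c
    proof -
      have "norm (r *\<^sub>R ((f q - g q) * c)) \<le> \<bar>r\<bar> * (norm (f q - g q) * norm c)"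
        using norm_mult_ineq[of "f q - g q" c] by (simp add: mult_left_mono)
      also have "\<dots> \<le> norm h * (norm (f q - g q) * norm c)"
        using that by (intro mult_right_mono) auto
      finally show ?thesis by (simp add: algebra_simps)
    qed
    have "norm (partials ((f q - g q) * a q) ((f q - g q) * b q) h) \<le>
        norm (a q) * norm (f q - g q) * norm h + norm (b q) * norm (f q - g q) * norm h"
      by (rule order_trans[OF norm_triangle_ineq add_mono[OF n[OF h(1)] n[OF h(2)]]])
    then show "norm (partials ((f q - g q) * a q) ((f q - g q) * b q) h) \<le> (norm (a q) + norm (b q)) * norm (f q - g q) * norm h"
      by (simp add: algebra_simps)
  qed
  then show ?thesis by simp
qed

text \<open>The conditions on the rectangle concern only its size and bounds of the coefficients, so
  a single neighbourhood serves all base points in it and all initial values.\<close>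

lemma flat_local_solution:
  fixes a b :: "plane \<Rightarrow> 'a::{real_normed_algebra, banach}"
  assumes D: "open D" "p \<in> D" and sm: "smooth_on D a" "smooth_on D b"
    and flat: "\<And>p. p \<in> D \<Longrightarrow> pdy a p + b p * a p = pdx b p + a p * b p"
  obtains V where "open V" "p \<in> V" "V \<subseteq> D" "\<And>q g. q \<in> V \<Longrightarrow> \<exists>f. f q = g \<and> solves a b V f"
proof -
  obtain e where e: "e > 0" "\<And>x y. \<bar>x - fst p\<bar> < e \<Longrightarrow> \<bar>y - snd p\<bar> < e \<Longrightarrow> (x, y) \<in> D"
    using open_box_around[OF D] by blast
  let ?Q = "\<lambda>d. {fst p - d..fst p + d} \<times> {snd p - d..snd p + d}"
  have Q: "?Q d \<subseteq> D" if "d < e" for d using e(2) that by fastforce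
  note cont = smooth_on_imp_continuous_on[OF sm(1)] smooth_on_imp_continuous_on[OF sm(2)]
    smooth_on_imp_continuous_on[OF smooth_on_pd(2)[OF D(1) sm(1)]]
    smooth_on_imp_continuous_on[OF smooth_on_pd(1)[OF D(1) sm(2)]]
  have "compact ((\<lambda>p. norm (a p) + norm (b p) + norm (pdx b p)) ` ?Q (e / 2))"
    by (rule compact_continuous_image)
      (use Q[of "e / 2"] e(1) in \<open>auto intro!: continuous_intros compact_Times intro: continuous_on_subset cont\<close>)
  then obtain K where K: "K > 0" "\<forall>z\<in>(\<lambda>p. norm (a p) + norm (b p) + norm (pdx b p)) ` ?Q (e / 2). norm z \<le> K"
    unfolding compact_eq_bounded_closed bounded_pos by blast
  \<comment> \<open>The three bounds keep the box inside \<open>D\<close>, make its side times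
    \<open>K\<close> at most 1/4, and its side at most 1.\<close>
  define d where "d = Min {e / 2, 1 / (8 * K), 1 / 2}"
  have d: "d > 0" "d \<le> e / 2" "d \<le> 1 / (8 * K)" "d \<le> 1 / 2" using e(1) K(1) by (auto simp: d_def)
  have QD: "?Q d \<subseteq> D" using Q[of d] d(2) e(1) by auto
  have sub: "?Q d \<subseteq> ?Q (e / 2)" using d(2) by auto
  have bound: "norm (a q) \<le> K \<and> norm (b q) \<le> K \<and> norm (pdx b q) \<le> K" if "q \<in> ?Q d" for q
  proof -
    have "norm (norm (a q) + norm (b q) + norm (pdx b q)) \<le> K" using K(2) sub that by blast
    moreover have "norm (norm (a q) + norm (b q) + norm (pdx b q)) = norm (a q) + norm (b q) + norm (pdx b q)"
      by simp
    ultimately show ?thesis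
      using norm_ge_zero[of "a q"] norm_ge_zero[of "b q"] norm_ge_zero[of "pdx b q"] by linarith
  qed
  have dK: "2 * d * K \<le> 1 / 4" using d(3) K(1) by (simp add: field_simps)
  define V where "V = {fst p - d<..<fst p + d} \<times> {snd p - d<..<snd p + d}"
  have VQ: "V \<subseteq> ?Q d" by (auto simp: V_def)
  show thesis
  proof (rule that[of V])
    show "open V" unfolding V_def by (intro open_Times open_greaterThanLessThan)
    show "p \<in> V" using d(1) by (simp add: V_def mem_Times_iff)
    show "V \<subseteq> D" using VQ QD by blast
    fix q g assume q: "q \<in> V"
    have da: "((\<lambda>t. a (x, t)) has_vector_derivative pdy a (x, y)) (at y within T)"
      "((\<lambda>t. b (t, y)) has_vector_derivative pdx b (x, y)) (at x within T)" if "(x, y) \<in> ?Q d" for x y T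
    proof -
      have m: "(x, y) \<in> D" using that QD by blast
      show "((\<lambda>t. a (x, t)) has_vector_derivative pdy a (x, y)) (at y within T)"
        using pd_eqI(4)[OF smooth_on_has_derivative[OF sm(1) m]] by (simp add: has_vector_derivative_at_within)
      show "((\<lambda>t. b (t, y)) has_vector_derivative pdx b (x, y)) (at x within T)"
        using pd_eqI(3)[OF smooth_on_has_derivative[OF sm(2) m]] by (simp add: has_vector_derivative_at_within)
    qed
    obtain f where "f (fst q, snd q) = g"
      "\<And>p'. p' \<in> V \<Longrightarrow> (f has_derivative partials (f p' * a p') (f p' * b p')) (at p')"
    proof (rule flat_box_solution[where ?x1.0 = "fst p - d" and ?x2.0 = "fst p + d" and ?y1.0 = "snd p - d"
          and ?y2.0 = "snd p + d" and a = a and b = b and ay = "pdy a" and bx = "pdx b" and K = K and g = g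
          and ?x0.0 = "fst q" and ?y0.0 = "snd q", folded V_def])
      show "fst q \<in> {fst p - d..fst p + d}" "snd q \<in> {snd p - d..snd p + d}"
        using q by (auto simp: V_def mem_Times_iff)
    qed (use dK d(4) in \<open>auto intro: continuous_on_subset[OF cont(1) QD] continuous_on_subset[OF cont(2) QD]
          continuous_on_subset[OF cont(3) QD] continuous_on_subset[OF cont(4) QD] da flat[OF subsetD[OF QD]]
          simp: bound\<close>)
    then show "\<exists>f. f q = g \<and> solves a b V f" by (auto simp: solves_def)
  qed
qed

text \<open>\<open>h\<close> is only continuous: sets are parametrized by plane coordinates, while
  the equation itself is always tested on open subsets of \<open>D\<close>.\<close>

locale local_system =
  fixes a b :: "plane \<Rightarrow> 'a::real_normed_algebra" and D :: "plane set" and h k :: "plane \<Rightarrow> plane"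
  assumes D: "open D" and h: "homeomorphism UNIV D h k"
    and cont: "continuous_on D a" "continuous_on D b"
    and local: "\<And>p. p \<in> D \<Longrightarrow> \<exists>V. open V \<and> p \<in> V \<and> V \<subseteq> D \<and> (\<forall>q g. q \<in> V \<longrightarrow> (\<exists>f. f q = g \<and> solves a b V f))"
begin

text \<open>Solutions are continued in the coordinates given by the homeomorphism \<open>h\<close>, over rectangles that are
  glued along common edges.\<close>

definition section_on :: "plane set \<Rightarrow> (plane \<Rightarrow> 'a) \<Rightarrow> bool"
  where "section_on K f \<longleftrightarrow> (\<forall>w\<in>K. \<exists>V F. open V \<and> h w \<in> V \<and> V \<subseteq> D \<and> solves a b V F \<and>
    (\<forall>w'\<in>K. h w' \<in> V \<longrightarrow> f w' = F (h w')))"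

text \<open>The value may be prescribed at any point. This freedom makes the property pass to
  unions, where the second section has to match the first at a common point.\<close>

definition extendable :: "plane set \<Rightarrow> bool"
  where "extendable K \<longleftrightarrow> (\<forall>w\<in>K. \<forall>g. \<exists>f. section_on K f \<and> f w = g)"

lemma hk: "h w \<in> D" "k (h w) = w" "q \<in> D \<Longrightarrow> h (k q) = q" "continuous_on UNIV h" "continuous_on D k"
  using homeomorphism_image1[OF h] homeomorphism_apply1[OF h UNIV_I] homeomorphism_apply2[OF h]
    homeomorphism_cont1[OF h] homeomorphism_cont2[OF h]
  by blast+

lemma open_h_vimage: "open V \<Longrightarrow> open (h -` V)"
  by (rule open_vimage[OF _ hk(4)])

lemma open_k_vimage:
  assumes "open W"
  shows "open {q \<in> D. k q \<in> W}"
  using continuous_open_preimage[OF hk(5) D assms] by (simp add: vimage_def Int_def)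

lemma section_onE:
  assumes "section_on K f" "w \<in> K"
  obtains V F where "open V" "h w \<in> V" "V \<subseteq> D" "solves a b V F" "\<forall>w'\<in>K. h w' \<in> V \<longrightarrow> f w' = F (h w')"
  using bspec[OF assms(1)[unfolded section_on_def] assms(2)] by (elim exE conjE) (rule that)

lemma section_on_subset: "section_on K f \<Longrightarrow> K' \<subseteq> K \<Longrightarrow> section_on K' f"
  unfolding section_on_def by (meson subsetD)

lemma solutions_agree_near:
  assumes "open V" "p \<in> V" "V \<subseteq> D" "open V'" "p \<in> V'" "solves a b V F" "solves a b V' F'"
  obtains B where "open B" "p \<in> B" "B \<subseteq> V" "B \<subseteq> V'"
    "\<And>q q'. q \<in> B \<Longrightarrow> q' \<in> B \<Longrightarrow> F q = F' q \<Longrightarrow> F q' = F' q'"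
proof -
  have "open (V \<inter> V')" "p \<in> V \<inter> V'" using assms by auto
  then obtain r where r: "r > 0" "ball p r \<subseteq> V \<inter> V'" by (rule openE)
  show thesis
  proof (rule that[of "ball p r"])
    fix q q' assume q: "q \<in> ball p r" "q' \<in> ball p r" "F q = F' q"
    have "ball p r \<subseteq> D" "ball p r \<subseteq> V" "ball p r \<subseteq> V'" using r(2) assms(3) by auto
    then show "F q' = F' q'"
      using solves_unique[OF open_ball connected_ball continuous_on_subset[OF cont(1)] continuous_on_subset[OF cont(2)]
          solves_subset[OF assms(6)] solves_subset[OF assms(7)] q(1,3,2)] by blast
  qed (use r in auto)
qed

lemma sections_agree_near:
  assumes f: "section_on K f" "section_on K g" and w: "w \<in> K"
  obtains N where "open N" "w \<in> N" "\<And>u v. u \<in> K \<inter> N \<Longrightarrow> v \<in> K \<inter> N \<Longrightarrow> f u = g u \<Longrightarrow> f v = g v"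
proof -
  obtain V F where V: "open V" "h w \<in> V" "V \<subseteq> D" "solves a b V F" "\<forall>w'\<in>K. h w' \<in> V \<longrightarrow> f w' = F (h w')"
    by (rule section_onE[OF f(1) w])
  obtain V' F' where V': "open V'" "h w \<in> V'" "V' \<subseteq> D" "solves a b V' F'" "\<forall>w'\<in>K. h w' \<in> V' \<longrightarrow> g w' = F' (h w')"
    by (rule section_onE[OF f(2) w])
  obtain B where B: "open B" "h w \<in> B" "B \<subseteq> V" "B \<subseteq> V'"
    "\<And>q q'. q \<in> B \<Longrightarrow> q' \<in> B \<Longrightarrow> F q = F' q \<Longrightarrow> F q' = F' q'"
    using solutions_agree_near[OF V(1,2,3) V'(1,2) V(4) V'(4)] by metis
  show thesis
  proof (rule that[of "h -` B"])
    fix u v assume uv: "u \<in> K \<inter> h -` B" "v \<in> K \<inter> h -` B" "f u = g u"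
    have e: "f x = F (h x)" "g x = F' (h x)" if "x \<in> K \<inter> h -` B" for x
    proof -
      have "x \<in> K" "h x \<in> V" "h x \<in> V'" using that B(3,4) by blast+
      then show "f x = F (h x)" "g x = F' (h x)" using V(5) V'(5) by simp_all
    qed
    have "F (h u) = F' (h u)" using uv(3) e[OF uv(1)] by simp
    then have "F (h v) = F' (h v)" using B(5)[of "h u" "h v"] uv(1,2) by simp
    then show "f v = g v" using e[OF uv(2)] by simp
  qed (use B open_h_vimage in auto)
qed

lemma sections_unique:
  assumes f: "section_on K f" "section_on K g" and K: "connected K" and w: "w \<in> K" "f w = g w" "v \<in> K"
  shows "f v = g v"
proof -
  \<comment> \<open>The parameter \<open>P\<close> covers the set of agreement and its complement
    (\<open>P = Not\<close>) at once: near any point two sections agree everywhere or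
    nowhere.\<close>
  have op: "openin (top_of_set K) {u \<in> K. P (f u = g u)}" for P
    unfolding openin_subopen[of _ "{u \<in> K. P (f u = g u)}"]
  proof (intro ballI)
    fix u assume u: "u \<in> {u \<in> K. P (f u = g u)}"
    then have uK: "u \<in> K" by blast
    obtain N where N: "open N" "u \<in> N" "\<And>x y. x \<in> K \<inter> N \<Longrightarrow> y \<in> K \<inter> N \<Longrightarrow> f x = g x \<Longrightarrow> f y = g y"
      using sections_agree_near[OF f uK] by metis
    have "v \<in> {u \<in> K. P (f u = g u)}" if v: "v \<in> K \<inter> N" for v
    proof -
      have "f v = g v \<longleftrightarrow> f u = g u" using N(2) uK v N(3)[of u v] N(3)[of v u] by blast
      then show ?thesis using u v by simp
    qed
    then show "\<exists>T. openin (top_of_set K) T \<and> u \<in> T \<and> T \<subseteq> {u \<in> K. P (f u = g u)}"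
      using N(1,2) uK by (intro exI[of _ "K \<inter> N"]) (blast intro: openin_open_Int)
  qed
  have "closedin (top_of_set K) (K - {u \<in> K. f u \<noteq> g u})"
    using op[of Not] by (intro closedin_diff) auto
  moreover have "K - {u \<in> K. f u \<noteq> g u} = {u \<in> K. f u = g u}" by blast
  ultimately have "closedin (top_of_set K) {u \<in> K. f u = g u}" by simp
  then have "{u \<in> K. f u = g u} = K"
    using K op[of "\<lambda>x. x"] w unfolding connected_clopen by blast
  then show ?thesis using w(3) by blast
qed

text \<open>At a point of only one of the sets, the neighbourhood is shrunk so as to avoid the
  other, closed set. At a common point the two local solutions have the same value and hence agree
  on a ball, where either of them represents the glued section.\<close>

lemma section_glue:
  assumes cl: "closed K1" "closed K2" and f: "section_on K1 f1" "section_on K2 f2"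
    and eq: "\<And>w. w \<in> K1 \<inter> K2 \<Longrightarrow> f1 w = f2 w"
  shows "section_on (K1 \<union> K2) (\<lambda>w. if w \<in> K1 then f1 w else f2 w)"
proof -
  let ?f = "\<lambda>w. if w \<in> K1 then f1 w else f2 w"
  have one: "\<exists>V F. open V \<and> h w \<in> V \<and> V \<subseteq> D \<and> solves a b V F \<and> (\<forall>w'\<in>K1 \<union> K2. h w' \<in> V \<longrightarrow> ?f w' = F (h w'))"
    if w: "w \<in> K" "w \<notin> K'" and K: "K1 \<union> K2 = K \<union> K'" "closed K'" "section_on K g" "\<And>w. w \<in> K \<Longrightarrow> ?f w = g w"
    for w K K' g
  proof -
    obtain V F where V: "open V" "h w \<in> V" "V \<subseteq> D" "solves a b V F" "\<forall>w'\<in>K. h w' \<in> V \<longrightarrow> g w' = F (h w')"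
      by (rule section_onE[OF K(3) w(1)])
    let ?W = "V \<inter> {q \<in> D. k q \<in> - K'}"
    have 1: "open ?W" using V(1) K(2) by (intro open_Int open_k_vimage) auto
    have 2: "h w \<in> ?W" using V(2) w(2) by (simp add: hk(1,2))
    have 3: "?f w' = F (h w')" if "w' \<in> K1 \<union> K2" "h w' \<in> ?W" for w'
    proof -
      have "w' \<in> K" using that K(1) by (auto simp: hk(2))
      then show ?thesis using that V(5) K(4)[of w'] by auto
    qed
    show ?thesis
      using 1 2 3 V(3) solves_subset[OF V(4), of ?W] by (intro exI[of _ ?W] exI[of _ F]) blast
  qed
  show ?thesis
    unfolding section_on_def
  proof
    fix w assume "w \<in> K1 \<union> K2"
    then consider "w \<in> K1" "w \<notin> K2" | "w \<in> K2" "w \<notin> K1" | "w \<in> K1 \<inter> K2" by blast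
    then show "\<exists>V F. open V \<and> h w \<in> V \<and> V \<subseteq> D \<and> solves a b V F \<and> (\<forall>w'\<in>K1 \<union> K2. h w' \<in> V \<longrightarrow> ?f w' = F (h w'))"
    proof cases
      case 1
      show ?thesis by (rule one[OF 1 refl cl(2) f(1)]) simp
    next
      case 2
      show ?thesis by (rule one[OF 2 Un_commute cl(1) f(2)]) (simp add: eq)
    next
      case 3
      obtain V F where V: "open V" "h w \<in> V" "V \<subseteq> D" "solves a b V F" "\<forall>w'\<in>K1. h w' \<in> V \<longrightarrow> f1 w' = F (h w')"
        by (rule section_onE[OF f(1) IntD1[OF 3]])
      obtain V' F' where V': "open V'" "h w \<in> V'" "V' \<subseteq> D" "solves a b V' F'" "\<forall>w'\<in>K2. h w' \<in> V' \<longrightarrow> f2 w' = F' (h w')"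
        by (rule section_onE[OF f(2) IntD2[OF 3]])
      obtain B where B: "open B" "h w \<in> B" "B \<subseteq> V" "B \<subseteq> V'"
        "\<And>q q'. q \<in> B \<Longrightarrow> q' \<in> B \<Longrightarrow> F q = F' q \<Longrightarrow> F q' = F' q'"
        using solutions_agree_near[OF V(1,2,3) V'(1,2) V(4) V'(4)] by metis
      have "F (h w) = F' (h w)" using V(2,5) V'(2,5) eq[OF 3] 3 by auto
      then have FF: "F q = F' q" if "q \<in> B" for q using B(5)[OF B(2) that] by blast
      have "?f w' = F (h w')" if "w' \<in> K1 \<union> K2" "h w' \<in> B" for w'
      proof (cases "w' \<in> K1")
        case True
        then show ?thesis using that(2) V(5) B(3) by auto
      next
        case False
        have "h w' \<in> V'" using that(2) B(4) by blast
        then have "f2 w' = F' (h w')" using False that(1) V'(5) by blast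
        then show ?thesis using False FF[OF that(2)] by simp
      qed
      then show ?thesis
        using B(1-3) V(3) solves_subset[OF V(4) B(3)] by (intro exI[of _ B] exI[of _ F]) auto
    qed
  qed
qed

text \<open>A section over one set is continued over the other from its value at \<open>c\<close>;
  since the intersection is connected, uniqueness makes the two sections agree on all of it.\<close>

lemma extendable_Un:
  assumes cl: "closed K1" "closed K2" and con: "connected (K1 \<inter> K2)" "c \<in> K1 \<inter> K2"
    and ext: "extendable K1" "extendable K2"
  shows "extendable (K1 \<union> K2)"
proof -
  have main: "\<exists>f. section_on (A \<union> B) f \<and> f w = g"
    if AB: "closed A" "closed B" "connected (A \<inter> B)" "c \<in> A \<inter> B" "extendable A" "extendable B" and w: "w \<in> A"
    for A B w g
  proof -
    obtain f1 where f1: "section_on A f1" "f1 w = g" using AB(5) w unfolding extendable_def by blast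
    obtain f2 where f2: "section_on B f2" "f2 c = f1 c" using AB(4,6) unfolding extendable_def by blast
    have "f1 v = f2 v" if "v \<in> A \<inter> B" for v
      using sections_unique[OF section_on_subset[OF f1(1)] section_on_subset[OF f2(1)] AB(3,4) _ that] f2(2) by auto
    then have "section_on (A \<union> B) (\<lambda>w. if w \<in> A then f1 w else f2 w)"
      by (rule section_glue[OF AB(1,2) f1(1) f2(1)])
    then show ?thesis using f1(2) w by (intro exI[of _ "\<lambda>w. if w \<in> A then f1 w else f2 w"]) simp
  qed
  show ?thesis
    unfolding extendable_def
  proof (intro ballI allI)
    fix w g assume "w \<in> K1 \<union> K2"
    then show "\<exists>f. section_on (K1 \<union> K2) f \<and> f w = g"
      using main[of K1 K2 w g] main[of K2 K1 w g] assms by (auto simp: Int_commute Un_commute)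
  qed
qed

lemma extendable_small: "\<exists>\<delta>>0. \<forall>K. K \<subseteq> ball w \<delta> \<longrightarrow> extendable K"
proof -
  obtain V where V: "open V" "h w \<in> V" "V \<subseteq> D" "\<And>q g. q \<in> V \<Longrightarrow> \<exists>f. f q = g \<and> solves a b V f"
    using local[OF hk(1)[of w]] by blast
  have "open (h -` V)" "w \<in> h -` V" using V open_h_vimage by auto
  then obtain \<delta> where \<delta>: "\<delta> > 0" "ball w \<delta> \<subseteq> h -` V" by (rule openE)
  have "extendable K" if K: "K \<subseteq> ball w \<delta>" for K
    unfolding extendable_def
  proof (intro ballI allI)
    fix w0 g assume w0: "w0 \<in> K"
    then have "h w0 \<in> V" using K \<delta>(2) by auto
    then obtain F where F: "F (h w0) = g" "solves a b V F" using V(4) by blast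
    have "section_on K (F \<circ> h)"
      unfolding section_on_def using V(1,3) F(2) K \<delta>(2) by (intro ballI exI[of _ V] exI[of _ F]) auto
    then show "\<exists>f. section_on K f \<and> f w0 = g" using F(1) by (intro exI[of _ "F \<circ> h"]) simp
  qed
  then show ?thesis using \<delta>(1) by blast
qed

text \<open>Two nested bisection arguments: small boxes are stacked to a narrow strip of full height
  around each abscissa, and the strips are then joined. Neighbours meet in a segment, which is
  connected.\<close>

lemma extendable_box:
  assumes "x1 \<le> x2" "y1 \<le> y2"
  shows "extendable ({x1..x2} \<times> {y1..y2})"
proof -
  have strip: "\<exists>e>0. \<forall>s t. s \<le> x \<and> x \<le> t \<and> t - s < e \<longrightarrow> extendable ({s..t} \<times> {y1..y2})" for x
    using assms(2)
  proof (induction y1 y2 rule: Bolzano)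
    case (trans c d e)
    then obtain r1 r2 where r: "r1 > 0" "r2 > 0"
      "\<And>s t. s \<le> x \<Longrightarrow> x \<le> t \<Longrightarrow> t - s < r1 \<Longrightarrow> extendable ({s..t} \<times> {c..d})"
      "\<And>s t. s \<le> x \<Longrightarrow> x \<le> t \<Longrightarrow> t - s < r2 \<Longrightarrow> extendable ({s..t} \<times> {d..e})"
      by blast
    have "extendable ({s..t} \<times> {c..e})" if st: "s \<le> x" "x \<le> t" "t - s < min r1 r2" for s t
    proof -
      have i: "({s..t} \<times> {c..d}) \<inter> ({s..t} \<times> {d..e}) = {s..t} \<times> {d}" using trans(3,4) by auto
      have u: "({s..t} \<times> {c..d}) \<union> ({s..t} \<times> {d..e}) = {s..t} \<times> {c..e}" using trans(3,4) by auto
      have "extendable (({s..t} \<times> {c..d}) \<union> ({s..t} \<times> {d..e}))"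
        by (rule extendable_Un[where c = "(x, d)"])
          (use st trans(3,4) in \<open>auto intro!: closed_Times r connected_Times simp: i\<close>)
      then show ?thesis by (simp add: u)
    qed
    then show ?case using r(1,2) by (intro exI[of _ "min r1 r2"]) auto
  next
    case (local y)
    obtain \<delta> where \<delta>: "\<delta> > 0" "\<And>K. K \<subseteq> ball (x, y) \<delta> \<Longrightarrow> extendable K" using extendable_small by blast
    have "extendable ({s..t} \<times> {c..d})"
      if "s \<le> x" "x \<le> t" "t - s < \<delta> / 2" "c \<le> y" "y \<le> d" "d - c < \<delta> / 2" for s t c d
    proof (rule \<delta>(2), safe)
      fix u v assume uv: "u \<in> {s..t}" "v \<in> {c..d}"
      have "dist (x, y) (u, v) \<le> \<bar>x - u\<bar> + \<bar>y - v\<bar>"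
        using norm_Pair_le[of "x - u" "y - v"] by (simp add: dist_norm)
      also have "\<dots> < \<delta>" using uv that by (auto simp: abs_if)
      finally show "(u, v) \<in> ball (x, y) \<delta>" by simp
    qed
    then show ?case using \<delta>(1) by (intro exI[of _ "\<delta> / 2"]) (meson half_gt_zero)
  qed
  show ?thesis
    using assms(1)
  proof (induction x1 x2 rule: Bolzano)
    case (trans s x t)
    have i: "({s..x} \<times> {y1..y2}) \<inter> ({x..t} \<times> {y1..y2}) = {x} \<times> {y1..y2}" using trans(3,4) by auto
    have u: "({s..x} \<times> {y1..y2}) \<union> ({x..t} \<times> {y1..y2}) = {s..t} \<times> {y1..y2}" using trans(3,4) by auto
    have "extendable (({s..x} \<times> {y1..y2}) \<union> ({x..t} \<times> {y1..y2}))"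
      by (rule extendable_Un[where c = "(x, y1)"])
        (use trans assms(2) in \<open>auto intro!: closed_Times connected_Times simp: i\<close>)
    then show ?case by (simp add: u)
  next
    case (local x)
    then show ?case using strip by blast
  qed
qed

lemma global_solution:
  assumes p0: "p0 \<in> D"
  shows "\<exists>f. f p0 = g \<and> solves a b D f"
proof -
  define w0 where "w0 = k p0"
  define K where "K n = {fst w0 - real n..fst w0 + real n} \<times> {snd w0 - real n..snd w0 + real n}" for n
  \<comment> \<open>The open boxes provide points around which the section over \<open>K n\<close>
    determines the solution on a full neighbourhood, as the derivative demands.\<close>
  define I where "I n = {fst w0 - real n<..<fst w0 + real n} \<times> {snd w0 - real n<..<snd w0 + real n}" for n
  have I: "open (I n)" "I n \<subseteq> K n" for n
    unfolding I_def K_def by (auto intro: open_Times)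
  have w0K: "w0 \<in> K n" for n by (simp add: K_def mem_Times_iff)
  have "\<exists>f. section_on (K n) f \<and> f w0 = g" for n
    using extendable_box[of "fst w0 - real n" "fst w0 + real n" "snd w0 - real n" "snd w0 + real n"] w0K[of n]
    unfolding extendable_def K_def by auto
  then obtain F where F: "\<And>n. section_on (K n) (F n)" "\<And>n. F n w0 = g" by metis
  have mono: "K m \<subseteq> K n" if "m \<le> n" for m n using that by (auto simp: K_def)
  have con: "connected (K n)" for n
    unfolding K_def by (intro convex_connected convex_Times) auto
  have agree: "F m w = F n w" if "w \<in> K m" "w \<in> K n" for m n w
  proof -
    have "F m w = F n w" if "m \<le> n" "w \<in> K m" for m n
      using sections_unique[OF F(1) section_on_subset[OF F(1) mono[OF that(1)]] con w0K _ that(2)] F(2) by simp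
    then show ?thesis using that nat_le_linear[of m n] by metis
  qed
  have ex: "\<exists>n. w \<in> I n" for w
  proof -
    obtain n where "real n > \<bar>fst w - fst w0\<bar> + \<bar>snd w - snd w0\<bar>" using reals_Archimedean2 by blast
    then show ?thesis by (intro exI[of _ n]) (auto simp: I_def mem_Times_iff abs_if split: if_splits)
  qed
  define f where "f w = F (SOME n. w \<in> K n) w" for w
  have f: "f w = F n w" if "w \<in> K n" for n w
    unfolding f_def by (rule agree[OF someI[of "\<lambda>n. w \<in> K n", OF that] that])
  have "((f \<circ> k) has_derivative partials ((f \<circ> k) p * a p) ((f \<circ> k) p * b p)) (at p)" if p: "p \<in> D" for p
  proof -
    obtain n where n: "k p \<in> I n" using ex by blast
    then have kK: "k p \<in> K n" using I(2) by blast
    obtain V G where V: "open V" "h (k p) \<in> V" "V \<subseteq> D" "solves a b V G" "\<forall>w'\<in>K n. h w' \<in> V \<longrightarrow> F n w' = G (h w')"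
      by (rule section_onE[OF F(1) kK])
    let ?W = "V \<inter> {q \<in> D. k q \<in> I n}"
    have W: "open ?W" by (intro open_Int V open_k_vimage I)
    have pW: "p \<in> ?W" using V(2) n p by (simp add: hk(3))
    have eq: "G q = (f \<circ> k) q" if "q \<in> ?W" for q
    proof -
      have "k q \<in> K n" using that I(2) by blast
      then show ?thesis using V(5) f[of "k q" n] that by (auto simp: hk(3))
    qed
    have "(G has_derivative partials (G p * a p) (G p * b p)) (at p)"
      using V(4) pW by (simp add: solves_def)
    then show ?thesis
      unfolding eq[OF pW] by (rule has_derivative_transform_within_open[OF _ W pW eq])
  qed
  moreover have "(f \<circ> k) p0 = g" using f[OF w0K[of 0]] F(2) by (simp add: w0_def)
  ultimately show ?thesis unfolding solves_def by blast
qed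

end

text \<open>Under the identification of the plane with the complex numbers, the Riemann mapping
  theorem yields the disc, which is homeomorphic to the whole plane.\<close>

lemma simply_connected_homeomorphic_plane:
  fixes D :: "plane set"
  assumes "open D" "simply_connected D" "D \<noteq> {}"
  obtains h k where "homeomorphism UNIV D h (k :: plane \<Rightarrow> plane)"
proof -
  let ?c = "\<lambda>p :: plane. Complex (fst p) (snd p)" and ?r = "\<lambda>z. (Re z, Im z)"
  have cc: "continuous_on S ?c" for S
    unfolding complex_eq by (intro continuous_intros)
  have cr: "continuous_on S ?r" for S by (intro continuous_intros)
  have cD: "homeomorphism D (?c ` D) ?c ?r"
    by (rule homeomorphismI) (auto intro: cc cr)
  have "?c ` D = ?r -` D" by (force simp: image_iff complex_eq_iff)
  then have oc: "open (?c ` D)" using assms(1) open_vimage[OF _ cr] by simp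
  have "simply_connected (?c ` D)"
    using homeomorphic_simply_connected_eq assms(2) cD unfolding homeomorphic_def by blast
  then have cb: "?c ` D homeomorphic ball (0::complex) 1"
    using simply_connected_eq_homeomorphic_to_disc[OF oc] assms(3) by blast
  have bU: "ball (0::complex) 1 homeomorphic (UNIV :: complex set)"
    by (rule homeomorphic_ball_UNIV) simp
  have UU: "(UNIV :: complex set) homeomorphic (UNIV :: plane set)"
    unfolding homeomorphic_def
    by (intro exI[of _ ?r] exI[of _ ?c] homeomorphismI) (auto intro: cc cr)
  have Dc: "D homeomorphic ?c ` D" using cD unfolding homeomorphic_def by blast
  have "D homeomorphic (UNIV :: plane set)"
    by (rule homeomorphic_trans[OF Dc homeomorphic_trans[OF cb homeomorphic_trans[OF bU UU]]])
  then have "(UNIV :: plane set) homeomorphic D" by (subst homeomorphic_sym)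
  then show thesis using that unfolding homeomorphic_def by blast
qed

lemma flat_solution:
  fixes a b :: "plane \<Rightarrow> 'a::{real_normed_algebra, banach}"
  assumes D: "open D" "simply_connected D" and p0: "p0 \<in> D" and sm: "smooth_on D a" "smooth_on D b"
    and flat: "\<And>p. p \<in> D \<Longrightarrow> pdy a p + b p * a p = pdx b p + a p * b p"
  obtains f where "f p0 = g" "solves a b D f" "smooth_on D f"
proof -
  obtain h k where hk: "homeomorphism UNIV D h (k :: plane \<Rightarrow> plane)"
    using simply_connected_homeomorphic_plane[OF D] p0 by blast
  interpret local_system a b D h k
  proof
    fix p assume "p \<in> D"
    then show "\<exists>V. open V \<and> p \<in> V \<and> V \<subseteq> D \<and> (\<forall>q g. q \<in> V \<longrightarrow> (\<exists>f. f q = g \<and> solves a b V f))"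
      using flat_local_solution[OF D(1) _ sm flat, of p] by metis
  qed (use D hk sm smooth_on_imp_continuous_on in blast)+
  obtain f where f: "f p0 = g" "solves a b D f" using global_solution[OF p0] by blast
  have "smooth_on D f"
    by (rule smooth_on_bootstrap[where fx = "\<lambda>p. f p * a p" and fy = "\<lambda>p. f p * b p"])
      (use f(2) sm in \<open>auto simp: solves_def smooth_on_def intro: Ck_on_mult\<close>)
  then show thesis using f that by blast
qed

section \<open>Lifting to the group\<close>

text \<open>\<open>f\<close> is written as its restriction to a vertical line plus the integral of
  its x-derivative; differentiating under the integral in y and then in x gives the symmetry for
  values in a Banach space.\<close>

lemma mixed_partials:
  fixes f :: "plane \<Rightarrow> 'b::banach"
  assumes D: "open D" "p \<in> D" and sm: "smooth_on D f"
  shows "pdx (pdy f) p = pdy (pdx f) p"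
proof -
  obtain e where e: "e > 0" "\<And>x y. \<bar>x - fst p\<bar> < e \<Longrightarrow> \<bar>y - snd p\<bar> < e \<Longrightarrow> (x, y) \<in> D"
    using open_box_around[OF D] by blast
  define d where "d = e / 2"
  define X Y where "X = {fst p - d..fst p + d}" and "Y = {snd p - d..snd p + d}"
  have d: "d > 0" using e(1) by (simp add: d_def)
  have px: "fst p \<in> X" and py: "snd p \<in> Y" using d by (auto simp: X_def Y_def)
  have sub: "(x, y) \<in> D" if "x \<in> X" "y \<in> Y" for x y
    using that e by (auto simp: X_def Y_def d_def intro!: e(2))
  note smx = smooth_on_pd(1)[OF D(1) sm] and smy = smooth_on_pd(2)[OF D(1) sm]
  note dx = pd_eqI(3)[OF smooth_on_has_derivative] and dy = pd_eqI(4)[OF smooth_on_has_derivative]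
  have cont: "continuous_on D (pdx f)" "continuous_on D (pdy (pdx f))"
    by (rule smooth_on_imp_continuous_on[OF smx])
      (rule smooth_on_imp_continuous_on[OF smooth_on_pd(2)[OF D(1) smx]])
  let ?s = "\<lambda>x \<theta>. fst p + \<theta> * (x - fst p)"
  have seg: "?s x \<theta> \<in> X" if "x \<in> X" "\<theta> \<in> {0..1}" for x \<theta>
    using seg_in_interval[OF px[unfolded X_def]] that unfolding X_def by blast
  have f: "f (x, y) = f (fst p, y) + seg_integral (\<lambda>s. pdx f (s, y)) (fst p) x" if "x \<in> X" "y \<in> Y" for x y
  proof -
    have "seg_integral (\<lambda>s. pdx f (s, y)) (fst p) x = f (x, y) - f (fst p, y)"
      by (rule seg_integral_eq_diff[OF _ px[unfolded X_def] that(1)[unfolded X_def], where H = "\<lambda>s. f (s, y)"])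
        (use dx[OF sm sub[OF _ that(2)]] in \<open>auto simp: X_def intro: has_vector_derivative_at_within\<close>)
    then show ?thesis by simp
  qed
  have fy: "pdy f (x, snd p) = pdy f p + seg_integral (\<lambda>s. pdy (pdx f) (s, snd p)) (fst p) x" if x: "x \<in> X" for x
  proof -
    have "((\<lambda>t. integral (cbox 0 1) (\<lambda>\<theta>. pdx f (?s x \<theta>, t))) has_vector_derivative
        integral (cbox 0 1) (\<lambda>\<theta>. pdy (pdx f) (?s x \<theta>, snd p))) (at (snd p) within Y)"
    proof (rule leibniz_rule_vector_derivative[where fx = "\<lambda>t \<theta>. pdy (pdx f) (?s x \<theta>, t)"])
      fix t \<theta> :: real assume t: "t \<in> Y" "\<theta> \<in> cbox 0 1"
      then have "(?s x \<theta>, t) \<in> D" using seg[OF x] by (intro sub) auto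
      from dy[OF smx this]
      show "((\<lambda>t. pdx f (?s x \<theta>, t)) has_vector_derivative pdy (pdx f) (?s x \<theta>, t)) (at t within Y)"
        by (simp add: has_vector_derivative_at_within)
    next
      fix t assume t: "t \<in> Y"
      show "(\<lambda>\<theta>. pdx f (?s x \<theta>, t)) integrable_on cbox 0 1"
        by (rule integrable_continuous, rule continuous_on_compose2[OF cont(1)])
          (use seg[OF x] t in \<open>auto intro!: continuous_intros sub\<close>)
    next
      show "continuous_on (Y \<times> cbox 0 1) (\<lambda>(t, \<theta>). pdy (pdx f) (?s x \<theta>, t))"
        unfolding case_prod_unfold
        by (rule continuous_on_compose2[OF cont(2)]) (use seg[OF x] in \<open>auto intro!: continuous_intros sub\<close>)
    qed (use py in \<open>auto simp: Y_def\<close>)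
    then have I: "((\<lambda>t. seg_integral (\<lambda>s. pdx f (s, t)) (fst p) x) has_vector_derivative
        seg_integral (\<lambda>s. pdy (pdx f) (s, snd p)) (fst p) x) (at (snd p) within Y)"
      unfolding seg_integral_def cbox_interval
      by (rule bounded_linear.has_vector_derivative[OF bounded_linear_scaleR_right])
    have "((\<lambda>t. f (fst p, t)) has_vector_derivative pdy f p) (at (snd p) within Y)"
      using dy[OF sm D(2)] by (simp add: has_vector_derivative_at_within)
    from has_vector_derivative_add[OF this I]
    have "((\<lambda>t. f (x, t)) has_vector_derivative
        pdy f p + seg_integral (\<lambda>s. pdy (pdx f) (s, snd p)) (fst p) x) (at (snd p) within Y)"
      by (rule has_vector_derivative_transform[OF py, rotated]) (rule f[OF x])
    moreover have "((\<lambda>t. f (x, t)) has_vector_derivative pdy f (x, snd p)) (at (snd p) within Y)"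
      using dy[OF sm sub[OF x py]] by (simp add: has_vector_derivative_at_within)
    moreover have "at (snd p) within Y = at (snd p)"
      using d by (intro at_within_interior) (simp add: Y_def interior_atLeastAtMost_real)
    ultimately show ?thesis by (metis vector_derivative_unique_at)
  qed
  have c: "continuous_on X (\<lambda>s. pdy (pdx f) (s, snd p))"
    by (rule continuous_on_compose2[OF cont(2)]) (auto intro!: continuous_intros sub py)
  have "((\<lambda>x. pdy f p + seg_integral (\<lambda>s. pdy (pdx f) (s, snd p)) (fst p) x) has_vector_derivative
      0 + pdy (pdx f) (fst p, snd p)) (at (fst p) within X)"
    unfolding X_def
    by (rule has_vector_derivative_add[OF has_vector_derivative_const
          seg_integral_derivative[OF c[unfolded X_def] px[unfolded X_def] px[unfolded X_def]]])
  then have "((\<lambda>x. pdy f (x, snd p)) has_vector_derivative 0 + pdy (pdx f) (fst p, snd p)) (at (fst p) within X)"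
    by (rule has_vector_derivative_transform[OF px, rotated]) (rule fy)
  moreover have "((\<lambda>x. pdy f (x, snd p)) has_vector_derivative pdx (pdy f) p) (at (fst p) within X)"
    using dx[OF smy D(2)] by (simp add: has_vector_derivative_at_within)
  moreover have "at (fst p) within X = at (fst p)"
    using d by (intro at_within_interior) (simp add: X_def interior_atLeastAtMost_real)
  ultimately show ?thesis using vector_derivative_unique_at by fastforce
qed

lemma smooth_on_inverse:
  fixes g :: "plane \<Rightarrow> 'b::real_normed_field"
  assumes U: "open U" and g: "smooth_on U g" "\<And>p. p \<in> U \<Longrightarrow> g p \<noteq> 0"
  shows "smooth_on U (\<lambda>p. inverse (g p))"
proof (rule smooth_on_bootstrap)
  show "((\<lambda>p. inverse (g p)) has_derivative partials (- (inverse (g p) * pdx g p * inverse (g p)))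
      (- (inverse (g p) * pdy g p * inverse (g p)))) (at p)" if "p \<in> U" for p
    using Deriv.has_derivative_inverse[OF g(2)[OF that] smooth_on_has_derivative[OF g(1) that]]
    by (simp add: algebra_simps)
  note pd = smooth_on_pd[OF U g(1)]
  show "Ck_on n U (\<lambda>p. - (inverse (g p) * pdx g p * inverse (g p))) \<and>
      Ck_on n U (\<lambda>p. - (inverse (g p) * pdy g p * inverse (g p)))" if "Ck_on n U (\<lambda>p. inverse (g p))" for n
    using pd that unfolding smooth_on_def
    by (intro conjI Ck_on_linear[OF bounded_linear_minus[OF bounded_linear_ident]] Ck_on_mult) auto
qed

text \<open>Near \<open>p\<close> the root is \<open>s p * csqrt (z q / z p)\<close>: the argument
  is close to 1, away from the cut, and continuity of \<open>s\<close> gives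
  \<open>s q / s p\<close> positive real part, which selects the principal branch.\<close>

lemma smooth_on_square_root:
  fixes s z :: "plane \<Rightarrow> complex"
  assumes U: "open U" and s: "continuous_on U s" "\<And>p. p \<in> U \<Longrightarrow> (s p)\<^sup>2 = z p"
    and z: "smooth_on U z" "\<And>p. p \<in> U \<Longrightarrow> z p \<noteq> 0"
  shows "smooth_on U s"
proof (rule smooth_on_bootstrap)
  fix p assume p: "p \<in> U"
  have s0: "s p \<noteq> 0" using s(2)[OF p] z(2)[OF p] by auto
  have "isCont s p" using s(1) U p by (simp add: continuous_on_eq_continuous_at)
  then have "(s \<longlongrightarrow> s p) (nhds p)" by (simp add: isCont_def tendsto_at_iff_tendsto_nhds)
  then have "((\<lambda>q. s q / s p) \<longlongrightarrow> s p / s p) (nhds p)" by (intro tendsto_intros s0)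
  then have "((\<lambda>q. Re (s q / s p)) \<longlongrightarrow> 1) (nhds p)" using s0 by (auto dest: tendsto_Re)
  then have "\<forall>\<^sub>F q in nhds p. Re (s q / s p) > 0" by (rule order_tendstoD(1)) simp
  moreover have "\<forall>\<^sub>F q in nhds p. q \<in> U" using U p by (rule eventually_nhds_in_open)
  ultimately have ev: "\<forall>\<^sub>F q in nhds p. s p * csqrt (z q / z p) = s q"
  proof eventually_elim
    case (elim q)
    have "z q / z p = (s q / s p)\<^sup>2" using s(2) elim p by (simp add: power_divide)
    then have "csqrt (z q / z p) = s q / s p" using elim by (simp add: csqrt_square)
    then show ?case using s0 by simp
  qed
  have 1: "(csqrt has_derivative (*) (inverse (2 * csqrt 1))) (at (z p / z p))"
    unfolding divide_self[OF z(2)[OF p]]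
    by (rule has_field_derivative_csqrt[unfolded has_field_derivative_def]) simp
  have "((\<lambda>q. z q / z p) has_derivative (\<lambda>h. partials (pdx z p) (pdy z p) h / z p)) (at p)"
    using bounded_linear.has_derivative[OF bounded_linear_divide smooth_on_has_derivative[OF z(1) p]] .
  from bounded_linear.has_derivative[OF bounded_linear_mult_right has_derivative_compose[OF this 1], of "s p"]
  have "((\<lambda>q. s p * csqrt (z q / z p)) has_derivative
      (\<lambda>h. s p * (inverse (2 * csqrt 1) * (partials (pdx z p) (pdy z p) h / z p)))) (at p)" .
  then have "(s has_derivative
      (\<lambda>h. s p * (inverse (2 * csqrt 1) * (partials (pdx z p) (pdy z p) h / z p)))) (at p)"
    by (rule has_derivative_transform_eventually)
      (use ev z(2)[OF p] in \<open>auto simp: eventually_nhds_conv_at\<close>)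
  then show "(s has_derivative partials (s p * (pdx z p * inverse (z p)) /\<^sub>R 2) (s p * (pdy z p * inverse (z p)) /\<^sub>R 2)) (at p)"
  proof (rule has_derivative_eq_rhs)
    show "(\<lambda>h. s p * (inverse (2 * csqrt 1) * (partials (pdx z p) (pdy z p) h / z p))) =
        partials (s p * (pdx z p * inverse (z p)) /\<^sub>R 2) (s p * (pdy z p * inverse (z p)) /\<^sub>R 2)"
      using z(2)[OF p] by (intro ext) (simp add: scaleR_conv_of_real field_simps)
  qed
next
  note pd = smooth_on_pd[OF U z(1)] and iz = smooth_on_inverse[OF U z]
  show "Ck_on n U (\<lambda>p. s p * (pdx z p * inverse (z p)) /\<^sub>R 2) \<and> Ck_on n U (\<lambda>p. s p * (pdy z p * inverse (z p)) /\<^sub>R 2)"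
    if "Ck_on n U s" for n
    using pd iz that unfolding smooth_on_def
    by (intro conjI Ck_on_linear[OF bounded_linear_scaleR_right] Ck_on_mult) auto
qed

section \<open>Matrix entries and the eigenline construction\<close>

definition matunit :: "2 \<Rightarrow> 2 \<Rightarrow> mat2" where "matunit i j = (\<chi> k l. if k = i \<and> l = j then 1 else 0)"

lemma mat2_decomp: "X = X $ 1 $ 1 *\<^sub>R matunit 1 1 + X $ 1 $ 2 *\<^sub>R matunit 1 2 +
    X $ 2 $ 1 *\<^sub>R matunit 2 1 + X $ 2 $ 2 *\<^sub>R matunit 2 2"
  by (simp add: mat2_eq_iff matunit_def)

lemma bounded_linear_entry: "bounded_linear (\<lambda>X :: mat2. X $ i $ j)"
  by (intro bounded_linear_compose[OF bounded_linear_vec_nth] bounded_linear_vec_nth)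

lemma bounded_linear_mat2I:
  assumes "\<And>i j. bounded_linear (\<lambda>x. f x $ i $ j)"
  shows "bounded_linear (f :: 'a::real_normed_vector \<Rightarrow> mat2)"
proof -
  have eq: "f = (\<lambda>x. f x $ 1 $ 1 *\<^sub>R matunit 1 1 + f x $ 1 $ 2 *\<^sub>R matunit 1 2 +
      f x $ 2 $ 1 *\<^sub>R matunit 2 1 + f x $ 2 $ 2 *\<^sub>R matunit 2 2)"
    by (rule ext, rule mat2_decomp)
  show ?thesis by (subst eq) (intro bounded_linear_add bounded_linear_scaleR_const assms)
qed

lemma smooth_on_mat2I:
  assumes "\<And>i j. smooth_on U (\<lambda>x. f x $ i $ j)"
  shows "smooth_on U (f :: plane \<Rightarrow> mat2)"
proof -
  have eq: "f = (\<lambda>x. f x $ 1 $ 1 *\<^sub>R matunit 1 1 + f x $ 1 $ 2 *\<^sub>R matunit 1 2 +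
      f x $ 2 $ 1 *\<^sub>R matunit 2 1 + f x $ 2 $ 2 *\<^sub>R matunit 2 2)"
    by (rule ext, rule mat2_decomp)
  show ?thesis
    by (subst eq, intro smooth_on_add) (rule smooth_on_linear[OF bounded_linear_scaleR_left assms])+
qed

lemma smooth_on_mat2I':
  assumes "smooth_on U (\<lambda>x. f x $ 1 $ 1)" "smooth_on U (\<lambda>x. f x $ 1 $ 2)"
    "smooth_on U (\<lambda>x. f x $ 2 $ 1)" "smooth_on U (\<lambda>x. f x $ 2 $ 2)"
  shows "smooth_on U (f :: plane \<Rightarrow> mat2)"
proof (rule smooth_on_mat2I)
  show "smooth_on U (\<lambda>x. f x $ i $ j)" for i j
    using exhaust_2[of i] exhaust_2[of j] assms by (elim disjE) simp_all
qed

text \<open>The projection \<open>P\<close> is that onto the eigenline of \<open>\<psi>\<close> for the eigenvalue \<open>-1\<close>. Read as complex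
  numbers, its columns are real multiples of a vector spanning this line, so that the sum of their
  squares is a positive multiple of the square of such a vector and has no zeros; a continuous square
  root of it is a nowhere vanishing eigenvector field.\<close>

lemma eigenvector_square_root:
  fixes p q r m :: real and s :: complex
  assumes P: "p + m = 1" "p * m = q * r" and s: "s\<^sup>2 = (Complex p r)\<^sup>2 + (Complex q m)\<^sup>2"
  shows "s \<noteq> 0" "p * Re s + q * Im s = Re s" "r * Re s + m * Im s = Im s"
proof -
  let ?u = "Complex p r" and ?v = "Complex q m"
  have real: "Im (?u * cnj ?v) = 0" "Im (?v * cnj ?u) = 0"
    using P(2) by (simp_all add: algebra_simps)
  \<comment> \<open>As v is a real multiple of u whenever u is nonzero, the square of
    \<open>s * cnj u\<close> is the real number n^2 + t^2 \<ge> 0. So \<open>s * cnj u\<close> is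
    real, that is, \<open>s\<close> is parallel to \<open>u\<close>.\<close>
  have key: "Im (s * cnj u) = 0" and nz: "u \<noteq> 0 \<Longrightarrow> s \<noteq> 0"
    if uv: "s\<^sup>2 = u\<^sup>2 + v\<^sup>2" "Im (v * cnj u) = 0" for u v
  proof -
    obtain t where t: "v * cnj u = of_real t" using uv(2) by (metis complex_eq_iff Im_complex_of_real Re_complex_of_real)
    obtain n where n: "u * cnj u = of_real n" "n = (norm u)\<^sup>2" using complex_norm_square[of u] by metis
    have "(s * cnj u)\<^sup>2 = (u * cnj u)\<^sup>2 + (v * cnj u)\<^sup>2"
      by (simp add: power_mult_distrib uv(1) algebra_simps)
    also have "\<dots> = of_real (n\<^sup>2 + t\<^sup>2)" by (simp add: n(1) t)
    finally have e: "(s * cnj u)\<^sup>2 = of_real (n\<^sup>2 + t\<^sup>2)" .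
    then have re: "(Re (s * cnj u))\<^sup>2 - (Im (s * cnj u))\<^sup>2 = n\<^sup>2 + t\<^sup>2" and im: "Re (s * cnj u) * Im (s * cnj u) = 0"
      by (simp_all only: complex_eq_iff Re_power2 Im_power2 Re_complex_of_real Im_complex_of_real) auto
    show "Im (s * cnj u) = 0"
    proof (rule ccontr)
      assume i: "Im (s * cnj u) \<noteq> 0"
      then have "Re (s * cnj u) = 0" using im by auto
      then have "- (Im (s * cnj u))\<^sup>2 = n\<^sup>2 + t\<^sup>2" using re by simp
      then show False using i by (smt (verit) zero_le_power2 zero_less_power2)
    qed
    show "s \<noteq> 0" if "u \<noteq> 0"
    proof
      assume "s = 0"
      then have "of_real (n\<^sup>2 + t\<^sup>2) = (0 :: complex)" using e by simp
      then have "n\<^sup>2 + t\<^sup>2 = 0" by (simp only: of_real_eq_0_iff)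
      then have "n = 0" by (simp add: sum_power2_eq_zero_iff)
      then show False using that n(2) by simp
    qed
  qed
  have "?u \<noteq> 0 \<or> ?v \<noteq> 0" using P(1) by (auto simp: complex_eq_iff)
  then show "s \<noteq> 0" using nz[OF s real(2)] nz[OF s[unfolded add.commute[of "?u\<^sup>2"]] real(1)] by blast
  have 1: "Im s * p = Re s * r" using key[OF s real(2)] by simp
  have 2: "Im s * q = Re s * m"
    using key[OF s[unfolded add.commute[of "?u\<^sup>2"]] real(1)] by simp
  have "p * Re s + q * Im s = (p + m) * Re s" using 2 by (simp add: algebra_simps)
  then show "p * Re s + q * Im s = Re s" using P(1) by simp
  have "r * Re s + m * Im s = (p + m) * Im s" using 1 by (simp add: algebra_simps)
  then show "r * Re s + m * Im s = Im s" using P(1) by simp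
qed

lemma lift_to_group:
  fixes \<psi> :: "plane \<Rightarrow> mat2"
  assumes D: "open D" "simply_connected D" "(0, 0) \<in> D"
    and \<psi>: "smooth_on D \<psi>" "\<psi> ` D \<subseteq> S21" "\<psi> (0, 0) = kmat"
  obtains F where "smooth_on D F" "F (0, 0) = mat 1" "\<forall>p\<in>D. det (F p) = 1" "\<forall>p\<in>D. \<psi> p ** F p = F p ** kmat"
proof -
  define P11 P12 P21 P22 where "P11 p = (1 - \<psi> p $ 1 $ 1) / 2" and "P12 p = - \<psi> p $ 1 $ 2 / 2"
    and "P21 p = - \<psi> p $ 2 $ 1 / 2" and "P22 p = (1 - \<psi> p $ 2 $ 2) / 2" for p
  have P: "P11 p + P22 p = 1" "P11 p * P22 p = P12 p * P21 p" if "p \<in> D" for p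
  proof -
    have "\<psi> p $ 2 $ 2 = - \<psi> p $ 1 $ 1"
      and "\<psi> p $ 1 $ 1 * \<psi> p $ 1 $ 1 + \<psi> p $ 1 $ 2 * \<psi> p $ 2 $ 1 + (\<psi> p $ 2 $ 1 * \<psi> p $ 1 $ 2 + \<psi> p $ 2 $ 2 * \<psi> p $ 2 $ 2) = 2"
      using \<psi>(2) that by (auto simp: S21_def ip_def trace2 matrix_mult_nth2)
    then show "P11 p + P22 p = 1" "P11 p * P22 p = P12 p * P21 p"
      by (simp_all add: P11_def P12_def P21_def P22_def field_simps)
  qed
  define z where "z p = (Complex (P11 p) (P21 p))\<^sup>2 + (Complex (P12 p) (P22 p))\<^sup>2" for p
  have ent: "smooth_on D (\<lambda>p. \<psi> p $ i $ j)" for i j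
    by (rule smooth_on_linear[OF bounded_linear_entry \<psi>(1)])
  have smP: "smooth_on D P11" "smooth_on D P12" "smooth_on D P21" "smooth_on D P22"
  proof -
    have "smooth_on D (\<lambda>p. c + (- 1 / 2) *\<^sub>R (\<psi> p $ i $ j))" for c i j
      by (intro smooth_on_add smooth_on_const smooth_on_linear[OF bounded_linear_scaleR_right] ent)
    from this[of "1/2" 1 1] this[of 0 1 2] this[of 0 2 1] this[of "1/2" 2 2]
    show "smooth_on D P11" "smooth_on D P12" "smooth_on D P21" "smooth_on D P22"
      by (simp_all add: P11_def[abs_def] P12_def[abs_def] P21_def[abs_def] P22_def[abs_def] diff_divide_distrib)
  qed
  have smC: "smooth_on D (\<lambda>p. Complex (f p) (g p))" if "smooth_on D f" "smooth_on D g" for f g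
    unfolding Complex_eq
    by (intro smooth_on_add smooth_on_linear[OF bounded_linear_of_real]
        smooth_on_linear[OF bounded_linear_compose[OF bounded_linear_mult_right bounded_linear_of_real]] that)
  have smz: "smooth_on D z"
    unfolding z_def power2_eq_square by (intro smooth_on_add smooth_on_mult smC smP)
  have z0: "z p \<noteq> 0" if "p \<in> D" for p
  proof
    assume "z p = 0"
    then show False using eigenvector_square_root(1)[OF P[OF that], of 0] by (simp add: z_def)
  qed
  have "locally path_connected D"
    using D(1) by (rule open_imp_locally_path_connected)
  then obtain s0 where s0: "continuous_on D s0" "\<And>p. p \<in> D \<Longrightarrow> z p = (s0 p)\<^sup>2"
    using continuous_sqrt_on_simply_connected[OF smooth_on_imp_continuous_on[OF smz] D(2) _ z0] by metis
  have z00: "z (0, 0) = 1"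
    by (simp add: z_def P11_def P12_def P21_def P22_def \<psi>(3) complex_eq_iff power2_eq_square)
  \<comment> \<open>At the origin the root is 1 or -1; multiplication by this sign normalizes it to
    1.\<close>
  define s where "s p = s0 p * s0 (0, 0)" for p
  have s: "(s p)\<^sup>2 = z p" if "p \<in> D" for p
    using s0(2)[OF that] s0(2)[OF D(3)] z00 by (simp add: s_def power_mult_distrib)
  have s1: "s (0, 0) = 1"
    using s0(2)[OF D(3)] z00 by (simp add: s_def power2_eq_square)
  have "continuous_on D s" unfolding s_def by (intro continuous_intros s0)
  from smooth_on_square_root[OF D(1) this s smz z0] have sms: "smooth_on D s" .
  define x y where "x p = Re (s p)" and "y p = Im (s p)" for p
  define N where "N p = x p * x p + y p * y p" for p
  have smxy: "smooth_on D x" "smooth_on D y"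
    unfolding x_def y_def by (intro smooth_on_linear[OF bounded_linear_Re] smooth_on_linear[OF bounded_linear_Im] sms)+
  have N0: "N p \<noteq> 0" and ev: "P11 p * x p + P12 p * y p = x p" "P21 p * x p + P22 p * y p = y p" if "p \<in> D" for p
    using eigenvector_square_root[OF P[OF that] s[OF that, unfolded z_def]]
    by (simp_all add: x_def y_def N_def complex_eq_iff sum_squares_eq_zero_iff)
  have "smooth_on D N" unfolding N_def by (intro smooth_on_add smooth_on_mult smxy)
  from smooth_on_inverse[OF D(1) this N0] have smN: "smooth_on D (\<lambda>p. inverse (N p))" .
  \<comment> \<open>The first column is the eigenvector s = (x, y) for the eigenvalue -1. The second
    is J P^T s / N with J the quarter turn: it lies in the kernel of P, the eigenline for 1, because
    P J P^T = (det P) J = 0, and the determinant is the inner product of P s = s with s, divided by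
    N, hence 1.\<close>
  define F :: "plane \<Rightarrow> mat2" where "F p = vector [vector [x p, - (P22 p * y p + P12 p * x p) * inverse (N p)],
      vector [y p, (P11 p * x p + P21 p * y p) * inverse (N p)]]" for p
  have Fn: "F p $ 1 $ 1 = x p" "F p $ 2 $ 1 = y p" "F p $ 1 $ 2 = - (P22 p * y p + P12 p * x p) * inverse (N p)"
    "F p $ 2 $ 2 = (P11 p * x p + P21 p * y p) * inverse (N p)" for p
    by (simp_all add: F_def)
  show thesis
  proof (rule that[of F])
    have "smooth_on D (\<lambda>p. - (P22 p * y p + P12 p * x p))"
      by (intro smooth_on_linear[OF bounded_linear_minus[OF bounded_linear_ident]] smooth_on_add smooth_on_mult smP smxy)
    then show "smooth_on D F"
      by (intro smooth_on_mat2I'; simp only: Fn) (intro smooth_on_mult smooth_on_add smP smxy smN | assumption)+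
    show "F (0, 0) = mat 1"
      by (simp add: mat2_eq_iff Fn x_def y_def N_def s1 P11_def P12_def P21_def P22_def \<psi>(3))
    show "\<forall>p\<in>D. det (F p) = 1"
    proof
      fix p assume p: "p \<in> D"
      have "x p * (P11 p * x p + P21 p * y p) + y p * (P22 p * y p + P12 p * x p) = N p"
        using arg_cong[OF ev(1)[OF p], of "\<lambda>t. x p * t"] arg_cong[OF ev(2)[OF p], of "\<lambda>t. y p * t"]
        by (simp add: N_def algebra_simps)
      moreover have "det (F p) =
          (x p * (P11 p * x p + P21 p * y p) + y p * (P22 p * y p + P12 p * x p)) * inverse (N p)"
        by (simp add: det_2 Fn algebra_simps)
      ultimately show "det (F p) = 1" using N0[OF p] by simp
    qed
    show "\<forall>p\<in>D. \<psi> p ** F p = F p ** kmat"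
    proof
      fix p assume p: "p \<in> D"
      have \<psi>P: "\<psi> p $ 1 $ 1 = 1 - 2 * P11 p" "\<psi> p $ 1 $ 2 = - 2 * P12 p" "\<psi> p $ 2 $ 1 = - 2 * P21 p" "\<psi> p $ 2 $ 2 = 1 - 2 * P22 p"
        by (simp_all add: P11_def P12_def P21_def P22_def field_simps)
      have o: "P11 p * - (P22 p * y p + P12 p * x p) + P12 p * (P11 p * x p + P21 p * y p) = 0"
        "P21 p * - (P22 p * y p + P12 p * x p) + P22 p * (P11 p * x p + P21 p * y p) = 0"
        using P(2)[OF p] by algebra+
      have o': "P11 p * F p $ 1 $ 2 + P12 p * F p $ 2 $ 2 = 0" "P21 p * F p $ 1 $ 2 + P22 p * F p $ 2 $ 2 = 0"
        unfolding Fn using arg_cong[OF o(1), of "\<lambda>t. t * inverse (N p)"] arg_cong[OF o(2), of "\<lambda>t. t * inverse (N p)"]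
        by (simp_all add: algebra_simps)
      have e': "P11 p * F p $ 1 $ 1 + P12 p * F p $ 2 $ 1 = F p $ 1 $ 1" "P21 p * F p $ 1 $ 1 + P22 p * F p $ 2 $ 1 = F p $ 2 $ 1"
        unfolding Fn by (rule ev[OF p])+
      show "\<psi> p ** F p = F p ** kmat"
        using o' e' by (simp add: mat2_eq_iff matrix_mult_nth2 \<psi>P algebra_simps)
    qed
  qed
qed

section \<open>The family of flat connections of a harmonic map\<close>

definition kpart :: "mat2 \<Rightarrow> mat2" where "kpart X = vector [vector [X $ 1 $ 1, 0], vector [0, X $ 2 $ 2]]"

definition mpart :: "mat2 \<Rightarrow> mat2" where "mpart X = vector [vector [0, X $ 1 $ 2], vector [X $ 2 $ 1, 0]]"

lemma kpart_nth [simp]: "kpart X $ 1 $ 1 = X $ 1 $ 1" "kpart X $ 1 $ 2 = 0" "kpart X $ 2 $ 1 = 0" "kpart X $ 2 $ 2 = X $ 2 $ 2"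
  and mpart_nth [simp]: "mpart X $ 1 $ 1 = 0" "mpart X $ 1 $ 2 = X $ 1 $ 2" "mpart X $ 2 $ 1 = X $ 2 $ 1" "mpart X $ 2 $ 2 = 0"
  by (simp_all add: kpart_def mpart_def)

lemma norm_kpart_le: "norm (kpart X) \<le> norm X" and norm_mpart_le: "norm (mpart X) \<le> norm X"
  by (simp_all add: norm_mat2)

lemma bounded_linear_kpart: "bounded_linear kpart" and bounded_linear_mpart: "bounded_linear mpart"
  by (rule bounded_linear_intro[of _ 1]; simp add: mat2_eq_iff norm_kpart_le norm_mpart_le)+

text \<open>The dilation \<open>r\<close> of the spectral parameter serves to control the growth of the coefficients of the
  framing.\<close>

definition conn :: "int \<Rightarrow> real \<Rightarrow> mat2 \<Rightarrow> loop"
  where "conn k r X = lmonom 0 (kpart X) + lmonom k (r powi k *\<^sub>R mpart X)"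

lemma bounded_linear_conn: "bounded_linear (conn k r)"
  unfolding conn_def[abs_def]
  by (intro bounded_linear_add bounded_linear_compose[OF bounded_linear_lmonom] bounded_linear_kpart
      bounded_linear_compose[OF bounded_linear_scaleR_right] bounded_linear_mpart)

lemma ladj_conn: "X $ 1 $ 1 + X $ 2 $ 2 = 0 \<Longrightarrow> ladj (conn k r X) = - conn k r X"
proof -
  assume "X $ 1 $ 1 + X $ 2 $ 2 = 0"
  then have "adj2 (kpart X) = - kpart X" "adj2 (r powi k *\<^sub>R mpart X) = - (r powi k *\<^sub>R mpart X)"
    by (auto intro!: adj2_traceless)
  then show ?thesis
    unfolding conn_def linear_add[OF bounded_linear.linear[OF bounded_linear_ladj]] ladj_lmonom
    by (simp only: lmonom_minus) simp
qed

lemma ltwist_conn: "odd k \<Longrightarrow> ltwist (conn k r X) = conn k r X"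
proof -
  assume "odd k"
  moreover have "\<sigma> (kpart X) = kpart X" "- \<sigma> (r powi k *\<^sub>R mpart X) = r powi k *\<^sub>R mpart X"
    by (simp_all add: mat2_eq_iff \<sigma>_nth)
  ultimately show ?thesis
    unfolding conn_def linear_add[OF bounded_linear.linear[OF bounded_linear_ltwist]] ltwist_lmonom by simp
qed

lemma has_derivative_bilinear_partials:
  assumes "bounded_bilinear B" "(f has_derivative partials fx fy) (at p)" "(g has_derivative partials gx gy) (at p)"
  shows "((\<lambda>q. B (f q) (g q)) has_derivative partials (B (f p) gx + B fx (g p)) (B (f p) gy + B fy (g p))) (at p)"
proof -
  interpret B: bounded_bilinear B by (rule assms(1))
  show ?thesis
    using B.FDERIV[OF assms(2,3)]
    by (simp add: B.add_left B.add_right B.scaleR_left B.scaleR_right algebra_simps)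
qed

lemma has_derivative_linear_partials:
  assumes "bounded_linear h" "(f has_derivative partials fx fy) (at p)"
  shows "((\<lambda>q. h (f q)) has_derivative partials (h fx) (h fy)) (at p)"
proof -
  interpret h: bounded_linear h by (rule assms(1))
  show ?thesis using h.has_derivative[OF assms(2)] by (simp add: h.add h.scaleR)
qed

lemma bounded_linear_adj2: "bounded_linear (adj2 :: mat2 \<Rightarrow> mat2)"
  using linear_adj2 by (simp add: linear_conv_bounded_linear)

text \<open>With c = [b, k'] one has \<open>\<psi>\<close>_y = F c F^(-1), and the mixed derivative
  is F ([a, c] + c_x) F^(-1). Harmonicity makes the bracket a multiple of k', so its off-diagonal
  part vanishes; dividing by 2k' gives the last equation. The preceding one is the symmetry of the
  second derivatives of \<open>F\<close>.\<close>

lemma lift_connection: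
  fixes \<psi> F :: "plane \<Rightarrow> mat2"
  assumes D: "open D" and \<psi>: "harmonic_map D \<psi>"
    and F: "smooth_on D F" "\<And>p. p \<in> D \<Longrightarrow> det (F p) = 1" "\<And>p. p \<in> D \<Longrightarrow> \<psi> p ** F p = F p ** kmat"
  obtains a b where "smooth_on D a" "smooth_on D b"
    "\<forall>p\<in>D. (F has_derivative partials (F p ** a p) (F p ** b p)) (at p)"
    "\<forall>p\<in>D. a p $ 1 $ 1 + a p $ 2 $ 2 = 0" "\<forall>p\<in>D. b p $ 1 $ 1 + b p $ 2 $ 2 = 0"
    "\<forall>p\<in>D. pdy a p + b p ** a p = pdx b p + a p ** b p"
    "\<forall>p\<in>D. mpart (pdx b p) + kpart (a p) ** mpart (b p) = mpart (b p) ** kpart (a p)"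
proof -
  define a b where "a p = adj2 (F p) ** pdx F p" and "b p = adj2 (F p) ** pdy F p" for p
  have sa: "smooth_on D a" and sb: "smooth_on D b"
    unfolding a_def b_def
    by (intro smooth_on_matrix_mult smooth_on_linear[OF bounded_linear_adj2] smooth_on_pd F(1) D)+
  have inv: "F p ** (adj2 (F p) ** X) = X" "adj2 (F p) ** (F p ** X) = X" "adj2 (F p) ** F p = mat 1"
    if "p \<in> D" for p X
  proof -
    have id: "F p ** adj2 (F p) = mat 1" "adj2 (F p) ** F p = mat 1"
      by (simp_all only: mult_adj2 adj2_mult_self F(2)[OF that])
    show "F p ** (adj2 (F p) ** X) = X" "adj2 (F p) ** (F p ** X) = X" "adj2 (F p) ** F p = mat 1"
      by (simp_all only: matrix_mul_assoc id matrix_mul_lid)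
  qed
  have cancel: "X = Y" if "p \<in> D" "F p ** X = F p ** Y" for p X Y
    using arg_cong[OF that(2), of "\<lambda>Z. adj2 (F p) ** Z"] by (simp only: inv(2)[OF that(1)])
  have pF: "pdx F p = F p ** a p" "pdy F p = F p ** b p" if "p \<in> D" for p
    by (simp_all only: a_def b_def inv(1)[OF that])
  have dF: "(F has_derivative partials (F p ** a p) (F p ** b p)) (at p)" if "p \<in> D" for p
    using smooth_on_has_derivative[OF F(1) that] by (simp add: pF[OF that])
  have tr: "a p $ 1 $ 1 + a p $ 2 $ 2 = 0 \<and> b p $ 1 $ 1 + b p $ 2 $ 2 = 0" if p: "p \<in> D" for p
  proof -
    note d = has_derivative_bilinear_partials[OF matrix_bilinear has_derivative_linear_partials[OF bounded_linear_adj2 dF[OF p]] dF[OF p]]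
    have e: "adj2 (F p ** X) ** F p = adj2 X" for X
      by (simp add: adj2_mult inv(3)[OF p] flip: matrix_mul_assoc)
    have "((\<lambda>q. mat 1) has_derivative partials (a p + adj2 (a p)) (b p + adj2 (b p))) (at p)"
      by (rule has_derivative_transform_within_open[OF d[unfolded e inv(2)[OF p]] D p]) (rule inv(3))
    from pd_eqI(1,2)[OF this] pd_eqI(1,2)[of "\<lambda>_. mat 1 :: mat2" 0 0 p]
    have "a p + adj2 (a p) = 0" "b p + adj2 (b p) = 0" by simp_all
    then show ?thesis by (simp add: mat2_eq_iff add.commute)
  qed
  have flat: "pdy a p + b p ** a p = pdx b p + a p ** b p" if p: "p \<in> D" for p
  proof -
    note sx = smooth_on_has_derivative[OF sa p] and sy = smooth_on_has_derivative[OF sb p]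
    have d1: "(pdx F has_derivative partials (F p ** pdx a p + F p ** a p ** a p) (F p ** pdy a p + F p ** b p ** a p)) (at p)"
      by (rule has_derivative_transform_within_open[OF has_derivative_bilinear_partials[OF matrix_bilinear dF[OF p] sx] D p])
        (rule pF(1)[symmetric])
    have d2: "(pdy F has_derivative partials (F p ** pdx b p + F p ** a p ** b p) (F p ** pdy b p + F p ** b p ** b p)) (at p)"
      by (rule has_derivative_transform_within_open[OF has_derivative_bilinear_partials[OF matrix_bilinear dF[OF p] sy] D p])
        (rule pF(2)[symmetric])
    have "F p ** pdx b p + F p ** a p ** b p = F p ** pdy a p + F p ** b p ** a p"
      using mixed_partials[OF D p F(1)] by (simp only: pd_eqI(2)[OF d1] pd_eqI(1)[OF d2])
    then have "F p ** (pdy a p + b p ** a p) = F p ** (pdx b p + a p ** b p)"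
      by (simp only: mat2.add_right matrix_mul_assoc)
    then show ?thesis by (rule cancel[OF p])
  qed
  have conj: "((\<lambda>q. F q ** X q ** adj2 (F q)) has_derivative
      partials (F p ** (a p ** X p - X p ** a p + Xx) ** adj2 (F p)) (F p ** (b p ** X p - X p ** b p + Xy) ** adj2 (F p))) (at p)"
    if p: "p \<in> D" and X: "(X has_derivative partials Xx Xy) (at p)" for p X Xx Xy
  proof -
    have n: "adj2 (F p ** a p) = - (a p ** adj2 (F p))" "adj2 (F p ** b p) = - (b p ** adj2 (F p))"
      using tr[OF p] by (simp_all add: adj2_mult adj2_traceless mat2.minus_left)
    show ?thesis
      using has_derivative_bilinear_partials[OF matrix_bilinear
          has_derivative_bilinear_partials[OF matrix_bilinear dF[OF p] X]
          has_derivative_linear_partials[OF bounded_linear_adj2 dF[OF p]]]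
      by (simp add: n mat2.add_left mat2.add_right mat2.diff_left mat2.diff_right mat2.minus_right
          matrix_mul_assoc algebra_simps)
  qed
  have \<psi>F: "F p ** kmat ** adj2 (F p) = \<psi> p" if "p \<in> D" for p
    using F(2,3)[OF that] by (simp add: mult_adj2 flip: F(3)[OF that] matrix_mul_assoc)
  define c where "c p = b p ** kmat - kmat ** b p" for p
  have pd\<psi>: "F p ** c p ** adj2 (F p) = pdy \<psi> p" if p: "p \<in> D" for p
  proof -
    have "((\<lambda>_. kmat :: mat2) has_derivative partials 0 0) (at p)" by simp
    from has_derivative_transform_within_open[OF conj[OF p this] D p \<psi>F] show ?thesis
      by (auto simp: c_def dest!: pd_eqI(2))
  qed
  have har: "mpart (pdx b p) + kpart (a p) ** mpart (b p) = mpart (b p) ** kpart (a p)" if p: "p \<in> D" for p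
  proof -
    define cx where "cx = pdx b p ** kmat - kmat ** pdx b p"
    have blc: "bounded_linear (\<lambda>X :: mat2. X ** kmat - kmat ** X)"
      by (intro bounded_linear_sub mat2.bounded_linear_left mat2.bounded_linear_right)
    have dc: "(c has_derivative partials cx (pdy b p ** kmat - kmat ** pdy b p)) (at p)"
      unfolding c_def[abs_def] cx_def
      by (rule has_derivative_linear_partials[OF blc smooth_on_has_derivative[OF sb p]])
    from has_derivative_transform_within_open[OF conj[OF p dc] D p pd\<psi>]
    have "pdx (pdy \<psi>) p = F p ** (a p ** c p - c p ** a p + cx) ** adj2 (F p)"
      by (rule pd_eqI(1))
    moreover obtain t where "pdx (pdy \<psi>) p = t *\<^sub>R \<psi> p"
      using \<psi> p by (auto simp: harmonic_map_def tension_field_def tangential_def)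
    moreover have "t *\<^sub>R \<psi> p = F p ** (t *\<^sub>R kmat) ** adj2 (F p)"
      unfolding \<psi>F[OF p, symmetric] by (simp only: mat2.scaleR_left mat2.scaleR_right)
    ultimately have "F p ** (a p ** c p - c p ** a p + cx) ** adj2 (F p) = F p ** (t *\<^sub>R kmat) ** adj2 (F p)"
      by simp
    from arg_cong[OF this, of "\<lambda>Y. Y ** F p"]
    have "F p ** (a p ** c p - c p ** a p + cx) = F p ** (t *\<^sub>R kmat)"
      by (simp only: matrix_mul_assoc[symmetric] inv(3)[OF p] matrix_mul_rid)
    then have "a p ** c p - c p ** a p + cx = t *\<^sub>R kmat" by (rule cancel[OF p])
    then show ?thesis
      by (simp add: mat2_eq_iff matrix_mult_nth2 c_def cx_def algebra_simps)
  qed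
  show thesis by (rule that[of a b]) (use sa sb dF tr flat har in auto)
qed

locale flat_family =
  fixes D :: "plane set" and a b :: "plane \<Rightarrow> mat2"
  assumes D: "open D" "simply_connected D" "(0, 0) \<in> D"
    and smooth: "smooth_on D a" "smooth_on D b"
    and traceless: "\<And>p. p \<in> D \<Longrightarrow> a p $ 1 $ 1 + a p $ 2 $ 2 = 0" "\<And>p. p \<in> D \<Longrightarrow> b p $ 1 $ 1 + b p $ 2 $ 2 = 0"
    and flat: "\<And>p. p \<in> D \<Longrightarrow> pdy a p + b p ** a p = pdx b p + a p ** b p"
    and harmonic: "\<And>p. p \<in> D \<Longrightarrow> mpart (pdx b p) + kpart (a p) ** mpart (b p) = mpart (b p) ** kpart (a p)"
begin

definition \<alpha> :: "real \<Rightarrow> plane \<Rightarrow> loop" where "\<alpha> r p = conn 1 r (a p)"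

definition \<beta> :: "real \<Rightarrow> plane \<Rightarrow> loop" where "\<beta> r p = conn (-1) r (b p)"

lemma smooth_conn: "smooth_on D (\<alpha> r)" "smooth_on D (\<beta> r)"
  unfolding \<alpha>_def[abs_def] \<beta>_def[abs_def]
  by (intro smooth_on_linear[OF bounded_linear_conn] smooth)+

lemma connected_D: "connected D"
  using D(2) by (rule simply_connected_imp_connected)

text \<open>Comparison of powers of \<lambda>: the power -1 is the harmonic equation, the power 0
  the diagonal part of flatness, and the power 1 its off-diagonal part after subtraction of the
  harmonic equation. The dilation merely multiplies the outer two by 1/r and r.\<close>

lemma conn_flat:
  assumes r: "r > 0" and p: "p \<in> D"
  shows "pdy (\<alpha> r) p + \<beta> r p * \<alpha> r p = pdx (\<beta> r) p + \<alpha> r p * \<beta> r p"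
proof -
  let ?A = "kpart (a p)" and ?B = "mpart (a p)" and ?C = "kpart (b p)" and ?E = "mpart (b p)"
  let ?ay = "pdy a p" and ?bx = "pdx b p"
  have pd: "pdy (\<alpha> r) p = conn 1 r ?ay" "pdx (\<beta> r) p = conn (-1) r ?bx"
    unfolding \<alpha>_def[abs_def] \<beta>_def[abs_def]
    by (rule pd_eqI(2)[OF has_derivative_linear_partials[OF bounded_linear_conn smooth_on_has_derivative[OF smooth(1) p]]]
        pd_eqI(1)[OF has_derivative_linear_partials[OF bounded_linear_conn smooth_on_has_derivative[OF smooth(2) p]]])+
  have f: "?ay $ i $ j + (b p ** a p) $ i $ j = ?bx $ i $ j + (a p ** b p) $ i $ j" for i j
    using arg_cong[OF flat[OF p], of "\<lambda>X. X $ i $ j"] by simp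
  have e2: "?E ** ?A = mpart ?bx + ?A ** ?E" using harmonic[OF p] by simp
  have e0: "kpart ?ay + ?C ** ?A + ?E ** ?B = kpart ?bx + ?A ** ?C + ?B ** ?E"
    using f[of 1 1] f[of 2 2] by (simp add: mat2_eq_iff matrix_mult_nth2 algebra_simps)
  have e1: "mpart ?ay + ?C ** ?B = ?B ** ?C"
    using f[of 1 2] f[of 2 1] e2 by (simp add: mat2_eq_iff matrix_mult_nth2 algebra_simps)
  have "pdy (\<alpha> r) p + \<beta> r p * \<alpha> r p =
      lmonom 0 (kpart ?ay + ?C ** ?A + ?E ** ?B) + lmonom 1 (r *\<^sub>R (mpart ?ay + ?C ** ?B)) +
      lmonom (-1) (inverse r *\<^sub>R (?E ** ?A))"
    using r unfolding pd \<alpha>_def \<beta>_def conn_def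
    by (simp add: distrib_left distrib_right lmonom_mult_lmonom lmonom_add mat2.scaleR_left mat2.scaleR_right
        scaleR_add_right power_int_minus)
  also have "\<dots> = lmonom 0 (kpart ?bx + ?A ** ?C + ?B ** ?E) + lmonom 1 (r *\<^sub>R (?B ** ?C)) +
      lmonom (-1) (inverse r *\<^sub>R (mpart ?bx + ?A ** ?E))"
    by (simp only: e0 e1 e2)
  also have "\<dots> = pdx (\<beta> r) p + \<alpha> r p * \<beta> r p"
    using r unfolding pd \<alpha>_def \<beta>_def conn_def
    by (simp add: distrib_left distrib_right lmonom_mult_lmonom lmonom_add mat2.scaleR_left mat2.scaleR_right
        scaleR_add_right power_int_minus)
  finally show ?thesis .
qed

text \<open>The connection is traceless, so \<open>ladj\<close> negates it and the derivative of
  \<open>\<Psi> * ladj \<Psi>\<close> cancels.\<close>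

lemma framing_det:
  assumes \<Psi>: "solves (\<alpha> r) (\<beta> r) D \<Psi>" "\<Psi> (0, 0) = 1" and p: "p \<in> D"
  shows "\<Psi> p * ladj (\<Psi> p) = 1"
proof -
  have d: "((\<lambda>q. \<Psi> q * ladj (\<Psi> q) - 1) has_derivative partials 0 0) (at q)" if q: "q \<in> D" for q
  proof -
    have dq: "(\<Psi> has_derivative partials (\<Psi> q * \<alpha> r q) (\<Psi> q * \<beta> r q)) (at q)"
      using \<Psi>(1) q by (simp add: solves_def)
    have n: "ladj (\<Psi> q * \<alpha> r q) = - (\<alpha> r q * ladj (\<Psi> q))" "ladj (\<Psi> q * \<beta> r q) = - (\<beta> r q * ladj (\<Psi> q))"
      using traceless[OF q] by (simp_all add: ladj_mult ladj_conn \<alpha>_def \<beta>_def)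
    show ?thesis
      using has_derivative_diff[OF has_derivative_bilinear_partials[OF bounded_bilinear_mult dq
            has_derivative_linear_partials[OF bounded_linear_ladj dq]] has_derivative_const[of 1]]
      by (simp add: n mult.assoc)
  qed
  have "\<Psi> p * ladj (\<Psi> p) - 1 = 0"
    by (rule linear_system_unique[OF D(1) connected_D D(3) _ d _ continuous_on_const[of _ 0] p])
      (simp_all add: \<Psi>(2))
  then show ?thesis by simp
qed

lemma framing_twist:
  assumes \<Psi>: "solves (\<alpha> r) (\<beta> r) D \<Psi>" "\<Psi> (0, 0) = 1" and p: "p \<in> D"
  shows "ltwist (\<Psi> p) = \<Psi> p"
proof -
  have s: "solves (\<alpha> r) (\<beta> r) D (\<lambda>q. ltwist (\<Psi> q))"
    unfolding solves_def
  proof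
    fix q assume q: "q \<in> D"
    then have dq: "(\<Psi> has_derivative partials (\<Psi> q * \<alpha> r q) (\<Psi> q * \<beta> r q)) (at q)"
      using \<Psi>(1) by (simp add: solves_def)
    show "((\<lambda>q. ltwist (\<Psi> q)) has_derivative partials (ltwist (\<Psi> q) * \<alpha> r q) (ltwist (\<Psi> q) * \<beta> r q)) (at q)"
      using has_derivative_linear_partials[OF bounded_linear_ltwist dq]
      by (simp add: ltwist_mult \<alpha>_def \<beta>_def ltwist_conn)
  qed
  show ?thesis
    by (rule solves_unique[OF D(1) connected_D smooth_on_imp_continuous_on[OF smooth_conn(1)]
          smooth_on_imp_continuous_on[OF smooth_conn(2)] s \<Psi>(1) D(3) _ p])
      (simp add: \<Psi>(2))
qed

end

text \<open>The coefficients \<open>u\<^sub>j\<close> of a solution for the dilated connection and \<open>r\<^sup>j v\<^sub>j\<close>, where \<open>v\<close> is a solution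
  for the original one, satisfy the same equations, but the latter need not be summable. Their difference
  becomes summable after multiplication with \<open>min 1 (r\<^sup>j) / r\<^sup>j\<close>.\<close>

definition wt :: "real \<Rightarrow> int \<Rightarrow> real" where "wt r j = min 1 (r powi j)"

definition wdiff :: "real \<Rightarrow> loop \<Rightarrow> loop \<Rightarrow> loop"
  where "wdiff r u v = lmap (\<lambda>j X. (wt r j * r powi (- j)) *\<^sub>R X) u - lmap (\<lambda>j X. wt r j *\<^sub>R X) v"

context
  fixes r :: real
  assumes r: "r > 0"
begin

lemma wt_pos: "wt r j > 0"
  using r by (simp add: wt_def)

text \<open>Multiplication by \<lambda>^k shifts the indices, so the ratio of neighbouring weights
  has to be bounded for the connection to act boundedly on weighted differences.\<close>

lemma wt_shift_le:
  assumes "k = 0 \<or> k = 1 \<or> k = -1"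
  shows "wt r j \<le> max r (inverse r) * wt r (j - k)"
proof -
  have \<rho>: "1 \<le> max r (inverse r)" using r by (cases "r \<ge> 1") (auto simp: one_le_inverse_iff le_max_iff_disj)
  have k: "r powi k \<le> max r (inverse r)" using assms \<rho> by (auto simp: power_int_minus)
  have "r powi j = r powi k * r powi (j - k)" using r by (simp flip: power_int_add)
  also have "\<dots> \<le> max r (inverse r) * r powi (j - k)" using k r by (intro mult_right_mono) auto
  finally show ?thesis using \<rho> by (simp add: wt_def min_def)
qed

lemma coeffwise_scale:
  assumes "\<And>j. \<bar>w j\<bar> \<le> K"
  shows "coeffwise (\<lambda>j X. w j *\<^sub>R X)"
  by (rule coeffwiseI[of _ K]) (auto intro: mult_right_mono assms linear_scaleR)

lemma coeffwise_wt: "coeffwise (\<lambda>j X. (wt r j * r powi (- j)) *\<^sub>R X)" "coeffwise (\<lambda>j X. wt r j *\<^sub>R X)"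
proof -
  have "wt r j * r powi (- j) \<le> r powi j * r powi (- j)" for j
    using r by (intro mult_right_mono) (auto simp: wt_def)
  moreover have "r powi j * r powi (- j) = 1" for j using r by (simp add: power_int_minus)
  ultimately have "wt r j * r powi (- j) \<le> 1" for j by simp
  then show "coeffwise (\<lambda>j X. (wt r j * r powi (- j)) *\<^sub>R X)"
    using wt_pos r by (intro coeffwise_scale[of _ 1]) (simp add: abs_mult less_imp_le)
  show "coeffwise (\<lambda>j X. wt r j *\<^sub>R X)"
    using wt_pos by (intro coeffwise_scale[of _ 1]) (simp add: less_imp_le, simp add: wt_def)
qed

lemma coeff_wdiff: "coeff (wdiff r u v) j = wt r j *\<^sub>R (r powi (- j) *\<^sub>R coeff u j - coeff v j)"
  by (simp add: wdiff_def coeff_minus coeff_lmap[OF coeffwise_wt(1)] coeff_lmap[OF coeffwise_wt(2)] scaleR_diff_right)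

text \<open>On the weighted difference this is right multiplication by \<open>lmonom k Z\<close>
  followed by the multiplier \<open>wt r j / wt r (j - k)\<close>; the factor
  \<open>r powi k\<close> on the dilated side compensates the shift in
  \<open>r powi (- j)\<close>.\<close>

lemma norm_wdiff_shift:
  assumes k: "k = 0 \<or> k = 1 \<or> k = -1"
  shows "norm (wdiff r (u * lmonom k (r powi k *\<^sub>R Z)) (v * lmonom k Z)) \<le> max r (inverse r) * (norm (wdiff r u v) * norm Z)"
proof -
  let ?S = "\<lambda>j X. (wt r j / wt r (j - k)) *\<^sub>R X" and ?\<rho> = "max r (inverse r)"
  have le: "\<bar>wt r j / wt r (j - k)\<bar> \<le> ?\<rho>" for j
    using wt_shift_le[OF k, of j] wt_pos[of j] wt_pos[of "j - k"] by (simp add: divide_le_eq)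
  have S: "coeffwise ?S" by (rule coeffwise_scale[OF le])
  have "lmap ?S (wdiff r u v * lmonom k Z) = wdiff r (u * lmonom k (r powi k *\<^sub>R Z)) (v * lmonom k Z)"
  proof (rule lmap_eqI[OF S])
    fix j
    have "r powi (- (j - k)) = r powi (- j) * r powi k"
      using r by (simp flip: power_int_add)
    then show "(wt r j / wt r (j - k)) *\<^sub>R coeff (wdiff r u v * lmonom k Z) j =
        coeff (wdiff r (u * lmonom k (r powi k *\<^sub>R Z)) (v * lmonom k Z)) j"
      using wt_pos[of "j - k"]
      by (simp add: coeff_wdiff coeff_mult_lmonom mat2.scaleR_left mat2.scaleR_right mat2.diff_left)
  qed
  moreover have "norm (lmap ?S (wdiff r u v * lmonom k Z)) \<le> ?\<rho> * norm (wdiff r u v * lmonom k Z)"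
    by (rule norm_lmap_le[OF S]) (simp only: norm_scaleR, rule mult_right_mono[OF le norm_ge_zero])
  moreover have "norm (wdiff r u v * lmonom k Z) \<le> norm (wdiff r u v) * norm Z"
    using norm_mult_ineq[of "wdiff r u v" "lmonom k Z"] by (simp add: norm_lmonom)
  ultimately show ?thesis using r by (smt (verit) mult_left_mono max.cobounded1)
qed

lemma wdiff_add: "wdiff r (u + u') (v + v') = wdiff r u v + wdiff r u' v'"
  by (rule loop_eqI) (simp add: coeff_wdiff coeff_add algebra_simps)

lemma norm_wdiff_conn:
  assumes k: "k = 1 \<or> k = -1"
  shows "norm (wdiff r (u * conn k r X) (v * conn k 1 X)) \<le> 2 * max r (inverse r) * norm X * norm (wdiff r u v)"
proof -
  let ?\<rho> = "max r (inverse r)" and ?w = "norm (wdiff r u v)"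
  have "wdiff r (u * conn k r X) (v * conn k 1 X) =
      wdiff r (u * lmonom 0 (r powi 0 *\<^sub>R kpart X)) (v * lmonom 0 (kpart X)) +
      wdiff r (u * lmonom k (r powi k *\<^sub>R mpart X)) (v * lmonom k (mpart X))"
    by (simp add: conn_def distrib_left wdiff_add)
  also have "norm \<dots> \<le> ?\<rho> * (?w * norm (kpart X)) + ?\<rho> * (?w * norm (mpart X))"
    using k by (intro order_trans[OF norm_triangle_ineq] add_mono norm_wdiff_shift) auto
  also have "\<dots> \<le> ?\<rho> * (?w * norm X) + ?\<rho> * (?w * norm X)"
    using r by (intro add_mono mult_left_mono norm_kpart_le norm_mpart_le) auto
  finally show ?thesis by (simp add: algebra_simps)
qed

lemma has_derivative_wdiff:
  assumes "(u has_derivative partials ux uy) (at p)" "(v has_derivative partials vx vy) (at p)"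
  shows "((\<lambda>q. wdiff r (u q) (v q)) has_derivative partials (wdiff r ux vx) (wdiff r uy vy)) (at p)"
  using has_derivative_diff[OF has_derivative_linear_partials[OF bounded_linear_lmap[OF coeffwise_wt(1)] assms(1)]
      has_derivative_linear_partials[OF bounded_linear_lmap[OF coeffwise_wt(2)] assms(2)]]
  by (simp add: wdiff_def algebra_simps)

end

section \<open>Framings with values in the analytic loop group\<close>

context flat_family
begin

text \<open>The derivative of the weighted difference is bounded by a continuous multiple of the
  difference itself, which is all that \<open>linear_system_unique\<close> requires. The weights are
  positive, so its vanishing gives every coefficient.\<close>

lemma framing_dilation:
  assumes r: "r > 0" and \<Phi>: "solves (\<alpha> r) (\<beta> r) D \<Phi>" "\<Phi> (0, 0) = 1"
    and \<Psi>: "solves (\<alpha> 1) (\<beta> 1) D \<Psi>" "\<Psi> (0, 0) = 1" and p: "p \<in> D"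
  shows "coeff (\<Phi> p) j = r powi j *\<^sub>R coeff (\<Psi> p) j"
proof -
  let ?e = "\<lambda>q. wdiff r (\<Phi> q) (\<Psi> q)" and ?\<rho> = "2 * max r (inverse r)"
  let ?\<kappa> = "\<lambda>q. ?\<rho> * norm (a q) + ?\<rho> * norm (b q)"
  have "?e p = 0"
  proof (rule linear_system_unique[OF D(1) connected_D D(3) _ _ _ _ p, where e = ?e])
    show "?e (0, 0) = 0"
      unfolding \<Phi>(2) \<Psi>(2) by (rule loop_eqI) (simp add: coeff_wdiff[OF r] coeff_one)
    show "(?e has_derivative partials (wdiff r (\<Phi> q * \<alpha> r q) (\<Psi> q * \<alpha> 1 q)) (wdiff r (\<Phi> q * \<beta> r q) (\<Psi> q * \<beta> 1 q))) (at q)"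
      if "q \<in> D" for q
      using \<Phi>(1) \<Psi>(1) that by (intro has_derivative_wdiff[OF r]) (auto simp: solves_def)
    show "continuous_on D ?\<kappa>"
      by (intro continuous_intros smooth_on_imp_continuous_on smooth)
    fix q h :: plane
    have h: "\<bar>fst h\<bar> \<le> norm h" "\<bar>snd h\<bar> \<le> norm h"
      using norm_fst_le[of "fst h" "snd h"] norm_snd_le[of "snd h" "fst h"] by simp_all
    have 1: "norm (wdiff r (\<Phi> q * \<alpha> r q) (\<Psi> q * \<alpha> 1 q)) \<le> ?\<rho> * norm (a q) * norm (?e q)"
      unfolding \<alpha>_def by (rule norm_wdiff_conn[OF r]) simp
    have 2: "norm (wdiff r (\<Phi> q * \<beta> r q) (\<Psi> q * \<beta> 1 q)) \<le> ?\<rho> * norm (b q) * norm (?e q)"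
      unfolding \<beta>_def by (rule norm_wdiff_conn[OF r]) simp
    have "norm (partials (wdiff r (\<Phi> q * \<alpha> r q) (\<Psi> q * \<alpha> 1 q)) (wdiff r (\<Phi> q * \<beta> r q) (\<Psi> q * \<beta> 1 q)) h) \<le>
        norm h * (?\<rho> * norm (a q) * norm (?e q)) + norm h * (?\<rho> * norm (b q) * norm (?e q))"
      by (rule order_trans[OF norm_triangle_ineq]) (simp only: norm_scaleR, intro add_mono mult_mono h 1 2; simp)
    then show "norm (partials (wdiff r (\<Phi> q * \<alpha> r q) (\<Psi> q * \<alpha> 1 q)) (wdiff r (\<Phi> q * \<beta> r q) (\<Psi> q * \<beta> 1 q)) h) \<le>
        ?\<kappa> q * norm (?e q) * norm h"
      by (simp add: algebra_simps)
  qed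
  then have "wt r j *\<^sub>R (r powi (- j) *\<^sub>R coeff (\<Phi> p) j - coeff (\<Psi> p) j) = 0"
    by (simp flip: coeff_wdiff[OF r])
  then have "coeff (\<Psi> p) j = r powi (- j) *\<^sub>R coeff (\<Phi> p) j"
    using wt_pos[OF r, of j] by simp
  then show ?thesis using r by (simp add: power_int_minus)
qed

lemma framing_exists:
  obtains \<Psi> where "solves (\<alpha> 1) (\<beta> 1) D \<Psi>" "smooth_on D \<Psi>" "\<Psi> (0, 0) = 1" "\<Psi> ` D \<subseteq> tLG"
proof -
  have ex: "\<exists>\<Psi>. \<Psi> (0, 0) = 1 \<and> solves (\<alpha> r) (\<beta> r) D \<Psi> \<and> smooth_on D \<Psi>" if "r > 0" for r
    using flat_solution[OF D smooth_conn conn_flat[OF that], where g = 1] by metis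
  obtain \<Psi> where \<Psi>: "\<Psi> (0, 0) = 1" "solves (\<alpha> 1) (\<beta> 1) D \<Psi>" "smooth_on D \<Psi>" using ex[of 1] by auto
  have "\<Psi> p \<in> tLG" if p: "p \<in> D" for p
  proof -
    have "dilatable (\<Psi> p)"
      unfolding dilatable_def
    proof (intro allI impI)
      fix r :: real assume r: "r > 0"
      obtain \<Phi> where "\<Phi> (0, 0) = 1" "solves (\<alpha> r) (\<beta> r) D \<Phi>" using ex[OF r] by blast
      then have "r powi j * norm (coeff (\<Psi> p) j) = norm (coeff (\<Phi> p) j)" for j
        using framing_dilation[OF r _ _ \<Psi>(2,1) p] r by simp
      then show "(\<lambda>j. r powi j * norm (coeff (\<Psi> p) j)) summable_on UNIV"
        using coeff_abs_summable[of "\<Phi> p"] by simp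
    qed
    then show ?thesis
      using framing_det[OF \<Psi>(2,1) p] framing_twist[OF \<Psi>(2,1) p] by (simp add: tLG_iff)
  qed
  then show thesis using that \<Psi> by blast
qed

text \<open>At \<lambda> = 1 the connection is the original one, so both sides solve the same linear
  system with the same initial value.\<close>

lemma framing_at_1:
  assumes \<Psi>: "solves (\<alpha> 1) (\<beta> 1) D \<Psi>" "\<Psi> (0, 0) = 1"
    and F: "\<And>p. p \<in> D \<Longrightarrow> (F has_derivative partials (F p ** a p) (F p ** b p)) (at p)" "F (0, 0) = mat 1"
    and p: "p \<in> D"
  shows "loop_at (\<Psi> p) 1 = F p"
proof -
  let ?L = "\<lambda>\<gamma>. loop_at \<gamma> (1 :: real)"
  let ?e = "\<lambda>q. ?L (\<Psi> q) - F q"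
  have bl: "bounded_linear ?L" by (rule bounded_linear_mat2I) (rule bounded_linear_loop_at, simp)
  have c1: "?L (conn k 1 X) = X" for k X
    unfolding conn_def linear_add[OF bounded_linear.linear[OF bl]]
    by (simp add: mat2_eq_iff loop_at_lmonom)
  have "?e p = 0"
  proof (rule linear_system_unique[OF D(1) connected_D D(3) _ _ _ _ p, where e = ?e])
    show "?e (0, 0) = 0" by (simp add: \<Psi>(2) F(2) loop_at_1)
    show "(?e has_derivative partials (?e q ** a q) (?e q ** b q)) (at q)" if q: "q \<in> D" for q
    proof -
      have dq: "(\<Psi> has_derivative partials (\<Psi> q * \<alpha> 1 q) (\<Psi> q * \<beta> 1 q)) (at q)"
        using \<Psi>(1) q by (simp add: solves_def)
      have "?L (\<Psi> q * \<alpha> 1 q) = ?L (\<Psi> q) ** a q" "?L (\<Psi> q * \<beta> 1 q) = ?L (\<Psi> q) ** b q"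
        by (simp_all add: loop_at_mult \<alpha>_def \<beta>_def c1)
      with has_derivative_diff[OF has_derivative_linear_partials[OF bl dq] F(1)[OF q]]
      show ?thesis by (simp add: mat2.diff_left algebra_simps)
    qed
    show "continuous_on D (\<lambda>q. norm (a q) + norm (b q))"
      by (intro continuous_intros smooth_on_imp_continuous_on smooth)
    fix q h :: plane
    have h: "\<bar>fst h\<bar> \<le> norm h" "\<bar>snd h\<bar> \<le> norm h"
      using norm_fst_le[of "fst h" "snd h"] norm_snd_le[of "snd h" "fst h"] by simp_all
    have "norm (partials (?e q ** a q) (?e q ** b q) h) \<le>
        norm h * (norm (?e q) * norm (a q)) + norm h * (norm (?e q) * norm (b q))"
      by (rule order_trans[OF norm_triangle_ineq])
        (simp only: norm_scaleR, intro add_mono mult_mono h norm_matrix_mult_le; simp)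
    then show "norm (partials (?e q ** a q) (?e q ** b q) h) \<le> (norm (a q) + norm (b q)) * norm (?e q) * norm h"
      by (simp add: algebra_simps)
  qed
  then show ?thesis by simp
qed

end

lemma Ad_kmat_eqI: "det g = 1 \<Longrightarrow> X ** g = g ** kmat \<Longrightarrow> X = Ad g kmat" for g :: mat2
  by (metis Ad_def matrix_inv_adj2 matrix_mul_assoc matrix_mul_rid mult_adj2)

lemma extended_framing_exists:
  assumes D: "open D" "simply_connected D" "(0, 0) \<in> D" and \<psi>: "harmonic_map D \<psi>" "\<psi> (0, 0) = kmat"
  obtains \<Psi> where "extended_framing D \<psi> \<Psi>"
proof -
  have "smooth_on D \<psi>" "\<psi> ` D \<subseteq> S21" using \<psi>(1) by (auto simp: harmonic_map_def)
  then obtain F where F: "smooth_on D F" "F (0, 0) = mat 1" "\<forall>p\<in>D. det (F p) = 1" "\<forall>p\<in>D. \<psi> p ** F p = F p ** kmat"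
    by (rule lift_to_group[where \<psi> = \<psi>, OF D _ _ \<psi>(2)])
  obtain a b where ab: "smooth_on D a" "smooth_on D b"
    "\<forall>p\<in>D. (F has_derivative partials (F p ** a p) (F p ** b p)) (at p)"
    "\<forall>p\<in>D. a p $ 1 $ 1 + a p $ 2 $ 2 = 0" "\<forall>p\<in>D. b p $ 1 $ 1 + b p $ 2 $ 2 = 0"
    "\<forall>p\<in>D. pdy a p + b p ** a p = pdx b p + a p ** b p"
    "\<forall>p\<in>D. mpart (pdx b p) + kpart (a p) ** mpart (b p) = mpart (b p) ** kpart (a p)"
    by (rule lift_connection[OF D(1) \<psi>(1) F(1) F(3)[rule_format] F(4)[rule_format]])
  interpret flat_family D a b
    by unfold_locales (use D ab in auto)
  obtain \<Psi> where \<Psi>: "solves (\<alpha> 1) (\<beta> 1) D \<Psi>" "smooth_on D \<Psi>" "\<Psi> (0, 0) = 1" "\<Psi> ` D \<subseteq> tLG"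
    by (rule framing_exists)
  have "extended_framing D \<psi> \<Psi>"
    unfolding extended_framing_def
  proof (intro conjI ballI \<Psi> exI)
    fix p assume p: "p \<in> D"
    have t: "\<Psi> p \<in> tLG" using \<Psi>(4) p by blast
    have "loop_at (\<Psi> p) 1 = F p"
      by (rule framing_at_1[OF \<Psi>(1,3) bspec[OF ab(3)] F(2) p])
    then show "\<psi> p = Ad (loop_at (\<Psi> p) 1) kmat"
      using F(3,4) p by (simp add: Ad_kmat_eqI)
    have "(\<Psi> has_derivative partials (\<Psi> p * \<alpha> 1 p) (\<Psi> p * \<beta> 1 p)) (at p)"
      using \<Psi>(1) p by (simp add: solves_def)
    from pd_eqI(1,2)[OF this] have "linv (\<Psi> p) * pdx \<Psi> p = \<alpha> 1 p" "linv (\<Psi> p) * pdy \<Psi> p = \<beta> 1 p"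
      by (simp_all add: linv_eq_ladj[OF t] ladj_mult_self[OF t] flip: mult.assoc)
    then show "linv (\<Psi> p) * pdx \<Psi> p = lmonom 0 (kpart (a p)) + lmonom 1 (mpart (a p))"
      "linv (\<Psi> p) * pdy \<Psi> p = lmonom 0 (kpart (b p)) + lmonom (-1) (mpart (b p))"
      by (simp_all add: \<alpha>_def \<beta>_def conn_def)
    show "kpart (a p) \<in> k_sub" "mpart (a p) \<in> m_sub" "kpart (b p) \<in> k_sub" "mpart (b p) \<in> m_sub"
      using traceless[OF p] by (simp_all add: k_sub_iff m_sub_iff)
  qed
  then show thesis by (rule that)
qed

section \<open>The Weierstrass representation\<close>

lemma constant_lmonom_in_tLG:
  assumes "det X = 1" "X $ 1 $ 2 = 0" "X $ 2 $ 1 = 0"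
  shows "lmonom 0 X \<in> tLG_side s"
proof -
  have "\<sigma> X = X" using assms(2,3) by (simp add: mat2_eq_iff \<sigma>_nth)
  then show ?thesis
    by (simp add: tLG_side_def ldeg_lmonom tLG_iff ladj_lmonom ltwist_lmonom lmonom_mult_lmonom
        mult_adj2 assms(1) dilatable_lmonom)
qed

lemma det_loop_at_1:
  assumes "\<gamma> \<in> tLG"
  shows "det (loop_at \<gamma> (1 :: real)) = 1"
proof -
  have "mat (det (loop_at \<gamma> 1)) = (mat 1 :: mat2)"
    using loop_at_mult[of "1 :: real" \<gamma> "ladj \<gamma>"]
    by (simp add: mult_ladj_self[OF assms] loop_at_ladj mult_adj2 loop_at_1)
  then show ?thesis by (metis mat_nth2(1))
qed

lemma constant_on_segment:
  fixes g :: "real \<Rightarrow> 'b::real_normed_vector"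
  assumes "\<And>t. t \<in> closed_segment 0 c \<Longrightarrow> (g has_vector_derivative 0) (at t)"
  shows "g c = g 0"
proof -
  obtain k where "\<And>x. x \<in> closed_segment 0 c \<Longrightarrow> g x = k"
    using has_vector_derivative_zero_constant[OF convex_closed_segment[of 0 c], of g]
      has_vector_derivative_at_within[OF assms] by metis
  then show ?thesis by simp
qed

text \<open>By uniqueness 1 = 1 * 1 is the only splitting of 1; this supplies the initial conditions
  of the Weierstrass data.\<close>

lemma splitting_at_one:
  assumes "splits_on U \<Psi> \<Psi>m Lp \<Psi>p Lm" "p \<in> U" "\<Psi> p = 1"
  shows "\<Psi>m p = 1" "\<Psi>p p = 1"
proof -
  have s: "\<Psi>m p \<in> tLG_star (- (- 1))" "Lp p \<in> tLG_side (- 1)" "\<Psi>m p * Lp p = 1 * 1"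
    "\<Psi>p p \<in> tLG_star (- 1)" "Lm p \<in> tLG_side 1" "\<Psi>p p * Lm p = 1 * 1"
    using assms by (auto simp: splits_on_def tLG_side_simps)
  have o: "1 \<in> tLG_side s" for s using one_in_tLG_star[of s] by (simp add: tLG_star_def)
  show "\<Psi>m p = 1" by (rule factor_unique(1)[OF _ s(1) one_in_tLG_star s(2) o s(3)]) simp
  show "\<Psi>p p = 1" by (rule factor_unique(1)[OF _ s(4) one_in_tLG_star s(5) o s(6)]) simp
qed

text \<open>The Iwasawa decomposition of \<open>(\<Psi>\<^sub>+, \<Psi>\<^sub>-)\<close> is \<open>(\<Psi> k, \<Psi> k) ((L\<^sub>- k)\<inverse>, (L\<^sub>+ k)\<inverse>)\<close>, where the constant \<open>k\<close>
  normalizes \<open>L\<^sub>-\<close>; the gauge \<open>k\<close> does not change the harmonic map.\<close>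

lemma weierstrass_from_splitting:
  assumes D: "open D" "U \<subseteq> D" and U: "open U" "(0, 0) \<in> U"
    and fr: "extended_framing D \<psi> \<Psi>" and sp: "splits_on U \<Psi> \<Psi>m Lp \<Psi>p Lm"
  shows "\<exists>\<eta>1 \<eta>2 \<Phi>. valued_in U m_sub \<eta>1 \<and> lorentz_holomorphic U \<eta>1 \<and>
      valued_in U m_sub \<eta>2 \<and> lorentz_antiholomorphic U \<eta>2 \<and>
      weierstrass_rep U (\<lambda>p h. lmonom 1 (\<eta>1 p h)) (\<lambda>p h. lmonom (-1) (\<eta>2 p h)) \<Phi> \<and>
      (\<forall>p\<in>U. \<psi> p = Ad (loop_at (\<Phi> p) 1) kmat)"
proof -
  obtain H1 H2 where H': "smooth_on U \<Psi>m" "smooth_on U \<Psi>p" "smooth_on U H1" "smooth_on U H2"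
    "\<forall>p\<in>U. H1 p \<in> m_sub" "\<forall>p\<in>U. H2 p \<in> m_sub"
    "\<forall>p\<in>U. (\<Psi>p has_derivative partials (\<Psi>p p * lmonom 1 (H1 p)) 0) (at p)"
    "\<forall>p\<in>U. (\<Psi>m has_derivative partials 0 (\<Psi>m p * lmonom (-1) (H2 p))) (at p)"
    "\<forall>p\<in>U. pdy H1 p = 0" "\<forall>p\<in>U. pdx H2 p = 0"
    by (rule splitting_factors[OF U(1) fr D sp])
  note H = H'[rule_format]
  let ?\<eta>1 = "\<lambda>p h. fst h *\<^sub>R H1 p" and ?\<eta>2 = "\<lambda>p h. snd h *\<^sub>R H2 p"
  have sp': "\<Psi>m p \<in> tLG_star 1" "Lp p \<in> tLG_side (-1)" "\<Psi>p p \<in> tLG_star (-1)" "Lm p \<in> tLG_side 1"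
    "\<Psi> p = \<Psi>m p * Lp p" "\<Psi> p = \<Psi>p p * Lm p" if "p \<in> U" for p
    using sp that by (auto simp: splits_on_def tLG_side_simps)
  have t\<Psi>: "\<Psi> p \<in> tLG" and \<psi>: "\<psi> p = Ad (loop_at (\<Psi> p) 1) kmat" if "p \<in> U" for p
    using fr that D(2) by (auto simp: extended_framing_def)
  \<comment> \<open>The constant term of \<open>Lm p\<close> is diagonal of determinant 1, so its
    adjugate is its inverse and takes values in K.\<close>
  define k where "k p = adj2 (coeff (Lm p) 0)" for p
  have k: "det (k p) = 1" "k p $ 1 $ 2 = 0" "k p $ 2 $ 1 = 0" "coeff (Lm p) 0 ** k p = mat 1" if "p \<in> U" for p
  proof -
    show 1: "coeff (Lm p) 0 ** k p = mat 1"
      unfolding k_def using sp'(4)[OF that] by (intro tLG_side_coeff_0) auto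
    have "mat (det (coeff (Lm p) 0)) = (mat 1 :: mat2)" using 1 by (simp add: k_def mult_adj2)
    then have "det (coeff (Lm p) 0) = 1" by (metis mat_nth2(1))
    then show "det (k p) = 1" by (simp add: k_def det_2 algebra_simps)
    show "k p $ 1 $ 2 = 0" "k p $ 2 $ 1 = 0"
      using tLG_coeff_0[OF tLG_sideD(1)[OF sp'(4)[OF that]]] by (simp_all add: k_def)
  qed
  define d where "d p = lmonom 0 (k p)" for p
  \<comment> \<open>A constant loop has powers bounded by 0 from both sides, so the same gauge can
    be absorbed into \<open>Lm\<close> and into \<open>Lp\<close>.\<close>
  have ds: "d p \<in> tLG_side s" if "p \<in> U" for p s
    unfolding d_def by (rule constant_lmonom_in_tLG[OF k(1-3)[OF that]])
  define \<Phi> where "\<Phi> p = \<Psi> p * d p" for p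
  have dt: "d p \<in> tLG" if "p \<in> U" for p using tLG_sideD(1)[OF ds[OF that]] .
  have cancel: "F = \<Phi> p * linv (L * d p)"
    if p: "p \<in> U" and L: "L \<in> tLG" "\<Psi> p = F * L" for p F L
  proof -
    have "\<Phi> p * linv (L * d p) = F * (L * (d p * ladj (d p)) * ladj L)"
      by (simp add: \<Phi>_def L(2) linv_eq_ladj[OF tLG_mult[OF L(1) dt[OF p]]] ladj_mult mult.assoc)
    then show ?thesis by (simp add: mult_ladj_self[OF dt[OF p]] mult_ladj_self[OF L(1)])
  qed
  have \<Psi>0: "\<Psi> (0, 0) = 1" using fr by (simp add: extended_framing_def)
  note one = splitting_at_one[OF sp U(2) \<Psi>0]
  have W: "weierstrass_rep U (\<lambda>p h. lmonom 1 (?\<eta>1 p h)) (\<lambda>p h. lmonom (-1) (?\<eta>2 p h)) \<Phi>"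
    unfolding weierstrass_rep_def
  proof (rule exI[of _ \<Psi>p], rule exI[of _ \<Psi>m], rule exI[of _ "\<lambda>p. Lm p * d p"],
      rule exI[of _ "\<lambda>p. Lp p * d p"], intro conjI ballI allI impI H(1,2))
    fix p assume p: "p \<in> U"
    note d1 = pd_eqI(1,2)[OF H(7)[OF p]] and d2 = pd_eqI(1,2)[OF H(8)[OF p]]
    show "d1 \<Psi>p p h = \<Psi>p p * lmonom 1 (?\<eta>1 p h)" for h
      by (simp only: d1_def d1 lmonom_scaleR mult_scaleR_right)
    show "pdy \<Psi>p p = 0" by (rule d1(2))
    show "d2 \<Psi>m p h = \<Psi>m p * lmonom (-1) (?\<eta>2 p h)" for h
      by (simp only: d2_def d2 lmonom_scaleR mult_scaleR_right)
    show "pdx \<Psi>m p = 0" by (rule d2(1))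
    show "\<Phi> p \<in> tLG" unfolding \<Phi>_def by (intro tLG_mult t\<Psi> dt p)
    have "coeff (Lm p * d p) 0 = mat 1"
      using k(4)[OF p] by (simp add: d_def coeff_mult_lmonom)
    then show "Lm p * d p \<in> tLG_minus_star"
      using tLG_side_mult[OF sp'(4)[OF p] ds[OF p]] by (simp add: tLG_side_simps tLG_star_def)
    show "Lp p * d p \<in> tLG_plus"
      using tLG_side_mult[OF sp'(2)[OF p] ds[OF p]] by (simp add: tLG_side_simps)
    show "\<Psi>p p = \<Phi> p * linv (Lm p * d p)"
      using sp'[OF p] by (intro cancel[OF p]) (auto dest: tLG_sideD(1))
    show "\<Psi>m p = \<Phi> p * linv (Lp p * d p)"
      using sp'[OF p] by (intro cancel[OF p]) (auto dest: tLG_sideD(1))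
  next
    fix y assume y: "closed_segment (0, 0) (0, y) \<subseteq> U"
    have "\<Psi>p (0, y) = \<Psi>p (0, 0)"
    proof (rule constant_on_segment)
      fix t assume "t \<in> closed_segment 0 y"
      then have "(0, t) \<in> closed_segment (0, 0) (0 :: real, y)"
        by (auto simp: closed_segment_def)
      then show "((\<lambda>t. \<Psi>p (0, t)) has_vector_derivative 0) (at t)"
        using pd_eqI(4)[OF H(7)] y by fastforce
    qed
    then show "\<Psi>p (0, y) = 1" using one by simp
  next
    fix x assume x: "closed_segment (0, 0) (x, 0) \<subseteq> U"
    have "\<Psi>m (x, 0) = \<Psi>m (0, 0)"
    proof (rule constant_on_segment)
      fix t assume "t \<in> closed_segment 0 x"
      then have "(t, 0) \<in> closed_segment (0, 0) (x, 0 :: real)"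
        by (auto simp: closed_segment_def)
      then show "((\<lambda>t. \<Psi>m (t, 0)) has_vector_derivative 0) (at t)"
        using pd_eqI(3)[OF H(8)] x by fastforce
    qed
    then show "\<Psi>m (x, 0) = 1" using one by simp
  qed
  have "\<psi> p = Ad (loop_at (\<Phi> p) 1) kmat" if p: "p \<in> U" for p
  proof (rule Ad_kmat_eqI)
    let ?g = "loop_at (\<Psi> p) (1 :: real)"
    have "\<Phi> p \<in> tLG" unfolding \<Phi>_def by (intro tLG_mult t\<Psi> dt p)
    then show "det (loop_at (\<Phi> p) (1 :: real)) = 1" by (rule det_loop_at_1)
    have "loop_at (d p) (1 :: real) = k p"
      by (simp add: d_def mat2_eq_iff loop_at_lmonom)
    then have \<Phi>1: "loop_at (\<Phi> p) 1 = ?g ** k p" by (simp add: \<Phi>_def loop_at_mult)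
    have "\<psi> p ** ?g = ?g ** kmat"
      unfolding \<psi>[OF p] Ad_def matrix_inv_adj2[OF det_loop_at_1[OF t\<Psi>[OF p]]]
      by (simp only: matrix_mul_assoc[symmetric] adj2_mult_self det_loop_at_1[OF t\<Psi>[OF p]] matrix_mul_rid)
    \<comment> \<open>K is the isotropy group of k', which is why the gauge leaves the harmonic map
      unchanged.\<close>
    moreover have "kmat ** k p = k p ** kmat"
      using k[OF p] by (simp add: mat2_eq_iff matrix_mult_nth2)
    ultimately show "\<psi> p ** loop_at (\<Phi> p) 1 = loop_at (\<Phi> p) 1 ** kmat"
      unfolding \<Phi>1 by (metis matrix_mul_assoc)
  qed
  moreover have "r *\<^sub>R X \<in> m_sub" if "X \<in> m_sub" for r X using that by (simp add: m_sub_iff)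
  then have "valued_in U m_sub ?\<eta>1" "valued_in U m_sub ?\<eta>2"
    using H(5,6) by (simp_all add: valued_in_def)
  moreover have "lorentz_holomorphic U ?\<eta>1" "lorentz_antiholomorphic U ?\<eta>2"
    unfolding lorentz_holomorphic_def lorentz_antiholomorphic_def using H by blast+
  ultimately show ?thesis using W by blast
qed

theorem theorem4p4:
  fixes D :: "plane set"
  assumes "open D" and "simply_connected D" and "(0, 0) \<in> D"
  shows "(\<forall>\<psi> \<Psi>. harmonic_map D \<psi> \<and> \<psi> (0, 0) = kmat \<and> extended_framing D \<psi> \<Psi> \<longrightarrow>
           (let U = D - sing_set D \<Psi> in
              open U \<and> (0, 0) \<in> U \<and>
              (\<exists>\<Psi>m Lp \<Psi>p Lm. splits_on U \<Psi> \<Psi>m Lp \<Psi>p Lm) \<and>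
              (\<forall>\<Psi>m Lp \<Psi>p Lm. splits_on U \<Psi> \<Psi>m Lp \<Psi>p Lm \<longrightarrow>
                 smooth_on U \<Psi>m \<and> smooth_on U \<Psi>p \<and>
                 (\<exists>\<eta>1 \<eta>2.
                    (\<forall>p\<in>U. \<forall>h. lmonom 0 (\<eta>1 p h) = lpow (-1) * linv (\<Psi>p p) * ext_d \<Psi>p p h \<and>
                                lmonom 0 (\<eta>2 p h) = lpow 1 * linv (\<Psi>m p) * ext_d \<Psi>m p h) \<and>
                    valued_in U m_sub \<eta>1 \<and> lorentz_holomorphic U \<eta>1 \<and>
                    valued_in U m_sub \<eta>2 \<and> lorentz_antiholomorphic U \<eta>2))))
       \<and> (\<forall>\<psi>. harmonic_map D \<psi> \<and> \<psi> (0, 0) = kmat \<longrightarrow>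
           (\<exists>\<Psi>. extended_framing D \<psi> \<Psi> \<and>
             (let U = D - sing_set D \<Psi> in
              \<exists>\<eta>1 \<eta>2 \<Phi>.
                valued_in U m_sub \<eta>1 \<and> lorentz_holomorphic U \<eta>1 \<and>
                valued_in U m_sub \<eta>2 \<and> lorentz_antiholomorphic U \<eta>2 \<and>
                weierstrass_rep U (\<lambda>p h. lmonom 1 (\<eta>1 p h)) (\<lambda>p h. lmonom (-1) (\<eta>2 p h)) \<Phi> \<and>
                (\<forall>p\<in>U. \<psi> p = Ad (loop_at (\<Phi> p) 1) kmat))))"
proof (intro conjI allI impI; elim conjE)
  fix \<psi> \<Psi> assume fr: "extended_framing D \<psi> \<Psi>"
  define U where "U = D - sing_set D \<Psi>"
  have U: "open U" "(0, 0) \<in> U" "\<exists>\<Psi>m Lp \<Psi>p Lm. splits_on U \<Psi> \<Psi>m Lp \<Psi>p Lm"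
    unfolding U_def by (rule regular_set[OF assms(1,3) fr])+
  have "U \<subseteq> D" by (auto simp: U_def)
  note potentials = splitting_potentials[OF U(1) fr assms(1) this]
  show "let U = D - sing_set D \<Psi> in
              open U \<and> (0, 0) \<in> U \<and>
              (\<exists>\<Psi>m Lp \<Psi>p Lm. splits_on U \<Psi> \<Psi>m Lp \<Psi>p Lm) \<and>
              (\<forall>\<Psi>m Lp \<Psi>p Lm. splits_on U \<Psi> \<Psi>m Lp \<Psi>p Lm \<longrightarrow>
                 smooth_on U \<Psi>m \<and> smooth_on U \<Psi>p \<and>
                 (\<exists>\<eta>1 \<eta>2.
                    (\<forall>p\<in>U. \<forall>h. lmonom 0 (\<eta>1 p h) = lpow (-1) * linv (\<Psi>p p) * ext_d \<Psi>p p h \<and>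
                                lmonom 0 (\<eta>2 p h) = lpow 1 * linv (\<Psi>m p) * ext_d \<Psi>m p h) \<and>
                    valued_in U m_sub \<eta>1 \<and> lorentz_holomorphic U \<eta>1 \<and>
                    valued_in U m_sub \<eta>2 \<and> lorentz_antiholomorphic U \<eta>2))"
    unfolding Let_def U_def[symmetric]
    by (rule conjI[OF U(1) conjI[OF U(2) conjI[OF U(3)]]]) (intro allI impI, rule potentials)
next
  fix \<psi> assume \<psi>: "harmonic_map D \<psi>" "\<psi> (0, 0) = kmat"
  obtain \<Psi> where fr: "extended_framing D \<psi> \<Psi>"
    by (rule extended_framing_exists[OF assms \<psi>])
  define U where "U = D - sing_set D \<Psi>"
  have U: "open U" "(0, 0) \<in> U" "\<exists>\<Psi>m Lp \<Psi>p Lm. splits_on U \<Psi> \<Psi>m Lp \<Psi>p Lm"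
    unfolding U_def by (rule regular_set[OF assms(1,3) fr])+
  have "U \<subseteq> D" by (auto simp: U_def)
  then show "\<exists>\<Psi>. extended_framing D \<psi> \<Psi> \<and>
             (let U = D - sing_set D \<Psi> in
              \<exists>\<eta>1 \<eta>2 \<Phi>.
                valued_in U m_sub \<eta>1 \<and> lorentz_holomorphic U \<eta>1 \<and>
                valued_in U m_sub \<eta>2 \<and> lorentz_antiholomorphic U \<eta>2 \<and>
                weierstrass_rep U (\<lambda>p h. lmonom 1 (\<eta>1 p h)) (\<lambda>p h. lmonom (-1) (\<eta>2 p h)) \<Phi> \<and>
                (\<forall>p\<in>U. \<psi> p = Ad (loop_at (\<Phi> p) 1) kmat))"
    using U(3) weierstrass_from_splitting[OF assms(1) _ U(1,2) fr] fr
    unfolding Let_def U_def by blast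
qed

end
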